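(* Let $F_2$ be the free group of rank $2$ and let $\mathbb Z$ act trivially on $F_2$. For $w\in F_2$ let $d_w\colon\mathbb Z\to F_2$ be the derivation (homomorphism) determined by $d_w(1)=w$. Then $\mathrm{tc}(d_w)=2$ for every $w\ne 1$.
   Context: All groups are discrete. When $G$ (written multiplicatively) acts by automorphisms on $K$ (written additively in the general definitions below, not necessarily abelian), $(g,k)\mapsto g\cdot k$, the semi-direct product $K\rtimes G$ is the set $K\times G$ with $(k,g)(k',g')=(k+g\cdot k',gg')$, with projection $p(k,g)=g$; for the trivial action this is $K\times G$. A derivation is a function $d\colon G\to K$ with $d(gh)=d(g)+g\cdot d(h)$ (a homomorphism if the action is trivial); it determines the splitting $s_d(g)=(d(g),g)$ of $p$. A functorial classifying space construction gives a fibration $Bp\colon B(K\rtimes G)\to BG$ with fibre $BK$ and section $B(s_d)$. For a fibration $q\colon E\to Y$, $\mathrm{secat}(q)$ is the minimal $n$ such that $Y$ has an open cover $U_0,\dots,U_n$ with each $U_i$ admitting a section $U_i\to E$ of $q$. For a fibration $q\colon X\to B$ with section $s$, let $P_BX=\{\alpha\colon I\to X \text{ continuous}\mid q\circ\alpha \text{ constant},\ \alpha(0)=s(q(\alpha(0)))\}$ and $\mathrm{ev}_1\colon P_BX\to X$, $\alpha\mapsto\alpha(1)$. The complexity of $d$ is the $BG$-parametrized LS-category of $B(K\rtimes G)$ with respect to the section $B(s_d)$ of $Bp$, that is, $$\mathrm{tc}(d):=\mathrm{cat}_{BG}(B(K\rtimes G))=\mathrm{secat}\big(\mathrm{ev}_1\colon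 P_{BG}B(K\rtimes G)\to B(K\rtimes G)\big).$$ *)

theory Defs
  imports
    "HOL-Algebra.Elementary_Groups"
    "HOL-Algebra.Bij"
    "HOL-Homology.Homology"
    "HOL-Library.Extended_Nat"
begin

section \<open>Free groups\<close>

text \<open>A letter is a generator together with a sign (\<open>True\<close> for the generator itself,
  \<open>False\<close> for its inverse). Elements of the free group are the reduced words.\<close>

type_synonym 'a letter = "'a \<times> bool"

definition inv_letter :: "'a letter \<Rightarrow> 'a letter" where
  "inv_letter x = (fst x, \<not> snd x)"

definition reduced :: "'a letter list \<Rightarrow> bool" where
  "reduced = successively (\<lambda>x y. y \<noteq> inv_letter x)"

fun push_letter :: "'a letter \<Rightarrow> 'a letter list \<Rightarrow> 'a letter list" where
  "push_letter x [] = [x]"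
| "push_letter x (y # ys) = (if y = inv_letter x then ys else x # y # ys)"

text \<open>For reduced \<open>u\<close> and \<open>v\<close>, \<open>foldr push_letter u v\<close> is the reduced form of \<open>u @ v\<close>.\<close>

definition free_group :: "'a set \<Rightarrow> 'a letter list monoid" where
  "free_group X = \<lparr>carrier = {w \<in> lists (X \<times> UNIV). reduced w},
     mult = foldr push_letter, one = []\<rparr>"

definition F2 :: "nat letter list monoid" where
  "F2 = free_group {..<2}"

lemma inv_letter_inv_letter [simp]: "inv_letter (inv_letter x) = x"
  by (simp add: inv_letter_def)

lemma inv_letter_neq [simp]: "inv_letter x \<noteq> x" "x \<noteq> inv_letter x"
  by (auto simp: inv_letter_def prod_eq_iff)

lemma reduced_Nil [simp]: "reduced []"
  by (simp add: reduced_def)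

lemma reduced_Cons: "reduced (x # xs) \<longleftrightarrow> xs = [] \<or> hd xs \<noteq> inv_letter x \<and> reduced xs"
  by (auto simp: reduced_def successively_Cons)

lemma reduced_push: "reduced w \<Longrightarrow> reduced (push_letter x w)"
  by (cases w) (auto simp: reduced_Cons)

lemma push_inv: "reduced w \<Longrightarrow> push_letter x (push_letter (inv_letter x) w) = w"
  by (cases w rule: remdups_adj.cases) (auto simp: reduced_Cons)

lemma push_lists: "x \<in> A \<Longrightarrow> w \<in> lists A \<Longrightarrow> push_letter x w \<in> lists A"
  by (cases w) auto

lemma reduced_foldr_push: "reduced v \<Longrightarrow> reduced (foldr push_letter u v)"
  by (induction u) (auto intro: reduced_push)

lemma foldr_push_lists: "u \<in> lists A \<Longrightarrow> v \<in> lists A \<Longrightarrow> foldr push_letter u v \<in> lists A"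
proof (induction u)
  case (Cons x u)
  then have "x \<in> A" "foldr push_letter u v \<in> lists A" by simp_all
  from push_lists[OF this] show ?case by simp
qed simp

lemma foldr_push_push:
  assumes "reduced w" "reduced v"
  shows "foldr push_letter (push_letter x v) w = push_letter x (foldr push_letter v w)"
proof (cases v)
  case (Cons y ys)
  then show ?thesis
    using push_inv[of "foldr push_letter ys w" x] reduced_foldr_push[OF assms(1), of ys] by auto
qed simp

lemma foldr_push_assoc:
  assumes "reduced w" "reduced v"
  shows "foldr push_letter (foldr push_letter u v) w = foldr push_letter u (foldr push_letter v w)"
  using assms by (induction u) (auto simp: foldr_push_push reduced_foldr_push)

lemma foldr_push_Nil: "reduced u \<Longrightarrow> foldr push_letter u [] = u"
proof (induction u)
  case (Cons x u)
  then show ?case by (cases u) (auto simp: reduced_Cons)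
qed simp

lemma foldr_push_inv: "foldr push_letter (map inv_letter (rev u)) u = []"
  by (induction u) simp_all

lemma reduced_inv: "reduced u \<Longrightarrow> reduced (map inv_letter (rev u))"
  unfolding reduced_def
  by (auto simp: successively_map successively_rev elim!: successively_mono)

lemma group_free_group: "group (free_group X)"
proof (rule groupI)
  fix u assume "u \<in> carrier (free_group X)"
  then have "map inv_letter (rev u) \<in> carrier (free_group X)"
    "foldr push_letter (map inv_letter (rev u)) u = []"
    by (auto simp: free_group_def reduced_inv foldr_push_inv)
      (auto simp: inv_letter_def)
  then show "\<exists>v\<in>carrier (free_group X). v \<otimes>\<^bsub>free_group X\<^esub> u = \<one>\<^bsub>free_group X\<^esub>"
    by (auto simp: free_group_def intro!: bexI[of _ "map inv_letter (rev u)"])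
next
  fix u v assume "u \<in> carrier (free_group X)" "v \<in> carrier (free_group X)"
  then show "u \<otimes>\<^bsub>free_group X\<^esub> v \<in> carrier (free_group X)"
    using foldr_push_lists[of u "X \<times> UNIV" v]
    by (simp add: free_group_def reduced_foldr_push)
qed (auto simp: free_group_def foldr_push_assoc)


definition eval_letter :: "('g, 'm) monoid_scheme \<Rightarrow> ('a \<Rightarrow> 'g) \<Rightarrow> 'a letter \<Rightarrow> 'g" where
  "eval_letter G f x = (if snd x then f (fst x) else inv\<^bsub>G\<^esub> f (fst x))"

lemma free_group_universal:
  assumes G: "group G" and f: "f \<in> X \<rightarrow> carrier G"
  shows "\<exists>h\<in>hom (free_group X) G. \<forall>x\<in>X. h [(x, True)] = f x"
    and "\<And>h h' u. h \<in> hom (free_group X) G \<Longrightarrow> h' \<in> hom (free_group X) G \<Longrightarrow>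
           \<forall>x\<in>X. h [(x, True)] = h' [(x, True)] \<Longrightarrow> u \<in> carrier (free_group X) \<Longrightarrow> h u = h' u"
proof -
  interpret G: group G by (rule G)
  interpret F: group "free_group X" by (rule group_free_group)
  define h where "h = (\<lambda>u. foldr (\<otimes>\<^bsub>G\<^esub>) (map (eval_letter G f) u) \<one>\<^bsub>G\<^esub>)"
  have el: "eval_letter G f x \<in> carrier G" if "x \<in> X \<times> UNIV" for x
    using f that by (auto simp: eval_letter_def Pi_iff mem_Times_iff)
  have inv: "eval_letter G f (inv_letter x) = inv\<^bsub>G\<^esub> eval_letter G f x" if "x \<in> X \<times> UNIV" for x
    using f that by (auto simp: eval_letter_def inv_letter_def Pi_iff mem_Times_iff)
  have hc: "h u \<in> carrier G" if "u \<in> lists (X \<times> UNIV)" for u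
    using that unfolding h_def by (induction u) (simp_all add: el)
  have push: "h (push_letter x u) = eval_letter G f x \<otimes>\<^bsub>G\<^esub> h u"
    if x: "x \<in> X \<times> UNIV" and u: "u \<in> lists (X \<times> UNIV)" for x u
  proof (cases u)
    case Nil
    then show ?thesis by (simp add: h_def)
  next
    case (Cons y ys)
    have "h ys \<in> carrier G" using u Cons by (intro hc) simp
    moreover have "h (y # ys) = eval_letter G f y \<otimes>\<^bsub>G\<^esub> h ys"
      "h (x # y # ys) = eval_letter G f x \<otimes>\<^bsub>G\<^esub> h (y # ys)"
      by (simp_all add: h_def)
    ultimately show ?thesis
      using Cons el[OF x] inv[OF x] by (simp add: G.m_assoc[symmetric])
  qed
  have fold: "h (foldr push_letter u v) = h u \<otimes>\<^bsub>G\<^esub> h v"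
    if "u \<in> lists (X \<times> UNIV)" "v \<in> lists (X \<times> UNIV)" for u v
    using that(1)
  proof (induction u)
    case Nil
    then show ?case using hc[OF that(2)] by (simp add: h_def)
  next
    case (Cons x u)
    have "h (x # u) = eval_letter G f x \<otimes>\<^bsub>G\<^esub> h u" by (simp add: h_def)
    with Cons show ?case
      using push[of x "foldr push_letter u v"] foldr_push_lists[of u "X \<times> UNIV" v] that(2)
        el[of x] hc[of u] hc[of v] by (simp add: G.m_assoc)
  qed
  have "h \<in> hom (free_group X) G"
    using fold hc by (auto simp: hom_def free_group_def)
  moreover have "h [(x, True)] = f x" if "x \<in> X" for x
    using that f by (auto simp: h_def eval_letter_def Pi_iff)
  ultimately show "\<exists>h\<in>hom (free_group X) G. \<forall>x\<in>X. h [(x, True)] = f x"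
    by blast
next
  fix h h' u
  assume h: "h \<in> hom (free_group X) G" and h': "h' \<in> hom (free_group X) G"
    and eq: "\<forall>x\<in>X. h [(x, True)] = h' [(x, True)]" and u: "u \<in> carrier (free_group X)"
  interpret h: group_hom "free_group X" G h
    using h G group_free_group by (simp add: group_hom_def group_hom_axioms_def)
  interpret h': group_hom "free_group X" G h'
    using h' G group_free_group by (simp add: group_hom_def group_hom_axioms_def)
  have c: "[x] \<in> carrier (free_group X)" if "x \<in> X \<times> UNIV" for x
    using that by (simp add: free_group_def reduced_Cons)
  have "[(x, False)] = inv\<^bsub>free_group X\<^esub> [(x, True)]" if "x \<in> X" for x
    using that c[of "(x, True)"] c[of "(x, False)"]
    by (intro group.inv_equality[OF group_free_group, symmetric])
       (simp_all add: free_group_def inv_letter_def)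
  then have letter: "h [x] = h' [x]" if "x \<in> X \<times> UNIV" for x
    using that eq c by (cases x; cases "snd x") auto
  show "h u = h' u"
    using u
  proof (induction u)
    case Nil
    then show ?case using h.hom_one h'.hom_one by (simp add: free_group_def)
  next
    case (Cons x u)
    then have *: "x \<in> X \<times> UNIV" "u \<in> carrier (free_group X)" "x # u = [x] \<otimes>\<^bsub>free_group X\<^esub> u"
      using foldr_push_Nil[of "x # u"] foldr_push_Nil[of u]
      by (auto simp: free_group_def reduced_Cons neq_Nil_conv)
    then show ?case
      using c letter h.hom_mult[of "[x]" u] h'.hom_mult[of "[x]" u] Cons.IH by simp
  qed
qed


section \<open>Semi-direct products and derivations\<close>

text \<open>\<open>G\<close> acts by automorphisms on \<open>K\<close> when \<open>\<phi> \<in> hom G (AutoGroup K)\<close>.\<close>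

definition semidirect ::
  "('k, 'm) monoid_scheme \<Rightarrow> ('g, 'n) monoid_scheme \<Rightarrow> ('g \<Rightarrow> 'k \<Rightarrow> 'k) \<Rightarrow> ('k \<times> 'g) monoid" where
  "semidirect K G \<phi> = \<lparr>carrier = carrier K \<times> carrier G,
     mult = \<lambda>(k, g) (k', g'). (k \<otimes>\<^bsub>K\<^esub> \<phi> g k', g \<otimes>\<^bsub>G\<^esub> g'),
     one = (\<one>\<^bsub>K\<^esub>, \<one>\<^bsub>G\<^esub>)\<rparr>"

definition trivial_action :: "('k, 'm) monoid_scheme \<Rightarrow> 'g \<Rightarrow> 'k \<Rightarrow> 'k" where
  "trivial_action K g = (\<lambda>k\<in>carrier K. k)"

definition derivation ::
  "('g, 'n) monoid_scheme \<Rightarrow> ('k, 'm) monoid_scheme \<Rightarrow> ('g \<Rightarrow> 'k \<Rightarrow> 'k) \<Rightarrow> ('g \<Rightarrow> 'k) \<Rightarrow> bool" where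
  "derivation G K \<phi> d \<longleftrightarrow> d \<in> carrier G \<rightarrow> carrier K \<and>
     (\<forall>g\<in>carrier G. \<forall>h\<in>carrier G. d (g \<otimes>\<^bsub>G\<^esub> h) = d g \<otimes>\<^bsub>K\<^esub> \<phi> g (d h))"

definition splitting :: "('g \<Rightarrow> 'k) \<Rightarrow> 'g \<Rightarrow> 'k \<times> 'g" where
  "splitting d g = (d g, g)"

lemma trivial_action_hom: "group K \<Longrightarrow> trivial_action K \<in> hom G (AutoGroup K)"
  using group.id_in_auto[of K]
  by (auto simp: hom_def trivial_action_def AutoGroup_def BijGroup_def auto_def compose_def)

lemma AutoGroup_hom:
  assumes "\<phi> \<in> hom G (AutoGroup K)"
  shows "\<And>g. g \<in> carrier G \<Longrightarrow> \<phi> g \<in> hom K K"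
    and "\<And>g h k. g \<in> carrier G \<Longrightarrow> h \<in> carrier G \<Longrightarrow> k \<in> carrier K
           \<Longrightarrow> \<phi> (g \<otimes>\<^bsub>G\<^esub> h) k = \<phi> g (\<phi> h k)"
    and "\<And>g. g \<in> carrier G \<Longrightarrow> inj_on (\<phi> g) (carrier K)"
  using assms
  by (auto simp: hom_def Pi_iff AutoGroup_def BijGroup_def auto_def compose_def Bij_def bij_betw_def)

lemma group_semidirect:
  assumes K: "group K" and G: "group G" and \<phi>: "\<phi> \<in> hom G (AutoGroup K)"
  shows "group (semidirect K G \<phi>)"
proof -
  interpret K: group K by (rule K)
  interpret G: group G by (rule G)
  note aut = AutoGroup_hom[OF \<phi>]
  have cl: "\<phi> g k \<in> carrier K" if "g \<in> carrier G" "k \<in> carrier K" for g k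
    using aut(1)[OF that(1)] that by (auto simp: hom_def)
  have mul: "\<phi> g (k \<otimes>\<^bsub>K\<^esub> k') = \<phi> g k \<otimes>\<^bsub>K\<^esub> \<phi> g k'"
    if "g \<in> carrier G" "k \<in> carrier K" "k' \<in> carrier K" for g k k'
    using aut(1)[OF that(1)] that by (auto simp: hom_def)
  have one: "\<phi> \<one>\<^bsub>G\<^esub> k = k" if "k \<in> carrier K" for k
  proof (rule inj_onD[OF aut(3)[of "\<one>\<^bsub>G\<^esub>"]])
    show "\<phi> \<one>\<^bsub>G\<^esub> (\<phi> \<one>\<^bsub>G\<^esub> k) = \<phi> \<one>\<^bsub>G\<^esub> k"
      using aut(2)[of "\<one>\<^bsub>G\<^esub>" "\<one>\<^bsub>G\<^esub>" k] that by simp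
  qed (use that cl in auto)
  show ?thesis
  proof (rule groupI; clarsimp simp: semidirect_def cl mul one K.m_assoc G.m_assoc aut(2))
    fix k g assume kg: "k \<in> carrier K" "g \<in> carrier G"
    show "\<exists>x\<in>carrier K. \<exists>y\<in>carrier G. x \<otimes>\<^bsub>K\<^esub> \<phi> y k = \<one>\<^bsub>K\<^esub> \<and> y \<otimes>\<^bsub>G\<^esub> g = \<one>\<^bsub>G\<^esub>"
      using kg
      by (intro bexI[of _ "inv\<^bsub>K\<^esub> \<phi> (inv\<^bsub>G\<^esub> g) k"] bexI[of _ "inv\<^bsub>G\<^esub> g"])
         (auto simp: cl)
  qed
qed

lemma snd_hom: "snd \<in> hom (semidirect K G \<phi>) G"
  by (auto simp: hom_def semidirect_def)

lemma splitting_hom: "derivation G K \<phi> d \<Longrightarrow> splitting d \<in> hom G (semidirect K G \<phi>)"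
  by (auto simp: derivation_def hom_def semidirect_def splitting_def)

definition power_derivation :: "('k, 'm) monoid_scheme \<Rightarrow> 'k \<Rightarrow> int \<Rightarrow> 'k" where
  "power_derivation K w n = w [^]\<^bsub>K\<^esub> n"

lemma derivation_integers_iff:
  assumes K: "group K" and w: "w \<in> carrier K"
  shows "derivation integer_group K (trivial_action K) d \<and> d 1 = w
           \<longleftrightarrow> d = power_derivation K w"
proof -
  interpret K: group K by (rule K)
  show ?thesis
  proof
    assume d: "derivation integer_group K (trivial_action K) d \<and> d 1 = w"
    then have h: "d \<in> hom integer_group K"
      by (auto simp: derivation_def hom_def trivial_action_def)
    interpret d: group_hom integer_group K d
      using h K by (simp add: group_hom_def group_hom_axioms_def)
    show "d = power_derivation K w"
      using d.hom_int_pow[of 1] d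
      by (auto simp: fun_eq_iff power_derivation_def group_hom.hom_int_pow)
  next
    assume "d = power_derivation K w"
    then show "derivation integer_group K (trivial_action K) d \<and> d 1 = w"
      using w by (auto simp: derivation_def power_derivation_def trivial_action_def K.int_pow_mult)
  qed
qed


section \<open>Classifying spaces\<close>

text \<open>
  The functorial construction used is the bar construction: the geometric realization (with
  the weak topology) of the nerve. An \<open>n\<close>-simplex of the nerve of \<open>G\<close> is a list
  \<open>[g\<^sub>1, \<dots>, g\<^sub>n]\<close>, where the entry at list position \<open>i\<close> labels the edge from vertex \<open>i\<close> to
  vertex \<open>i + 1\<close>. A monotone map \<open>f\<close> from \<open>{0..m}\<close> to \<open>{0..n}\<close> pulls it back to the
  \<open>m\<close>-simplex whose \<open>i\<close>-th entry is the product of the labels from \<open>f i\<close> to \<open>f (i + 1)\<close>; this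
  covers all face and degeneracy operators.
\<close>

definition nerve_pull ::
  "('g, 'm) monoid_scheme \<Rightarrow> nat \<Rightarrow> (nat \<Rightarrow> nat) \<Rightarrow> 'g list \<Rightarrow> 'g list" where
  "nerve_pull G m f gs =
     map (\<lambda>i. foldr (\<otimes>\<^bsub>G\<^esub>) (map ((!) gs) [f i..<f (Suc i)]) \<one>\<^bsub>G\<^esub>) [0..<m]"

definition simplex_push :: "nat \<Rightarrow> (nat \<Rightarrow> nat) \<Rightarrow> (nat \<Rightarrow> real) \<Rightarrow> nat \<Rightarrow> real" where
  "simplex_push m f t = (\<lambda>j. \<Sum>i | i \<le> m \<and> f i = j. t i)"

definition bar_cells :: "('g, 'm) monoid_scheme \<Rightarrow> ('g list \<times> (nat \<Rightarrow> real)) set" where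
  "bar_cells G = (SIGMA gs : lists (carrier G). standard_simplex (length gs))"

definition bar_glue ::
  "('g, 'm) monoid_scheme \<Rightarrow> ('g list \<times> (nat \<Rightarrow> real)) rel" where
  "bar_glue G = {((nerve_pull G m f gs, t), (gs, simplex_push m f t)) | m f gs t.
     gs \<in> lists (carrier G) \<and> t \<in> standard_simplex m \<and>
     mono_on {..m} f \<and> f ` {..m} \<subseteq> {..length gs}}"

definition bar_equiv ::
  "('g, 'm) monoid_scheme \<Rightarrow> ('g list \<times> (nat \<Rightarrow> real)) rel" where
  "bar_equiv G = (bar_glue G \<union> (bar_glue G)\<inverse>)\<^sup>*"

type_synonym 'g bar_point = "('g list \<times> (nat \<Rightarrow> real)) set"

definition classifying_space :: "('g, 'm) monoid_scheme \<Rightarrow> 'g bar_point topology" where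
  "classifying_space G = topology (\<lambda>U. U \<subseteq> bar_cells G // bar_equiv G \<and>
     (\<forall>gs\<in>lists (carrier G).
        openin (subtopology (powertop_real UNIV) (standard_simplex (length gs)))
          {t \<in> standard_simplex (length gs). bar_equiv G `` {(gs, t)} \<in> U}))"

text \<open>A homomorphism \<open>f\<close> sends the class of \<open>(gs, t)\<close> to the class of \<open>(map f gs, t)\<close>; see
  \<open>classifying_map_class\<close> below.\<close>

definition classifying_map ::
  "('h, 'm) monoid_scheme \<Rightarrow> ('g \<Rightarrow> 'h) \<Rightarrow> 'g bar_point \<Rightarrow> 'h bar_point" where
  "classifying_map H f P = bar_equiv H `` (map_prod (map f) id ` P)"

lemma openin_classifying_space:
  "openin (classifying_space G) U \<longleftrightarrow> U \<subseteq> bar_cells G // bar_equiv G \<and>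
     (\<forall>gs\<in>lists (carrier G).
        openin (subtopology (powertop_real UNIV) (standard_simplex (length gs)))
          {t \<in> standard_simplex (length gs). bar_equiv G `` {(gs, t)} \<in> U})"
proof -
  let ?Q = "\<lambda>gs U. {t \<in> standard_simplex (length gs). bar_equiv G `` {(gs, t)} \<in> U}"
  let ?P = "\<lambda>U. U \<subseteq> bar_cells G // bar_equiv G \<and>
     (\<forall>gs\<in>lists (carrier G).
        openin (subtopology (powertop_real UNIV) (standard_simplex (length gs))) (?Q gs U))"
  have "?Q gs (S \<inter> T) = ?Q gs S \<inter> ?Q gs T" for gs S T by blast
  moreover have "?Q gs (\<Union>\<K>) = (\<Union>K\<in>\<K>. ?Q gs K)" for gs \<K> by blast
  ultimately have "istopology ?P"
    unfolding istopology_def by (simp only:) (blast intro: openin_Int openin_Union)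
  then show ?thesis
    unfolding classifying_space_def by (simp add: topology_inverse')
qed

lemma bar_class_in: "gs \<in> lists (carrier G) \<Longrightarrow> t \<in> standard_simplex (length gs) \<Longrightarrow>
    bar_equiv G `` {(gs, t)} \<in> bar_cells G // bar_equiv G"
  by (auto simp: bar_cells_def quotient_def)

lemma bar_classE:
  assumes "P \<in> bar_cells G // bar_equiv G"
  obtains gs t where "gs \<in> lists (carrier G)" "t \<in> standard_simplex (length gs)"
    "P = bar_equiv G `` {(gs, t)}"
proof -
  from assms obtain x where "x \<in> bar_cells G" "P = bar_equiv G `` {x}"
    by (rule quotientE)
  then show thesis
    using that[of "fst x" "snd x"] by (auto simp: bar_cells_def simp flip: in_lists_conv_set)
qed

lemma topspace_classifying_space [simp]:
  "topspace (classifying_space G) = bar_cells G // bar_equiv G"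
proof -
  have "openin (subtopology (powertop_real UNIV) (standard_simplex (length gs)))
      {t \<in> standard_simplex (length gs).
        bar_equiv G `` {(gs, t)} \<in> bar_cells G // bar_equiv G}"
    if "gs \<in> lists (carrier G)" for gs
  proof -
    have "{t \<in> standard_simplex (length gs).
        bar_equiv G `` {(gs, t)} \<in> bar_cells G // bar_equiv G} = standard_simplex (length gs)"
      using bar_class_in[OF that] by blast
    then show ?thesis
      by (metis openin_topspace topspace_standard_simplex)
  qed
  then have "openin (classifying_space G) (bar_cells G // bar_equiv G)"
    by (simp add: openin_classifying_space)
  then show ?thesis
    using conjunct1[OF openin_topspace[of "classifying_space G", unfolded openin_classifying_space]]
    by (intro subset_antisym openin_subset)
qed

lemma equiv_bar_equiv: "equiv UNIV (bar_equiv G)"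
  unfolding bar_equiv_def
  by (intro equivI refl_rtrancl sym_rtrancl trans_rtrancl) (auto simp: sym_def)

lemma nerve_pull_map:
  assumes "group G" "group H" "f \<in> hom G H" "gs \<in> lists (carrier G)"
    "mono_on {..m} h" "h ` {..m} \<subseteq> {..length gs}"
  shows "map f (nerve_pull G m h gs) = nerve_pull H m h (map f gs)"
proof -
  interpret group_hom G H f
    using assms by (auto simp: group_hom_def group_hom_axioms_def)
  have *: "f (foldr (\<otimes>\<^bsub>G\<^esub>) xs \<one>\<^bsub>G\<^esub>) = foldr (\<otimes>\<^bsub>H\<^esub>) (map f xs) \<one>\<^bsub>H\<^esub>
      \<and> foldr (\<otimes>\<^bsub>G\<^esub>) xs \<one>\<^bsub>G\<^esub> \<in> carrier G" if "xs \<in> lists (carrier G)" for xs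
    using that by (induction xs) auto
  have "f (foldr (\<otimes>\<^bsub>G\<^esub>) (map ((!) gs) [h i..<h (Suc i)]) \<one>\<^bsub>G\<^esub>)
      = foldr (\<otimes>\<^bsub>H\<^esub>) (map ((!) (map f gs)) [h i..<h (Suc i)]) \<one>\<^bsub>H\<^esub>" if "i < m" for i
  proof -
    have "h (Suc i) \<le> length gs" using assms(6) that by (simp add: image_subset_iff)
    then have "map ((!) gs) [h i..<h (Suc i)] \<in> lists (carrier G)"
      "map f (map ((!) gs) [h i..<h (Suc i)]) = map ((!) (map f gs)) [h i..<h (Suc i)]"
      using assms(4) by (auto simp: subset_iff)
    then show ?thesis using * by metis
  qed
  then show ?thesis by (auto simp: nerve_pull_def)
qed

lemma bar_equiv_map:
  assumes "group G" "group H" "f \<in> hom G H" "(x, y) \<in> bar_equiv G"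
  shows "(map_prod (map f) id x, map_prod (map f) id y) \<in> bar_equiv H"
proof -
  have glue: "(map_prod (map f) id a, map_prod (map f) id b) \<in> bar_glue H"
    if ab: "(a, b) \<in> bar_glue G" for a b
  proof -
    from ab obtain m h gs t where *: "a = (nerve_pull G m h gs, t)" "b = (gs, simplex_push m h t)"
      "gs \<in> lists (carrier G)" "t \<in> standard_simplex m" "mono_on {..m} h"
      "h ` {..m} \<subseteq> {..length gs}"
      by (auto simp: bar_glue_def)
    have "map f gs \<in> lists (carrier H)"
      using *(3) assms(3) by (auto simp: hom_def Pi_iff)
    with * show ?thesis
      using nerve_pull_map[OF assms(1-3) *(3,5,6)]
      by (auto simp: bar_glue_def intro!: exI[of _ m] exI[of _ h])
  qed
  show ?thesis
    using assms(4) unfolding bar_equiv_def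
  proof (induction rule: rtrancl_induct)
    case (step y z)
    then have "(map_prod (map f) id y, map_prod (map f) id z) \<in> bar_glue H \<union> (bar_glue H)\<inverse>"
      using glue by blast
    with step.IH show ?case by (rule rtrancl.rtrancl_into_rtrancl)
  qed simp
qed

lemma Image_image_class:
  assumes "trans r" "(a, a) \<in> e" "\<And>x. (a, x) \<in> e \<Longrightarrow> (F a, F x) \<in> r"
  shows "r `` (F ` (e `` {a})) = r `` {F a}"
  using assms by (blast dest: transD)

lemma classifying_map_class:
  assumes "group G" "group H" "f \<in> hom G H"
  shows "classifying_map H f (bar_equiv G `` {(gs, t)}) = bar_equiv H `` {(map f gs, t)}"
proof -
  have tr: "trans (bar_equiv H)"
    unfolding bar_equiv_def by (rule trans_rtrancl)
  have refl: "((gs, t), (gs, t)) \<in> bar_equiv G"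
    by (simp add: bar_equiv_def)
  have "((map f gs, t), map_prod (map f) id x) \<in> bar_equiv H"
    if "((gs, t), x) \<in> bar_equiv G" for x
    using bar_equiv_map[OF assms that] by simp
  then have "bar_equiv H `` (map_prod (map f) id ` (bar_equiv G `` {(gs, t)}))
      = bar_equiv H `` {map_prod (map f) id (gs, t)}"
    by (intro Image_image_class tr refl) simp
  then show ?thesis
    by (simp add: classifying_map_def)
qed

lemma continuous_map_classifying_map:
  assumes "group G" "group H" "f \<in> hom G H"
  shows "continuous_map (classifying_space G) (classifying_space H) (classifying_map H f)"
proof -
  have lists: "map f gs \<in> lists (carrier H)" if "gs \<in> lists (carrier G)" for gs
    using that assms(3) by (auto simp: hom_def Pi_iff)
  have maps: "classifying_map H f P \<in> bar_cells H // bar_equiv H"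
    if "P \<in> bar_cells G // bar_equiv G" for P
  proof -
    obtain gs t where "gs \<in> lists (carrier G)" "t \<in> standard_simplex (length gs)"
      "P = bar_equiv G `` {(gs, t)}"
      using \<open>P \<in> bar_cells G // bar_equiv G\<close> by (rule bar_classE)
    then show ?thesis
      using lists bar_class_in[of "map f gs" H t] by (simp add: classifying_map_class[OF assms])
  qed
  have "openin (classifying_space G)
      {P \<in> topspace (classifying_space G). classifying_map H f P \<in> U}"
    if U: "openin (classifying_space H) U" for U
    unfolding openin_classifying_space
  proof (intro conjI ballI)
    fix gs assume gs: "gs \<in> lists (carrier G)"
    have eq: "{t \<in> standard_simplex (length gs). bar_equiv G `` {(gs, t)} \<in>
          {P \<in> topspace (classifying_space G). classifying_map H f P \<in> U}}
        = {t \<in> standard_simplex (length (map f gs)). bar_equiv H `` {(map f gs, t)} \<in> U}"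
      using gs bar_class_in[OF gs] by (auto simp: classifying_map_class[OF assms])
    have "openin (subtopology (powertop_real UNIV) (standard_simplex (length (map f gs))))
        {t \<in> standard_simplex (length (map f gs)). bar_equiv H `` {(map f gs, t)} \<in> U}"
      by (rule bspec[OF conjunct2[OF U[unfolded openin_classifying_space]] lists[OF gs]])
    then show "openin (subtopology (powertop_real UNIV) (standard_simplex (length gs)))
        {t \<in> standard_simplex (length gs). bar_equiv G `` {(gs, t)} \<in>
          {P \<in> topspace (classifying_space G). classifying_map H f P \<in> U}}"
      unfolding eq by simp
  qed auto
  with maps show ?thesis
    by (simp add: continuous_map_def Pi_iff)
qed

lemma classifying_map_section:
  assumes "group K" "group G" "\<phi> \<in> hom G (AutoGroup K)" "derivation G K \<phi> d"
    and "P \<in> topspace (classifying_space G)"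
  shows "classifying_map G snd (classifying_map (semidirect K G \<phi>) (splitting d) P) = P"
proof -
  have 1: "group (semidirect K G \<phi>)" by (rule group_semidirect) fact+
  obtain gs t where "P = bar_equiv G `` {(gs, t)}"
    using assms(5) unfolding topspace_classifying_space by (rule bar_classE)
  then show ?thesis
    using 1 assms
    by (simp add: classifying_map_class snd_hom splitting_hom comp_def splitting_def)
qed


section \<open>Sectional category and the complexity of a derivation\<close>

text \<open>The value is \<open>\<infinity>\<close> when there is no finite open cover of the required kind.\<close>

definition secat :: "'e topology \<Rightarrow> 'y topology \<Rightarrow> ('e \<Rightarrow> 'y) \<Rightarrow> enat" where
  "secat E Y q = Inf {enat n | n. \<exists>U :: nat \<Rightarrow> 'y set.
     (\<forall>i\<le>n. openin Y (U i)) \<and> (\<Union>i\<le>n. U i) = topspace Y \<and>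
     (\<forall>i\<le>n. \<exists>\<sigma>. continuous_map (subtopology Y (U i)) E \<sigma> \<and> (\<forall>y\<in>U i. q (\<sigma> y) = y))}"

text \<open>Paths are taken to be \<open>undefined\<close> outside of the unit interval, so that each path is
  represented by exactly one function; the path space carries the compact-open topology.\<close>

definition paths :: "'x topology \<Rightarrow> (real \<Rightarrow> 'x) set" where
  "paths X = {\<alpha> \<in> extensional {0..1}. pathin X \<alpha>}"

definition path_space :: "'x topology \<Rightarrow> (real \<Rightarrow> 'x) topology" where
  "path_space X = topology_generated_by
     {{\<alpha> \<in> paths X. \<alpha> ` C \<subseteq> V} | C V. compact C \<and> C \<subseteq> {0..1} \<and> openin X V}"

lemma topspace_path_space: "topspace (path_space X) = paths X"
proof -
  have "\<exists>C V. paths X = {\<alpha> \<in> paths X. \<alpha> ` C \<subseteq> V} \<and> compact C \<and> C \<subseteq> {0..1} \<and> openin X V"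
    by (intro exI[of _ "{}"]) simp
  then have "paths X \<in> {{\<alpha> \<in> paths X. \<alpha> ` C \<subseteq> V} | C V. compact C \<and> C \<subseteq> {0..1} \<and> openin X V}"
    by (rule CollectI)
  then show ?thesis
    unfolding path_space_def topology_generated_by_topspace
    by (intro subset_antisym Union_least Union_upper) (elim CollectE exE conjE, simp)
qed

definition fibrewise_path_space ::
  "'x topology \<Rightarrow> ('x \<Rightarrow> 'b) \<Rightarrow> ('b \<Rightarrow> 'x) \<Rightarrow> (real \<Rightarrow> 'x) topology" where
  "fibrewise_path_space X q s = subtopology (path_space X)
     {\<alpha>. (\<forall>t\<in>{0..1}. q (\<alpha> t) = q (\<alpha> 0)) \<and> \<alpha> 0 = s (q (\<alpha> 0))}"

definition parametrized_cat :: "'x topology \<Rightarrow> ('x \<Rightarrow> 'b) \<Rightarrow> ('b \<Rightarrow> 'x) \<Rightarrow> enat" where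
  "parametrized_cat X q s = secat (fibrewise_path_space X q s) X (\<lambda>\<alpha>. \<alpha> 1)"

definition tc ::
  "('g, 'n) monoid_scheme \<Rightarrow> ('k, 'm) monoid_scheme \<Rightarrow> ('g \<Rightarrow> 'k \<Rightarrow> 'k) \<Rightarrow> ('g \<Rightarrow> 'k) \<Rightarrow> enat" where
  "tc G K \<phi> d = parametrized_cat (classifying_space (semidirect K G \<phi>))
     (classifying_map G snd) (classifying_map (semidirect K G \<phi>) (splitting d))"

end

theory Submission
  imports Defs "HOL-Analysis.Abstract_Topological_Spaces"
begin

text \<open>
  Let \<open>\<pi>\<close> be the product of the free group and the integers. By \<open>bar_equiv_translate\<close> and
  \<open>bar_equiv_step\<close>, a point of the bar construction of \<open>\<pi>\<close> is a step function from \<open>[0, 1)\<close> to \<open>\<pi>\<close>, up to left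
  translation; the functions themselves are the points of the universal cover. In these terms, a path in the fibre
  from the given section to the point with values \<open>(a, b)\<close> is obtained by choosing an element \<open>c\<close> of the
  free group and replacing the values \<open>(c w\<^sup>b, b)\<close> by \<open>(a, b)\<close>, progressively from the right end of the
  interval. Conversely, by lifting, every such path singles out an element \<open>c\<close>. Under translation of the step
  function by \<open>(u, m)\<close> the element \<open>c\<close> becomes \<open>u c w\<^sup>-\<^sup>m\<close>. Hence an open set admits a section
  if and only if a locally constant choice of \<open>c\<close> with this equivariance exists over it: the complexity is the
  sectional category of the covering of the classifying space with fibre \<open>\<pi> / \<langle>(w, 1)\<rangle>\<close>. The two directions
  are \<open>section_of_label\<close> and \<open>holonomy_constant\<close>.

  Three sets suffice because \<open>\<pi>\<close> acts freely on a two-dimensional complex, the product of the Cayley tree and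
  the line. A step function has a mean in the line, and in the tree it has a second moment, which is
  strictly convex and thus takes its minimum at one vertex or at the two ends of one edge. Neighbourhoods of the
  cells of each dimension 0, 1, 2 give the three open sets (\<open>three_set_cover\<close>). The kind and the place of the
  minimum also serve as charts of the covering through which paths are lifted.

  Two sets do not suffice because of a torus. There is a generator \<open>v\<close> of which no nontrivial power is conjugate
  to a power of \<open>w\<close>; here it matters that \<open>w\<close> has infinite order. The subgroup generated by \<open>(v, 0)\<close> and
  \<open>(\<one>, 1)\<close> then acts freely on \<open>\<pi> / \<langle>(w, 1)\<rangle>\<close>. Two sections over a cover of the corresponding torus would produce
  an equivariant map from the vertices of a fine triangulation of the plane to a lattice, collapsing an edge of every
  triangle because two of its three vertices use the same section. But an equivariant map has degree one,
  and the signed areas of its image triangles cannot all vanish (\<open>no_degenerate_grid\<close>, \<open>no_two_set_cover\<close>).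
\<close>

section \<open>Points of the bar construction as step functions\<close>

text \<open>The vertices of the simplex \<open>gs\<close> in the universal cover, where its initial vertex is placed at the
  neutral element.\<close>
definition vertex :: "('g, 'm) monoid_scheme \<Rightarrow> 'g list \<Rightarrow> nat \<Rightarrow> 'g" where
  "vertex G gs i = foldr (\<otimes>\<^bsub>G\<^esub>) (take i gs) \<one>\<^bsub>G\<^esub>"

definition cumulative :: "(nat \<Rightarrow> real) \<Rightarrow> nat \<Rightarrow> real" where
  "cumulative t i = sum t {..<i}"

definition piece :: "(nat \<Rightarrow> real) \<Rightarrow> real \<Rightarrow> nat" where
  "piece t r = (LEAST i. r < cumulative t (Suc i))"

text \<open>A point \<open>(gs, t)\<close> is read as a function on \<open>[0, 1)\<close>: the interval is cut into consecutive pieces of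
  lengths \<open>t 0, t 1, \<dots>\<close>, and the \<open>i\<close>-th piece is sent to the \<open>i\<close>-th vertex. A vertex of weight
  zero owns an empty piece, and a degenerate edge joins two pieces with the same value, so this function
  does not see faces and degeneracies.\<close>
definition step :: "('g, 'm) monoid_scheme \<Rightarrow> 'g list \<Rightarrow> (nat \<Rightarrow> real) \<Rightarrow> real \<Rightarrow> 'g" where
  "step G gs t r = vertex G gs (piece t r)"

lemma simplex_nonneg: "t \<in> standard_simplex n \<Longrightarrow> 0 \<le> t i"
  and simplex_zero: "t \<in> standard_simplex n \<Longrightarrow> n < i \<Longrightarrow> t i = 0"
  and simplex_sum: "t \<in> standard_simplex n \<Longrightarrow> sum t {..n} = 1"
  by (auto simp: standard_simplex_def)

lemma simplexI:
  assumes "\<And>i. 0 \<le> t i" "\<And>i. n < i \<Longrightarrow> t i = 0" "sum t {..n} = 1"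
  shows "t \<in> standard_simplex n"
proof -
  have "t i \<le> 1" for i
  proof (cases "i \<le> n")
    case True
    then show ?thesis using member_le_sum[of i "{..n}" t] assms by auto
  qed (use assms in auto)
  with assms show ?thesis by (auto simp: standard_simplex_def)
qed

lemma cumulative_0 [simp]: "cumulative t 0 = 0"
  by (simp add: cumulative_def)

lemma cumulative_Suc: "cumulative t (Suc i) = cumulative t i + t i"
  by (simp add: cumulative_def)

lemma cumulative_mono: "t \<in> standard_simplex n \<Longrightarrow> i \<le> j \<Longrightarrow> cumulative t i \<le> cumulative t j"
  unfolding cumulative_def by (intro sum_mono2) (auto simp: simplex_nonneg)

lemma cumulative_last: "t \<in> standard_simplex n \<Longrightarrow> cumulative t (Suc n) = 1"
  by (simp add: cumulative_def lessThan_Suc_atMost simplex_sum)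

lemma cumulative_beyond:
  assumes "t \<in> standard_simplex n" "n < i" shows "cumulative t i = 1"
  using \<open>n < i\<close>
proof (induction i)
  case (Suc i)
  then show ?case
    using cumulative_last[OF assms(1)] simplex_zero[OF assms(1), of i]
    by (cases "i = n") (auto simp: cumulative_Suc)
qed simp

text \<open>The functions \<open>cumulative t\<close> and \<open>piece t\<close> form a Galois connection. Everything below about
  pieces is derived from it.\<close>
lemma cumulative_le_iff:
  assumes t: "t \<in> standard_simplex n" and r: "0 \<le> r" "r < 1"
  shows "cumulative t i \<le> r \<longleftrightarrow> i \<le> piece t r"
proof -
  have ex: "r < cumulative t (Suc n)" using cumulative_last[OF t] r by simp
  have less: "r < cumulative t (Suc (piece t r))"
    unfolding piece_def by (rule LeastI[of "\<lambda>i. r < cumulative t (Suc i)", OF ex])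
  show ?thesis
  proof
    assume "cumulative t i \<le> r"
    then show "i \<le> piece t r"
      using less cumulative_mono[OF t, of "Suc (piece t r)" i] by force
  next
    assume i: "i \<le> piece t r"
    show "cumulative t i \<le> r"
    proof (cases i)
      case (Suc j)
      then have "\<not> r < cumulative t (Suc j)"
        using i not_less_Least[of j "\<lambda>i. r < cumulative t (Suc i)"] by (simp add: piece_def)
      with Suc show ?thesis by simp
    qed (use r in simp)
  qed
qed

lemma piece_le: "t \<in> standard_simplex n \<Longrightarrow> 0 \<le> r \<Longrightarrow> r < 1 \<Longrightarrow> piece t r \<le> n"
  using cumulative_le_iff[of t n r "Suc n"] cumulative_last[of t n] by force

lemma piece_eqI:
  assumes "t \<in> standard_simplex n" "0 \<le> r" "r < 1"
    and "cumulative t i \<le> r" "r < cumulative t (Suc i)"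
  shows "piece t r = i"
  using cumulative_le_iff[OF assms(1-3), of i] cumulative_le_iff[OF assms(1-3), of "Suc i"] assms(4,5)
  by linarith

lemma piece_bounds:
  assumes "t \<in> standard_simplex n" "0 \<le> r" "r < 1"
  shows "cumulative t (piece t r) \<le> r" "r < cumulative t (Suc (piece t r))"
  using cumulative_le_iff[OF assms, of "piece t r"] cumulative_le_iff[OF assms, of "Suc (piece t r)"]
  by auto

lemma piece_mono:
  assumes "t \<in> standard_simplex n" "0 \<le> r" "r \<le> r'" "r' < 1"
  shows "piece t r \<le> piece t r'"
  using cumulative_le_iff[OF assms(1), of r' "piece t r"] piece_bounds(1)[OF assms(1), of r] assms
  by simp

lemma simplex_push_simplex:
  assumes t: "t \<in> standard_simplex m" and f: "f ` {..m} \<subseteq> {..n}"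
  shows "simplex_push m f t \<in> standard_simplex n"
proof (rule simplexI)
  have "sum (simplex_push m f t) {..n} = (\<Sum>j\<le>n. sum t {i. i \<in> {..m} \<and> f i = j})"
    by (simp add: simplex_push_def)
  also have "\<dots> = sum t {..m}"
    by (rule sum.group) (use f in auto)
  finally show "sum (simplex_push m f t) {..n} = 1" using t by (simp add: simplex_sum)
qed (use t f in \<open>auto simp: simplex_push_def simplex_nonneg intro!: sum_nonneg sum.neutral\<close>)

lemma cumulative_push:
  "cumulative (simplex_push m f t) i = sum t {j. j \<le> m \<and> f j < i}"
proof -
  have "cumulative (simplex_push m f t) i = (\<Sum>j\<in>{..<i}. sum t {k. k \<in> {k. k \<le> m \<and> f k < i} \<and> f k = j})"
    unfolding cumulative_def simplex_push_def by (intro sum.cong refl arg_cong[of _ _ "sum t"]) auto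
  also have "\<dots> = sum t {j. j \<le> m \<and> f j < i}"
    by (rule sum.group) auto
  finally show ?thesis .
qed

lemma mono_on_below:
  fixes f :: "nat \<Rightarrow> nat"
  assumes "mono_on {..m} f"
  obtains J where "J \<le> Suc m" "{j. j \<le> m \<and> f j < i} = {..<J}"
proof
  let ?J = "card {j. j \<le> m \<and> f j < i}"
  let ?S = "{j. j \<le> m \<and> f j < i}"
  have fin: "finite ?S" by simp
  have down: "k \<in> ?S" if "j \<in> ?S" "k \<le> j" for j k
    using that mono_onD[OF assms, of k j] by auto
  have "\<exists>J\<le>Suc m. ?S = {..<J}"
  proof (cases "?S = {}")
    case False
    have M: "Max ?S \<in> ?S" using fin False by (rule Max_in)
    have "?S = {..<Suc (Max ?S)}"
    proof (rule Set.set_eqI)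
      fix k show "k \<in> ?S \<longleftrightarrow> k \<in> {..<Suc (Max ?S)}"
        using down[OF M, of k] Max_ge[OF fin, of k] unfolding lessThan_iff less_Suc_eq_le by blast
    qed
    moreover have "Suc (Max ?S) \<le> Suc m" using M by simp
    ultimately show ?thesis by blast
  qed (intro exI[of _ 0], simp)
  then obtain J where J: "J \<le> Suc m" "?S = {..<J}" by blast
  then have "?J = J" by simp
  with J show "?J \<le> Suc m" "?S = {..<?J}" by simp_all
qed

text \<open>Pushing weights along a monotone map merges neighbouring pieces and creates empty ones, but it does
  not move the remaining cuts.\<close>
lemma piece_push:
  assumes t: "t \<in> standard_simplex m" and f: "mono_on {..m} f" "f ` {..m} \<subseteq> {..n}"
    and r: "0 \<le> r" "r < 1"
  shows "piece (simplex_push m f t) r = f (piece t r)"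
proof -
  have iff: "i \<le> piece (simplex_push m f t) r \<longleftrightarrow> i \<le> f (piece t r)" for i
  proof -
    obtain J where J: "J \<le> Suc m" "{j. j \<le> m \<and> f j < i} = {..<J}"
      using mono_on_below[OF f(1)] by blast
    have "i \<le> piece (simplex_push m f t) r \<longleftrightarrow> cumulative (simplex_push m f t) i \<le> r"
      using cumulative_le_iff[OF simplex_push_simplex[OF t f(2)] r] by blast
    also have "\<dots> \<longleftrightarrow> cumulative t J \<le> r"
      unfolding cumulative_push J(2) by (simp add: cumulative_def)
    also have "\<dots> \<longleftrightarrow> J \<le> piece t r" by (rule cumulative_le_iff[OF t r])
    also have "\<dots> \<longleftrightarrow> \<not> piece t r \<in> {j. j \<le> m \<and> f j < i}" unfolding J(2) by auto
    also have "\<dots> \<longleftrightarrow> i \<le> f (piece t r)" using piece_le[OF t r] by auto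
    finally show ?thesis .
  qed
  show ?thesis by (rule antisym) (use iff in blast)+
qed

context group
begin

lemma foldr_mult_closed: "set xs \<subseteq> carrier G \<Longrightarrow> foldr (\<otimes>) xs \<one> \<in> carrier G"
  by (induction xs) auto

lemma foldr_mult_append:
  "set xs \<subseteq> carrier G \<Longrightarrow> set ys \<subseteq> carrier G \<Longrightarrow>
     foldr (\<otimes>) (xs @ ys) \<one> = foldr (\<otimes>) xs \<one> \<otimes> foldr (\<otimes>) ys \<one>"
  by (induction xs) (auto simp: m_assoc foldr_mult_closed)

lemma vertex_closed [simp]: "set gs \<subseteq> carrier G \<Longrightarrow> vertex G gs i \<in> carrier G"
  unfolding vertex_def by (intro foldr_mult_closed) (auto dest: in_set_takeD)

lemma vertex_0 [simp]: "vertex G gs 0 = \<one>"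
  by (simp add: vertex_def)

lemma vertex_append:
  assumes "set gs \<subseteq> carrier G" "set hs \<subseteq> carrier G"
  shows "vertex G (gs @ hs) i = (if i \<le> length gs then vertex G gs i
           else vertex G gs (length gs) \<otimes> vertex G hs (i - length gs))"
proof (cases "i \<le> length gs")
  case False
  have "set (take k hs) \<subseteq> carrier G" for k using assms by (auto dest: in_set_takeD)
  with False assms show ?thesis by (simp add: vertex_def foldr_mult_append del: foldr_append)
qed (simp add: vertex_def)

lemma vertex_segment:
  assumes gs: "set gs \<subseteq> carrier G" and ij: "i \<le> j" "j \<le> length gs"
  shows "foldr (\<otimes>) (map ((!) gs) [i..<j]) \<one> = inv (vertex G gs i) \<otimes> vertex G gs j"
proof -
  let ?s = "map ((!) gs) [i..<j]"
  have seg: "?s = drop i (take j gs)"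
    using ij by (intro nth_equalityI) auto
  have s: "set ?s \<subseteq> carrier G" using gs ij by (auto simp: subset_iff)
  have "take j gs = take i gs @ ?s"
    unfolding seg using ij by (metis append_take_drop_id min.absorb1 take_take)
  then have "vertex G gs j = vertex G gs i \<otimes> foldr (\<otimes>) ?s \<one>"
    using foldr_mult_append[of "take i gs" ?s] gs s
    by (auto simp: vertex_def dest!: in_set_takeD)
  then show ?thesis
    using gs foldr_mult_closed[OF s] by (simp add: m_assoc[symmetric])
qed

lemma nerve_pull_vertices:
  assumes gs: "set gs \<subseteq> carrier G" and f: "mono_on {..m} f" "f ` {..m} \<subseteq> {..length gs}"
  shows "nerve_pull G m f gs =
    map (\<lambda>i. inv (vertex G gs (f i)) \<otimes> vertex G gs (f (Suc i))) [0..<m]"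
  unfolding nerve_pull_def
proof (rule map_cong)
  fix i assume "i \<in> set [0..<m]"
  then have "f i \<le> f (Suc i)" "f (Suc i) \<le> length gs"
    using f by (auto simp: mono_on_def image_subset_iff)
  then show "foldr (\<otimes>) (map ((!) gs) [f i..<f (Suc i)]) \<one>
      = inv (vertex G gs (f i)) \<otimes> vertex G gs (f (Suc i))"
    by (rule vertex_segment[OF gs])
qed simp

lemma nerve_pull_closed:
  assumes "set gs \<subseteq> carrier G" and f: "mono_on {..m} f" "f ` {..m} \<subseteq> {..length gs}"
  shows "set (nerve_pull G m f gs) \<subseteq> carrier G"
  using assms by (auto simp: nerve_pull_vertices[OF assms])

lemma length_nerve_pull [simp]: "length (nerve_pull H m f gs) = m"
  by (simp add: nerve_pull_def)

lemma vertex_nerve_pull: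
  assumes gs: "set gs \<subseteq> carrier G" and f: "mono_on {..m} f" "f ` {..m} \<subseteq> {..length gs}"
    and j: "j \<le> m"
  shows "vertex G gs (f 0) \<otimes> vertex G (nerve_pull G m f gs) j = vertex G gs (f j)"
  using j
proof (induction j)
  case (Suc j)
  let ?p = "nerve_pull G m f gs"
  have p: "set ?p \<subseteq> carrier G" by (rule nerve_pull_closed[OF gs f])
  have "take (Suc j) ?p = take j ?p @ [?p ! j]"
    using Suc.prems by (simp add: take_Suc_conv_app_nth)
  moreover have nth: "?p ! j = inv (vertex G gs (f j)) \<otimes> vertex G gs (f (Suc j))"
    using Suc.prems by (simp add: nerve_pull_vertices[OF gs f])
  ultimately have "vertex G ?p (Suc j) = vertex G ?p j \<otimes> (?p ! j)"
    using p gs foldr_mult_append[of "take j ?p" "[?p ! j]"] set_take_subset[of j ?p]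
      vertex_def[of G ?p "Suc j"] vertex_def[of G ?p j]
    by (simp del: foldr_append)
  then have "vertex G gs (f 0) \<otimes> vertex G ?p (Suc j)
      = (vertex G gs (f 0) \<otimes> vertex G ?p j) \<otimes> (?p ! j)"
    using p gs nth by (simp add: m_assoc)
  also have "\<dots> = vertex G gs (f (Suc j))"
    using Suc gs nth by (simp add: m_assoc[symmetric])
  finally show ?case .
qed (use gs in simp)

lemma vertex_sum_push:
  fixes \<phi> :: "'a \<Rightarrow> real"
  assumes t: "t \<in> standard_simplex m" and f: "f ` {..m} \<subseteq> {..n}"
  shows "(\<Sum>i\<le>n. simplex_push m f t i * \<phi> (v i)) = (\<Sum>j\<le>m. t j * \<phi> (v (f j)))"
proof -
  have "(\<Sum>i\<le>n. simplex_push m f t i * \<phi> (v i))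
      = (\<Sum>i\<le>n. \<Sum>j\<in>{j. j \<in> {..m} \<and> f j = i}. t j * \<phi> (v (f j)))"
    by (simp add: simplex_push_def sum_distrib_right)
  also have "\<dots> = (\<Sum>j\<le>m. t j * \<phi> (v (f j)))"
    by (rule sum.group) (use f in auto)
  finally show ?thesis .
qed

text \<open>Cells whose step functions differ by a left translation \<open>\<gamma>\<close>. The second condition is the resulting equality
  between integrals of functions \<open>\<phi>\<close> along the step functions; it is recorded for the same \<open>\<gamma>\<close>, as a weighted sum,
  because barycentres will be computed from such sums.\<close>
definition translate_rel :: "('a list \<times> (nat \<Rightarrow> real)) rel" where
  "translate_rel = {((gs, t), (gs', t')). (gs, t) \<in> bar_cells G \<and> (gs', t') \<in> bar_cells G \<and>
     (\<exists>\<gamma>\<in>carrier G. (\<forall>r. 0 \<le> r \<and> r < 1 \<longrightarrow> step G gs' t' r = \<gamma> \<otimes> step G gs t r) \<and>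
        (\<forall>\<phi> :: 'a \<Rightarrow> real. (\<Sum>i\<le>length gs'. t' i * \<phi> (vertex G gs' i)) =
            (\<Sum>i\<le>length gs. t i * \<phi> (\<gamma> \<otimes> vertex G gs i))))}"

lemma bar_cells_iff: "(gs, t) \<in> bar_cells G \<longleftrightarrow> set gs \<subseteq> carrier G \<and> t \<in> standard_simplex (length gs)"
  by (auto simp: bar_cells_def)

lemma bar_glue_translate: "bar_glue G \<subseteq> translate_rel"
proof -
  have "((nerve_pull G m f gs, t), (gs, simplex_push m f t)) \<in> translate_rel"
    if gs: "gs \<in> lists (carrier G)" and t: "t \<in> standard_simplex m"
      and f: "mono_on {..m} f" "f ` {..m} \<subseteq> {..length gs}" for m f gs t
  proof -
    have gs': "set gs \<subseteq> carrier G" using gs by auto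
    note pull = vertex_nerve_pull[OF gs' f]
    have "step G gs (simplex_push m f t) r = vertex G gs (f 0) \<otimes> step G (nerve_pull G m f gs) t r"
      if "0 \<le> r" "r < 1" for r
      using piece_push[OF t f that] piece_le[OF t that] by (simp add: step_def pull)
    moreover have "(\<Sum>i\<le>length gs. simplex_push m f t i * \<phi> (vertex G gs i)) =
        (\<Sum>i\<le>m. t i * \<phi> (vertex G gs (f 0) \<otimes> vertex G (nerve_pull G m f gs) i))" for \<phi>
      using vertex_sum_push[OF t f(2), of \<phi> "vertex G gs"] by (simp add: pull)
    ultimately show ?thesis
      using gs' t nerve_pull_closed[OF gs' f] simplex_push_simplex[OF t f(2)]
      by (auto simp: translate_rel_def bar_cells_iff intro!: bexI[of _ "vertex G gs (f 0)"])
  qed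
  then show ?thesis by (auto simp: bar_glue_def)
qed

lemma step_closed: "set gs \<subseteq> carrier G \<Longrightarrow> step G gs t r \<in> carrier G"
  by (simp add: step_def)

lemma sym_translate_rel: "sym translate_rel"
proof (rule symI, clarify)
  fix gs t gs' t' assume "((gs, t), (gs', t')) \<in> translate_rel"
  then obtain \<gamma> where c: "(gs, t) \<in> bar_cells G" "(gs', t') \<in> bar_cells G" "\<gamma> \<in> carrier G"
    and s: "\<And>r. 0 \<le> r \<Longrightarrow> r < 1 \<Longrightarrow> step G gs' t' r = \<gamma> \<otimes> step G gs t r"
    and p: "\<And>\<phi> :: 'a \<Rightarrow> real. (\<Sum>i\<le>length gs'. t' i * \<phi> (vertex G gs' i)) =
            (\<Sum>i\<le>length gs. t i * \<phi> (\<gamma> \<otimes> vertex G gs i))"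
    by (auto simp: translate_rel_def)
  have "step G gs t r = inv \<gamma> \<otimes> step G gs' t' r" if "0 \<le> r" "r < 1" for r
    using s[OF that] c by (simp add: bar_cells_iff step_closed m_assoc[symmetric])
  moreover have "(\<Sum>i\<le>length gs. t i * \<phi> (vertex G gs i)) =
      (\<Sum>i\<le>length gs'. t' i * \<phi> (inv \<gamma> \<otimes> vertex G gs' i))" for \<phi>
    using p[of "\<lambda>v. \<phi> (inv \<gamma> \<otimes> v)"] c by (simp add: bar_cells_iff m_assoc[symmetric])
  ultimately show "((gs', t'), (gs, t)) \<in> translate_rel"
    using c by (auto simp: translate_rel_def intro!: bexI[of _ "inv \<gamma>"])
qed

lemma trans_translate_rel: "trans translate_rel"
proof (rule transI, clarify)
  fix gs t gs' t' gs'' t''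
  assume "((gs, t), (gs', t')) \<in> translate_rel" "((gs', t'), (gs'', t'')) \<in> translate_rel"
  then obtain \<gamma> \<delta> where c: "(gs, t) \<in> bar_cells G" "(gs', t') \<in> bar_cells G" "(gs'', t'') \<in> bar_cells G"
      "\<gamma> \<in> carrier G" "\<delta> \<in> carrier G"
    and s: "\<And>r. 0 \<le> r \<Longrightarrow> r < 1 \<Longrightarrow> step G gs' t' r = \<gamma> \<otimes> step G gs t r"
      "\<And>r. 0 \<le> r \<Longrightarrow> r < 1 \<Longrightarrow> step G gs'' t'' r = \<delta> \<otimes> step G gs' t' r"
    and p: "\<And>\<phi> :: 'a \<Rightarrow> real. (\<Sum>i\<le>length gs'. t' i * \<phi> (vertex G gs' i)) =
            (\<Sum>i\<le>length gs. t i * \<phi> (\<gamma> \<otimes> vertex G gs i))"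
      "\<And>\<phi> :: 'a \<Rightarrow> real. (\<Sum>i\<le>length gs''. t'' i * \<phi> (vertex G gs'' i)) =
            (\<Sum>i\<le>length gs'. t' i * \<phi> (\<delta> \<otimes> vertex G gs' i))"
    unfolding translate_rel_def by auto
  have "step G gs'' t'' r = (\<delta> \<otimes> \<gamma>) \<otimes> step G gs t r" if "0 \<le> r" "r < 1" for r
    using s(1)[OF that] s(2)[OF that] c by (simp add: bar_cells_iff step_closed m_assoc)
  moreover have "(\<Sum>i\<le>length gs''. t'' i * \<phi> (vertex G gs'' i)) =
      (\<Sum>i\<le>length gs. t i * \<phi> ((\<delta> \<otimes> \<gamma>) \<otimes> vertex G gs i))" for \<phi>
    using p(1)[of "\<lambda>v. \<phi> (\<delta> \<otimes> v)"] p(2)[of \<phi>] c by (simp add: bar_cells_iff m_assoc)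
  ultimately show "((gs, t), (gs'', t'')) \<in> translate_rel"
    using c by (auto simp: translate_rel_def intro!: bexI[of _ "\<delta> \<otimes> \<gamma>"])
qed

text \<open>A simplicial operator changes at most the vertex that is placed at the neutral element, hence
  translates the step function.\<close>
lemma bar_equiv_translate:
  assumes "(gs, t) \<in> bar_cells G" "((gs, t), (gs', t')) \<in> bar_equiv G"
  shows "((gs, t), (gs', t')) \<in> translate_rel"
proof -
  have refl: "((gs, t), (gs, t)) \<in> translate_rel"
    using assms(1) by (auto simp: translate_rel_def bar_cells_iff step_closed intro!: bexI[of _ "\<one>"])
  have sub: "bar_glue G \<union> (bar_glue G)\<inverse> \<subseteq> translate_rel"
    using bar_glue_translate sym_translate_rel by (auto simp: sym_def)
  have "((gs, t), y) \<in> translate_rel" if "((gs, t), y) \<in> (bar_glue G \<union> (bar_glue G)\<inverse>)\<^sup>*" for y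
    using that
  proof (induction rule: rtrancl_induct)
    case (step y z)
    then show ?case using sub trans_translate_rel by (blast dest: transD)
  qed (rule refl)
  then show ?thesis using assms(2) by (simp add: bar_equiv_def)
qed

end

lemma cumulative_list:
  assumes ps: "sorted ps" "hd ps = 0" "ps \<noteq> []" "set ps \<subseteq> {0..<1::real}"
  defines "l \<equiv> \<lambda>j. if j < length ps then (ps @ [1]) ! Suc j - ps ! j else 0"
  shows "l \<in> standard_simplex (length ps - 1)"
    and "j \<le> length ps \<Longrightarrow> cumulative l j = (ps @ [1]) ! j"
proof -
  have sorted: "sorted (ps @ [1])" using ps(1,4) by (auto simp: sorted_append)
  have nonneg: "0 \<le> l j" for j
    using sorted_nth_mono[OF sorted, of j "Suc j"] by (auto simp: l_def nth_append)
  have cum: "cumulative l j = (ps @ [1]) ! j" if "j \<le> length ps" for j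
    using that
  proof (induction j)
    case 0
    then show ?case using ps(2,3) by (cases ps) auto
  next
    case (Suc j)
    then show ?case by (simp add: cumulative_Suc l_def nth_append)
  qed
  then show "j \<le> length ps \<Longrightarrow> cumulative l j = (ps @ [1]) ! j" .
  have "sum l {..length ps - 1} = cumulative l (length ps)"
    using ps(3) by (simp add: cumulative_def flip: lessThan_Suc_atMost)
  then show "l \<in> standard_simplex (length ps - 1)"
    using cum[of "length ps"] nonneg by (intro simplexI) (auto simp: l_def nth_append)
qed

context group
begin

text \<open>Cutting \<open>[0, 1)\<close> at further points is a degeneracy. The refined simplex depends only on the cut points
  and on the quotients of consecutive values of the step function.\<close>
lemma refine_cell:
  assumes c: "(gs, t) \<in> bar_cells G"
    and ps: "sorted ps" "distinct ps" "hd ps = 0" "ps \<noteq> []" "set ps \<subseteq> {0..<1::real}"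
    and sub: "\<And>i. cumulative t i < 1 \<Longrightarrow> cumulative t i \<in> set ps"
  defines "l \<equiv> \<lambda>j. if j < length ps then (ps @ [1]) ! Suc j - ps ! j else 0"
  shows "((map (\<lambda>j. inv (step G gs t (ps ! j)) \<otimes> step G gs t (ps ! Suc j)) [0..<length ps - 1], l),
    (gs, t)) \<in> bar_glue G"
proof -
  define m where "m = length ps - 1"
  define f where "f j = piece t (ps ! min j m)" for j
  have gs: "set gs \<subseteq> carrier G" and t: "t \<in> standard_simplex (length gs)"
    using c by (auto simp: bar_cells_iff)
  have len: "length ps = Suc m" using ps(4) by (simp add: m_def)
  have r: "0 \<le> ps ! j" "ps ! j < 1" if "j \<le> m" for j
    using subsetD[OF ps(5) nth_mem[of j ps]] that len by auto
  have f: "mono_on {..m} f" "f ` {..m} \<subseteq> {..length gs}"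
    using piece_mono[OF t r(1) sorted_nth_mono[OF ps(1)] r(2)] piece_le[OF t r] len
    by (auto intro!: mono_onI simp: f_def)
  note l = cumulative_list[OF ps(1,3,4,5), folded l_def m_def]
  have "cumulative (simplex_push m f l) i = cumulative t i" for i
  proof -
    have iff: "f j < i \<longleftrightarrow> ps ! j < cumulative t i" if "j \<le> m" for j
      using cumulative_le_iff[OF t r[OF that], of i] that by (auto simp: f_def)
    have "\<exists>J\<le>Suc m. cumulative t i = (ps @ [1]) ! J"
    proof (cases "cumulative t i < 1")
      case True
      then obtain J where "J < length ps" "cumulative t i = ps ! J"
        using sub[of i] by (metis in_set_conv_nth)
      then show ?thesis using len by (intro exI[of _ J]) (auto simp: nth_append)
    next
      case False
      then have "cumulative t i = 1"
        using cumulative_beyond[OF t, of i] cumulative_mono[OF t, of i "Suc (length gs)"]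
          cumulative_last[OF t] by (cases "i \<le> length gs") auto
      then show ?thesis using len by (intro exI[of _ "Suc m"]) (auto simp: nth_append)
    qed
    then obtain J where J: "J \<le> Suc m" "cumulative t i = (ps @ [1]) ! J" by blast
    have "ps ! j < (ps @ [1]) ! J \<longleftrightarrow> j < J" if "j \<le> m" for j
    proof (cases "J \<le> m")
      case True
      have "ps ! j < ps ! J" if "j < J"
      proof -
        have "ps ! j \<noteq> ps ! J" using that True len ps(2) by (simp add: nth_eq_iff_index_eq)
        then show ?thesis using sorted_nth_mono[OF ps(1), of j J] that True len by simp
      qed
      moreover have "ps ! J \<le> ps ! j" if "J \<le> j"
        using sorted_nth_mono[OF ps(1) that] \<open>j \<le> m\<close> len by simp
      ultimately show ?thesis using True len by (simp add: nth_append) linarith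
    next
      case False
      then show ?thesis using J(1) r[OF that] len that by (auto simp: nth_append)
    qed
    then have "{j. j \<le> m \<and> f j < i} = {..<J}" using iff J by auto
    then have "cumulative (simplex_push m f l) i = cumulative l J"
      by (simp only: cumulative_push) (simp add: cumulative_def)
    then show ?thesis using l(2)[of J] J len by simp
  qed
  then have "simplex_push m f l i = t i" for i
    using cumulative_Suc[of t i] cumulative_Suc[of "simplex_push m f l" i] by simp
  then have push: "simplex_push m f l = t" by auto
  have "nerve_pull G m f gs
      = map (\<lambda>j. inv (step G gs t (ps ! j)) \<otimes> step G gs t (ps ! Suc j)) [0..<m]"
    by (simp add: nerve_pull_vertices[OF gs f] step_def f_def)
  then have "((map (\<lambda>j. inv (step G gs t (ps ! j)) \<otimes> step G gs t (ps ! Suc j)) [0..<m], l), (gs, t))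
      = ((nerve_pull G m f gs, l), (gs, simplex_push m f l))"
    using push by simp
  then show ?thesis
    unfolding bar_glue_def m_def[symmetric] using gs l(1) f by blast
qed

text \<open>The converse of \<open>bar_equiv_translate\<close>: a point of the bar construction is the same thing as a step
  function up to left translation. Both cells are refined at the union of their cut points, where they
  become literally the same simplex.\<close>
theorem bar_equiv_step:
  assumes c: "(gs, t) \<in> bar_cells G" "(gs', t') \<in> bar_cells G" and \<gamma>: "\<gamma> \<in> carrier G"
    and s: "\<And>r. 0 \<le> r \<Longrightarrow> r < 1 \<Longrightarrow> step G gs' t' r = \<gamma> \<otimes> step G gs t r"
  shows "((gs, t), (gs', t')) \<in> bar_equiv G"
proof -
  define P where "P = (cumulative t ` {..length gs} \<union> cumulative t' ` {..length gs'}) \<inter> {0..<1}"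
  define ps where "ps = sorted_list_of_set P"
  have fin: "finite P" by (simp add: P_def)
  have gs: "set gs \<subseteq> carrier G" "set gs' \<subseteq> carrier G"
    and t: "t \<in> standard_simplex (length gs)" "t' \<in> standard_simplex (length gs')"
    using c by (auto simp: bar_cells_iff)
  have set: "set ps = P" using fin by (simp add: ps_def)
  have 0: "0 \<in> P" by (force simp: P_def image_iff intro: bexI[of _ 0])
  have ne: "ps \<noteq> []" using 0 set by auto
  have sorted: "sorted ps" "distinct ps" by (simp_all add: ps_def)
  have hd: "hd ps = 0"
  proof -
    have "hd ps \<le> 0" using sorted(1) ne 0 set by (cases ps) auto
    moreover have "hd ps \<in> P" using ne set by auto
    ultimately show ?thesis by (auto simp: P_def)
  qed
  have sub: "set ps \<subseteq> {0..<1}" using set by (auto simp: P_def)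
  have cov: "cumulative u i \<in> cumulative u ` {..n}" "0 \<le> cumulative u i"
    if "u \<in> standard_simplex n" "cumulative u i < 1" for u n i
  proof -
    have "i \<le> n" using that cumulative_beyond[OF that(1), of i] by (cases "n < i") auto
    then show "cumulative u i \<in> cumulative u ` {..n}" by simp
    show "0 \<le> cumulative u i" using cumulative_mono[OF that(1), of 0 i] by simp
  qed
  have in_ps: "cumulative t i < 1 \<Longrightarrow> cumulative t i \<in> set ps"
    "cumulative t' i < 1 \<Longrightarrow> cumulative t' i \<in> set ps" for i
    using cov[OF t(1)] cov[OF t(2)] unfolding set P_def by auto
  have eq: "inv (step G gs t (ps ! j)) \<otimes> step G gs t (ps ! Suc j)
      = inv (step G gs' t' (ps ! j)) \<otimes> step G gs' t' (ps ! Suc j)" if "j < length ps - 1" for j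
  proof -
    have "ps ! j \<in> {0..<1}" "ps ! Suc j \<in> {0..<1}"
      using that by (auto intro!: subsetD[OF sub] nth_mem simp del: atLeastLessThan_iff)
    then have "step G gs' t' (ps ! j) = \<gamma> \<otimes> step G gs t (ps ! j)"
      "step G gs' t' (ps ! Suc j) = \<gamma> \<otimes> step G gs t (ps ! Suc j)" using s by auto
    moreover have "inv (\<gamma> \<otimes> a) \<otimes> (\<gamma> \<otimes> b) = inv a \<otimes> b" if "a \<in> carrier G" "b \<in> carrier G" for a b
    proof -
      have "inv (\<gamma> \<otimes> a) \<otimes> (\<gamma> \<otimes> b) = inv a \<otimes> ((inv \<gamma> \<otimes> \<gamma>) \<otimes> b)"
        using that \<gamma> by (simp only: inv_mult_group m_assoc inv_closed m_closed)
      then show ?thesis using that \<gamma> by simp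
    qed
    ultimately show ?thesis using gs by (simp add: step_closed)
  qed
  have maps: "map (\<lambda>j. inv (step G gs t (ps ! j)) \<otimes> step G gs t (ps ! Suc j)) [0..<length ps - 1]
      = map (\<lambda>j. inv (step G gs' t' (ps ! j)) \<otimes> step G gs' t' (ps ! Suc j)) [0..<length ps - 1]"
    using eq by simp
  note common = refine_cell[OF c(1) sorted hd ne sub in_ps(1), unfolded maps]
    refine_cell[OF c(2) sorted hd ne sub in_ps(2)]
  show ?thesis
    unfolding bar_equiv_def
    by (rule rtrancl_trans[OF r_into_rtrancl r_into_rtrancl]) (use common in blast)+
qed

end

section \<open>Minima of convex functions on the tree of a free group\<close>

lemma length_push_letter:
  "length (push_letter x b) = (if b \<noteq> [] \<and> hd b = inv_letter x then length b - 1 else Suc (length b))"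
  by (cases b) auto

lemma length_foldr_push: "length (foldr push_letter u v) \<le> length u + length v"
proof (induction u)
  case (Cons x u)
  then show ?case using length_push_letter[of x "foldr push_letter u v"] by (auto split: if_splits)
qed simp

locale finite_rank_free_group =
  fixes X :: "'a set"
  assumes finite_generators: "finite X"
begin

abbreviation F where "F \<equiv> free_group X"
abbreviation letters :: "'a letter set" where "letters \<equiv> X \<times> UNIV"

sublocale group F by (rule group_free_group)

lemma carrier_iff: "u \<in> carrier F \<longleftrightarrow> set u \<subseteq> letters \<and> reduced u"
  by (auto simp: free_group_def)

lemma one_eq: "\<one>\<^bsub>F\<^esub> = []"
  by (simp add: free_group_def)

lemma mult_eq: "u \<otimes>\<^bsub>F\<^esub> v = foldr push_letter u v"
  by (simp add: free_group_def)

lemma letter_closed [simp]: "x \<in> letters \<Longrightarrow> [x] \<in> carrier F"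
  by (auto simp: carrier_iff reduced_Cons)

lemma letter_mult: "[x] \<otimes>\<^bsub>F\<^esub> v = push_letter x v"
  by (simp add: mult_eq)

lemma letter_Cons: "x # r \<in> carrier F \<Longrightarrow> x # r = [x] \<otimes>\<^bsub>F\<^esub> r"
  by (cases r) (auto simp: carrier_iff reduced_Cons letter_mult)

lemma inv_letter_in [simp]: "inv_letter x \<in> letters \<longleftrightarrow> x \<in> letters"
  by (auto simp: inv_letter_def mem_Times_iff)

lemma inv_letter_eq: "x \<in> letters \<Longrightarrow> inv\<^bsub>F\<^esub> [x] = [inv_letter x]"
  by (rule inv_equality) (auto simp: letter_mult one_eq)

lemma inv_eq: "u \<in> carrier F \<Longrightarrow> inv\<^bsub>F\<^esub> u = map inv_letter (rev u)"
proof (rule inv_equality)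
  assume "u \<in> carrier F"
  then show "map inv_letter (rev u) \<otimes>\<^bsub>F\<^esub> u = \<one>\<^bsub>F\<^esub>" "map inv_letter (rev u) \<in> carrier F"
    by (auto simp: one_eq mult_eq foldr_push_inv carrier_iff reduced_inv) (auto simp: inv_letter_def)
qed

lemma length_inv [simp]: "u \<in> carrier F \<Longrightarrow> length (inv\<^bsub>F\<^esub> u) = length u"
  by (simp add: inv_eq)

lemma length_mult: "length (u \<otimes>\<^bsub>F\<^esub> v) \<le> length u + length v"
  by (simp add: mult_eq length_foldr_push)

lemma length_le_dist:
  assumes "u \<in> carrier F" "a \<in> carrier F"
  shows "length u \<le> length (inv\<^bsub>F\<^esub> u \<otimes>\<^bsub>F\<^esub> a) + length a"
proof -
  have "inv\<^bsub>F\<^esub> u = (inv\<^bsub>F\<^esub> u \<otimes>\<^bsub>F\<^esub> a) \<otimes>\<^bsub>F\<^esub> inv\<^bsub>F\<^esub> a" using assms by (simp add: m_assoc)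
  then have "length (inv\<^bsub>F\<^esub> u) \<le> length (inv\<^bsub>F\<^esub> u \<otimes>\<^bsub>F\<^esub> a) + length (inv\<^bsub>F\<^esub> a)"
    using length_mult by metis
  then show ?thesis using assms by simp
qed

lemma finite_bounded_words: "finite {u \<in> carrier F. length u \<le> N}"
proof (rule finite_subset)
  show "{u \<in> carrier F. length u \<le> N} \<subseteq> {u. set u \<subseteq> letters \<and> length u \<le> N}"
    by (auto simp: carrier_iff)
  show "finite {u. set u \<subseteq> letters \<and> length u \<le> N}"
    by (intro finite_lists_length_le finite_cartesian_product finite_generators) simp
qed

text \<open>Strict convexity along the geodesics of the Cayley tree. It is a local condition: an interior vertex of
  a geodesic, together with its two neighbours there, is \<open>k\<close>, \<open>k x\<close>, \<open>k y\<close> for distinct letters.\<close>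
definition tree_convex :: "('a letter list \<Rightarrow> real) \<Rightarrow> bool" where
  "tree_convex f \<longleftrightarrow> (\<forall>k\<in>carrier F. \<forall>x\<in>letters. \<forall>y\<in>letters. x \<noteq> y \<longrightarrow>
     2 * f k < f (k \<otimes>\<^bsub>F\<^esub> [x]) + f (k \<otimes>\<^bsub>F\<^esub> [y]))"

text \<open>The increments of a convex function along a reduced word increase strictly, so once the first one is
  nonnegative the function never returns to its initial value.\<close>
lemma tree_convex_ray:
  assumes f: "tree_convex f" and p: "p \<in> carrier F" and xr: "x # r \<in> carrier F"
    and le: "f p \<le> f (p \<otimes>\<^bsub>F\<^esub> [x])"
  shows "f (p \<otimes>\<^bsub>F\<^esub> [x]) \<le> f (p \<otimes>\<^bsub>F\<^esub> (x # r)) \<and> (r \<noteq> [] \<longrightarrow> f (p \<otimes>\<^bsub>F\<^esub> [x]) < f (p \<otimes>\<^bsub>F\<^esub> (x # r)))"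
  using p xr le
proof (induction r arbitrary: p x)
  case (Cons y r)
  let ?p = "p \<otimes>\<^bsub>F\<^esub> [x]"
  have x: "x \<in> letters" and y: "y \<in> letters" and yr: "y # r \<in> carrier F" and xy: "y \<noteq> inv_letter x"
    using Cons.prems(2) by (auto simp: carrier_iff reduced_Cons)
  have p': "?p \<in> carrier F" using Cons.prems(1) x by simp
  have "?p \<otimes>\<^bsub>F\<^esub> [inv_letter x] = p"
    using Cons.prems(1) x by (simp add: m_assoc flip: inv_letter_eq)
  then have "2 * f ?p < f p + f (?p \<otimes>\<^bsub>F\<^esub> [y])"
    using f p' x y xy unfolding tree_convex_def by (metis inv_letter_in)
  then have less: "f ?p < f (?p \<otimes>\<^bsub>F\<^esub> [y])" using Cons.prems(3) by simp
  have "p \<otimes>\<^bsub>F\<^esub> (x # y # r) = ?p \<otimes>\<^bsub>F\<^esub> (y # r)"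
    using letter_Cons[OF Cons.prems(2)] Cons.prems(1) x yr by (simp add: m_assoc)
  then show ?case using Cons.IH[OF p' yr] less by auto
qed simp

text \<open>For \<open>e = False\<close> the vertex \<open>v\<close> is the strict global minimum. For \<open>e = True\<close> the two ends of an edge are
  strictly below all other vertices, and \<open>v\<close> is its origin for the direction given by the generators. The
  free group inverts no edge, so the choice of the origin is canonical. How the values at the two ends
  compare is left open: strict inequalities alone give an open condition on the weights of a second moment, and
  one of the two conditions always holds.\<close>
definition min_at :: "bool \<Rightarrow> ('a letter list \<Rightarrow> real) \<Rightarrow> 'a letter list \<Rightarrow> bool" where
  "min_at e f v \<longleftrightarrow> v \<in> carrier F \<and>
     (if e then \<exists>y\<in>X. \<forall>u\<in>carrier F - {v, v \<otimes>\<^bsub>F\<^esub> [(y, True)]}.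
                   f v < f u \<and> f (v \<otimes>\<^bsub>F\<^esub> [(y, True)]) < f u
      else \<forall>u\<in>carrier F - {v}. f v < f u)"

lemma min_at_closed: "min_at e f v \<Longrightarrow> v \<in> carrier F"
  by (simp add: min_at_def)

text \<open>Two such edges have the same pair of ends. If their origins differed, a product of two generators would
  be trivial.\<close>
lemma min_at_unique:
  assumes "min_at e f v" "min_at e f v'"
  shows "v = v'"
proof (cases e)
  case True
  obtain y y' where *: "v \<in> carrier F" "v' \<in> carrier F" "y \<in> X" "y' \<in> X"
    and less: "\<And>u. u \<in> carrier F \<Longrightarrow> u \<notin> {v, v \<otimes>\<^bsub>F\<^esub> [(y, True)]} \<Longrightarrow> f v < f u \<and> f (v \<otimes>\<^bsub>F\<^esub> [(y, True)]) < f u"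
    and less': "\<And>u. u \<in> carrier F \<Longrightarrow> u \<notin> {v', v' \<otimes>\<^bsub>F\<^esub> [(y', True)]} \<Longrightarrow> f v' < f u \<and> f (v' \<otimes>\<^bsub>F\<^esub> [(y', True)]) < f u"
    using assms True unfolding min_at_def by auto
  let ?a = "v \<otimes>\<^bsub>F\<^esub> [(y, True)]" and ?b = "v' \<otimes>\<^bsub>F\<^esub> [(y', True)]"
  have c: "?a \<in> carrier F" "?b \<in> carrier F" using * by simp_all
  have ne: "?a \<noteq> v" "?b \<noteq> v'" using * by (simp_all add: one_eq)
  have "{v, ?a} = {v', ?b}"
  proof (rule ccontr)
    assume neq: "{v, ?a} \<noteq> {v', ?b}"
    have "\<exists>p\<in>{v, ?a}. p \<notin> {v', ?b}" "\<exists>q\<in>{v', ?b}. q \<notin> {v, ?a}" using neq ne by auto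
    then obtain p q where "p \<in> {v, ?a}" "p \<notin> {v', ?b}" "q \<in> {v', ?b}" "q \<notin> {v, ?a}" by blast
    then have "f p < f q" "f q < f p" using less[of q] less'[of p] * c by auto
    then show False by simp
  qed
  moreover have False if "v' = ?a" "v = ?b"
  proof -
    have "v \<otimes>\<^bsub>F\<^esub> ([(y, True)] \<otimes>\<^bsub>F\<^esub> [(y', True)]) = v \<otimes>\<^bsub>F\<^esub> \<one>\<^bsub>F\<^esub>"
      using that * by (simp add: m_assoc[symmetric])
    then have "[(y, True)] \<otimes>\<^bsub>F\<^esub> [(y', True)] = \<one>\<^bsub>F\<^esub>"
      using * by (subst (asm) Units_l_cancel) simp_all
    then show False by (simp add: inv_letter_def letter_mult one_eq)
  qed
  ultimately show ?thesis by (auto simp: doubleton_eq_iff)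
next
  case False
  show ?thesis
  proof (rule ccontr)
    assume "v \<noteq> v'"
    then have "f v < f v'" "f v' < f v" using assms False by (auto simp: min_at_def)
    then show False by simp
  qed
qed

text \<open>By convexity along the geodesic between them, two minima are adjacent; and two minima adjacent to a third
  one contradict convexity there.\<close>
lemma tree_convex_min_at:
  assumes f: "tree_convex f" and v: "v \<in> carrier F" and min: "\<And>u. u \<in> carrier F \<Longrightarrow> f v \<le> f u"
  shows "\<exists>e v. min_at e f v"
proof (cases "\<forall>u\<in>carrier F - {v}. f v < f u")
  case True
  then have "min_at False f v" using v by (simp add: min_at_def)
  then show ?thesis by blast
next
  case False
  have adjacent: "\<exists>x\<in>letters. u = v \<otimes>\<^bsub>F\<^esub> [x]" if u: "u \<in> carrier F" "u \<noteq> v" "f u \<le> f v" for u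
  proof -
    define s where "s = inv\<^bsub>F\<^esub> v \<otimes>\<^bsub>F\<^esub> u"
    have s: "s \<in> carrier F" "u = v \<otimes>\<^bsub>F\<^esub> s" using u v by (simp_all add: s_def m_assoc[symmetric])
    then obtain x r where xr: "s = x # r" using u(2) v by (cases s) (auto simp flip: one_eq)
    have x: "x \<in> letters" using s(1) xr by (simp add: carrier_iff)
    have "f v \<le> f (v \<otimes>\<^bsub>F\<^esub> [x])" using min v x by simp
    then have "r = []"
      using tree_convex_ray[OF f v s(1)[unfolded xr]] u(3) s(2) xr by force
    then show ?thesis using s xr x by blast
  qed
  obtain u where u: "u \<in> carrier F" "u \<noteq> v" "f u \<le> f v" using False by force
  obtain x where x: "x \<in> letters" "u = v \<otimes>\<^bsub>F\<^esub> [x]" using adjacent[OF u] by blast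
  have other: "f v < f z" "f u < f z" if z: "z \<in> carrier F" "z \<noteq> v" "z \<noteq> u" for z
  proof -
    show "f v < f z"
    proof (rule ccontr)
      assume "\<not> f v < f z"
      then have "f z \<le> f v" by simp
      then obtain y where y: "y \<in> letters" "z = v \<otimes>\<^bsub>F\<^esub> [y]" using adjacent z by blast
      then have "y \<noteq> x" using z x by blast
      then have "2 * f v < f z + f u"
        using f[unfolded tree_convex_def, rule_format, OF v y(1) x(1)] x(2) y(2) by simp
      with \<open>f z \<le> f v\<close> u show False by simp
    qed
    with u(3) show "f u < f z" by simp
  qed
  obtain g b where g: "x = (g, b)" by (cases x)
  show ?thesis
  proof (cases b)
    case True
    have "min_at True f v"
      unfolding min_at_def using v x g True other by (auto intro!: bexI[of _ g])
    then show ?thesis by blast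
  next
    case False
    have "v = u \<otimes>\<^bsub>F\<^esub> [(g, True)]"
      using x g False v inv_letter_eq[of x] inv_letter_eq[of "(g, True)"]
      by (simp add: m_assoc inv_letter_def) (simp add: inv_letter_def letter_mult one_eq)
    then have "min_at True f u"
      unfolding min_at_def using u v x g other by (auto intro!: bexI[of _ g])
    then show ?thesis by blast
  qed
qed

definition act :: "'a letter list \<Rightarrow> ('a letter list \<Rightarrow> real) \<Rightarrow> 'a letter list \<Rightarrow> real" where
  "act u f = (\<lambda>k\<in>carrier F. f (inv\<^bsub>F\<^esub> u \<otimes>\<^bsub>F\<^esub> k))"

lemma act_mult: "u \<in> carrier F \<Longrightarrow> u' \<in> carrier F \<Longrightarrow> act u (act u' f) = act (u \<otimes>\<^bsub>F\<^esub> u') f"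
  by (auto simp: act_def fun_eq_iff inv_mult_group m_assoc)

lemma act_one: "f \<in> extensional (carrier F) \<Longrightarrow> act \<one>\<^bsub>F\<^esub> f = f"
  by (auto simp: act_def fun_eq_iff extensional_def)

lemma min_at_act1:
  assumes u: "u \<in> carrier F" and m: "min_at e f v"
  shows "min_at e (act u f) (u \<otimes>\<^bsub>F\<^esub> v)"
proof -
  have v: "v \<in> carrier F" using m by (rule min_at_closed)
  have act: "act u f (u \<otimes>\<^bsub>F\<^esub> k) = f k" if "k \<in> carrier F" for k
    using u that by (simp add: act_def m_assoc[symmetric])
  have pull: "\<exists>k\<in>carrier F. z = u \<otimes>\<^bsub>F\<^esub> k" if "z \<in> carrier F" for z
    using u that by (intro bexI[of _ "inv\<^bsub>F\<^esub> u \<otimes>\<^bsub>F\<^esub> z"]) (simp_all add: m_assoc[symmetric])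
  show ?thesis
  proof (cases e)
    case True
    then obtain y where y: "y \<in> X" and less: "\<And>z. z \<in> carrier F \<Longrightarrow> z \<notin> {v, v \<otimes>\<^bsub>F\<^esub> [(y, True)]} \<Longrightarrow>
        f v < f z \<and> f (v \<otimes>\<^bsub>F\<^esub> [(y, True)]) < f z"
      using m by (auto simp: min_at_def)
    have a: "u \<otimes>\<^bsub>F\<^esub> v \<otimes>\<^bsub>F\<^esub> [(y, True)] = u \<otimes>\<^bsub>F\<^esub> (v \<otimes>\<^bsub>F\<^esub> [(y, True)])" "v \<otimes>\<^bsub>F\<^esub> [(y, True)] \<in> carrier F"
      using u v y by (simp_all add: m_assoc)
    have "\<forall>z\<in>carrier F - {u \<otimes>\<^bsub>F\<^esub> v, u \<otimes>\<^bsub>F\<^esub> v \<otimes>\<^bsub>F\<^esub> [(y, True)]}.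
        act u f (u \<otimes>\<^bsub>F\<^esub> v) < act u f z \<and> act u f (u \<otimes>\<^bsub>F\<^esub> v \<otimes>\<^bsub>F\<^esub> [(y, True)]) < act u f z"
    proof
      fix z assume z: "z \<in> carrier F - {u \<otimes>\<^bsub>F\<^esub> v, u \<otimes>\<^bsub>F\<^esub> v \<otimes>\<^bsub>F\<^esub> [(y, True)]}"
      then obtain k where k: "k \<in> carrier F" "z = u \<otimes>\<^bsub>F\<^esub> k" using pull by blast
      then have ne: "k \<notin> {v, v \<otimes>\<^bsub>F\<^esub> [(y, True)]}" using z unfolding a(1) by blast
      then show "act u f (u \<otimes>\<^bsub>F\<^esub> v) < act u f z \<and> act u f (u \<otimes>\<^bsub>F\<^esub> v \<otimes>\<^bsub>F\<^esub> [(y, True)]) < act u f z"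
        using less[OF k(1) ne] unfolding a(1) k(2) by (simp only: act[OF v] act[OF k(1)] act[OF a(2)])
    qed
    then show ?thesis using True y u v unfolding min_at_def by auto
  next
    case False
    have "\<forall>z\<in>carrier F - {u \<otimes>\<^bsub>F\<^esub> v}. act u f (u \<otimes>\<^bsub>F\<^esub> v) < act u f z"
      using pull m False act v by (fastforce simp: min_at_def)
    then show ?thesis using False u v by (simp add: min_at_def)
  qed
qed

lemma min_at_cong:
  assumes m: "min_at e f v" and eq: "\<And>k. k \<in> carrier F \<Longrightarrow> f k = g k"
  shows "min_at e g v"
proof -
  have v: "v \<in> carrier F" using m by (rule min_at_closed)
  then have "v \<otimes>\<^bsub>F\<^esub> [(y, True)] \<in> carrier F" if "y \<in> X" for y using that by simp
  with m v eq show ?thesis unfolding min_at_def by (cases e) fastforce+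
qed

lemma min_at_restrict: "min_at e (restrict f (carrier F)) v \<longleftrightarrow> min_at e f v"
  by (blast intro: min_at_cong restrict_apply' restrict_apply'[symmetric])

lemma min_at_act:
  assumes u: "u \<in> carrier F" and v: "v \<in> carrier F"
  shows "min_at e (act u f) v \<longleftrightarrow> min_at e f (inv\<^bsub>F\<^esub> u \<otimes>\<^bsub>F\<^esub> v)"
proof
  assume "min_at e (act u f) v"
  then have "min_at e (act (inv\<^bsub>F\<^esub> u) (act u f)) (inv\<^bsub>F\<^esub> u \<otimes>\<^bsub>F\<^esub> v)"
    using u by (intro min_at_act1) simp_all
  moreover have "act (inv\<^bsub>F\<^esub> u) (act u f) = restrict f (carrier F)"
    using u by (simp add: act_mult l_inv) (simp add: act_def fun_eq_iff)
  ultimately show "min_at e f (inv\<^bsub>F\<^esub> u \<otimes>\<^bsub>F\<^esub> v)" by (simp add: min_at_restrict)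
next
  assume "min_at e f (inv\<^bsub>F\<^esub> u \<otimes>\<^bsub>F\<^esub> v)"
  from min_at_act1[OF u this] show "min_at e (act u f) v"
    using u v by (simp add: m_assoc[symmetric])
qed

text \<open>A translation that fixes a function fixes its canonical minimum, and translations of the tree are free.\<close>
lemma act_free:
  assumes "min_at e f v" "u \<in> carrier F" "act u f = f"
  shows "u = \<one>\<^bsub>F\<^esub>"
proof -
  have v: "v \<in> carrier F" using assms(1) by (rule min_at_closed)
  have "u \<otimes>\<^bsub>F\<^esub> v = v"
    using min_at_act1[OF assms(2,1)] assms by (auto intro: min_at_unique)
  then show ?thesis using assms(2) v by simp
qed

text \<open>The second moment about \<open>k\<close> of the distribution with mass \<open>t i\<close> at \<open>a i\<close>, for the word metric. Its
  minimum plays the part of the barycentre in the tree. The value outside of the group is pinned so that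
  equality of functions means equality on the group.\<close>
definition moment :: "nat \<Rightarrow> (nat \<Rightarrow> real) \<Rightarrow> (nat \<Rightarrow> 'a letter list) \<Rightarrow> 'a letter list \<Rightarrow> real" where
  "moment n t a = (\<lambda>k\<in>carrier F. \<Sum>i\<le>n. t i * (real (length (inv\<^bsub>F\<^esub> k \<otimes>\<^bsub>F\<^esub> a i)))\<^sup>2)"

text \<open>At most one neighbour of a vertex of a tree is closer to a given point, and \<open>(n + 1)\<^sup>2 + (n - 1)\<^sup>2\<close>
  exceeds \<open>2 n\<^sup>2\<close> by two.\<close>
lemma length_push_convex:
  assumes "x \<noteq> y"
  shows "2 * (real (length b))\<^sup>2 + 2 \<le> (real (length (push_letter x b)))\<^sup>2 + (real (length (push_letter y b)))\<^sup>2"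
proof -
  have "x = y" if "b \<noteq> [] \<and> hd b = inv_letter x" "b \<noteq> [] \<and> hd b = inv_letter y"
    using that by (metis inv_letter_inv_letter)
  moreover have "real (length b - Suc 0) = real (length b) - 1" if "b \<noteq> []"
    using that by (cases b) auto
  ultimately show ?thesis
    using assms by (auto simp: length_push_letter power2_eq_square algebra_simps)
qed

lemma tree_convex_moment:
  assumes t: "t \<in> standard_simplex n" and a: "\<And>i. i \<le> n \<Longrightarrow> a i \<in> carrier F"
  shows "tree_convex (moment n t a)"
  unfolding tree_convex_def
proof (intro ballI impI)
  fix k x y assume k: "k \<in> carrier F" and xy: "x \<in> letters" "y \<in> letters" "x \<noteq> y"
  have "inv_letter x \<noteq> inv_letter y" using xy(3) by (metis inv_letter_inv_letter)
  then have dist: "2 * (real (length (inv\<^bsub>F\<^esub> k \<otimes>\<^bsub>F\<^esub> a i)))\<^sup>2 + 2 \<le>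
      (real (length (inv\<^bsub>F\<^esub> (k \<otimes>\<^bsub>F\<^esub> [x]) \<otimes>\<^bsub>F\<^esub> a i)))\<^sup>2 + (real (length (inv\<^bsub>F\<^esub> (k \<otimes>\<^bsub>F\<^esub> [y]) \<otimes>\<^bsub>F\<^esub> a i)))\<^sup>2" if "i \<le> n" for i
    using length_push_convex[of "inv_letter x" "inv_letter y" "inv\<^bsub>F\<^esub> k \<otimes>\<^bsub>F\<^esub> a i"] k xy a[OF that]
    by (simp add: inv_mult_group m_assoc) (simp add: inv_letter_eq letter_mult)
  have "2 * moment n t a k + 2 = (\<Sum>i\<le>n. t i * (2 * (real (length (inv\<^bsub>F\<^esub> k \<otimes>\<^bsub>F\<^esub> a i)))\<^sup>2 + 2))"
    using k simplex_sum[OF t]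
    by (simp add: moment_def sum_distrib_left sum.distrib algebra_simps flip: sum_distrib_right)
  also have "\<dots> \<le> (\<Sum>i\<le>n. t i * ((real (length (inv\<^bsub>F\<^esub> (k \<otimes>\<^bsub>F\<^esub> [x]) \<otimes>\<^bsub>F\<^esub> a i)))\<^sup>2
      + (real (length (inv\<^bsub>F\<^esub> (k \<otimes>\<^bsub>F\<^esub> [y]) \<otimes>\<^bsub>F\<^esub> a i)))\<^sup>2))"
    using dist simplex_nonneg[OF t] by (intro sum_mono mult_left_mono) auto
  also have "\<dots> = moment n t a (k \<otimes>\<^bsub>F\<^esub> [x]) + moment n t a (k \<otimes>\<^bsub>F\<^esub> [y])"
    using k xy by (simp add: moment_def sum.distrib algebra_simps)
  finally show "2 * moment n t a k < moment n t a (k \<otimes>\<^bsub>F\<^esub> [x]) + moment n t a (k \<otimes>\<^bsub>F\<^esub> [y])" by simp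
qed

text \<open>This bound is uniform in the weights. It reduces statements about all vertices of the infinite tree to
  finitely many comparisons.\<close>
lemma moment_far:
  assumes t: "t \<in> standard_simplex n" and a: "\<And>i. i \<le> n \<Longrightarrow> a i \<in> carrier F \<and> length (a i) \<le> R"
    and v: "v \<in> carrier F" and u: "u \<in> carrier F" "length v + 2 * R < length u"
  shows "moment n t a v < moment n t a u"
proof -
  have "moment n t a v \<le> (\<Sum>i\<le>n. t i * (real (length v + R))\<^sup>2)"
  proof -
    have "length (inv\<^bsub>F\<^esub> v \<otimes>\<^bsub>F\<^esub> a i) \<le> length v + R" if "i \<le> n" for i
      using length_mult[of "inv\<^bsub>F\<^esub> v" "a i"] a[OF that] v by simp
    then show ?thesis
      using v simplex_nonneg[OF t] unfolding moment_def
      by (simp del: of_nat_add) (intro sum_mono mult_left_mono power_mono of_nat_mono; simp)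
  qed
  also have "\<dots> = (real (length v + R))\<^sup>2" using simplex_sum[OF t] by (simp flip: sum_distrib_right)
  also have "\<dots> < (real (length u - R))\<^sup>2" using u by (intro power_strict_mono) auto
  also have "\<dots> = (\<Sum>i\<le>n. t i * (real (length u - R))\<^sup>2)" using simplex_sum[OF t] by (simp flip: sum_distrib_right)
  also have "\<dots> \<le> moment n t a u"
  proof -
    have "length u - R \<le> length (inv\<^bsub>F\<^esub> u \<otimes>\<^bsub>F\<^esub> a i)" if "i \<le> n" for i
      using length_le_dist[of u "a i"] a[OF that] u by linarith
    then show ?thesis
      using u simplex_nonneg[OF t] unfolding moment_def
      by (simp del: of_nat_diff) (intro sum_mono mult_left_mono power_mono of_nat_mono; simp)
  qed
  finally show ?thesis .
qed

lemma bounded_vertices: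
  fixes a :: "nat \<Rightarrow> 'a letter list"
  obtains R where "\<And>i. i \<le> n \<Longrightarrow> length (a i) \<le> R"
proof
  show "length (a i) \<le> Max ((\<lambda>i. length (a i)) ` {..n})" if "i \<le> n" for i
    using that by (intro Max_ge) auto
qed

lemma moment_min_at:
  assumes t: "t \<in> standard_simplex n" and a: "\<And>i. i \<le> n \<Longrightarrow> a i \<in> carrier F"
  shows "\<exists>e v. min_at e (moment n t a) v"
proof -
  obtain R where R: "\<And>i. i \<le> n \<Longrightarrow> length (a i) \<le> R" using bounded_vertices[of n a] by blast
  let ?K = "{u \<in> carrier F. length u \<le> 2 * R}"
  have ne: "\<one>\<^bsub>F\<^esub> \<in> ?K" using one_closed by (simp add: one_eq)
  obtain v where v: "v \<in> ?K" "\<And>u. u \<in> ?K \<Longrightarrow> moment n t a v \<le> moment n t a u"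
    using arg_min_if_finite[OF finite_bounded_words, of "2 * R" "moment n t a"] ne
    by (metis (no_types, lifting) empty_iff linorder_not_le)
  have "moment n t a v \<le> moment n t a u" if "u \<in> carrier F" for u
  proof (cases "u \<in> ?K")
    case False
    then have "moment n t a \<one>\<^bsub>F\<^esub> < moment n t a u"
      using a R that one_closed by (intro moment_far[OF t, of a R]) (auto simp: one_eq)
    then show ?thesis using v(2)[OF ne] by simp
  qed (rule v(2))
  then show ?thesis using v(1) by (intro tree_convex_min_at[OF tree_convex_moment[OF t a]]) auto
qed

lemma openin_moment_less:
  assumes "u \<in> carrier F" "v \<in> carrier F"
  shows "openin (subtopology (powertop_real UNIV) (standard_simplex n))
    {t \<in> standard_simplex n. moment n t a u < moment n t a v}"
proof -
  have "continuous_map (subtopology (powertop_real UNIV) (standard_simplex n)) euclideanreal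
      (\<lambda>t. moment n t a v - moment n t a u)"
    using assms unfolding moment_def
    by (auto intro!: continuous_intros continuous_map_from_subtopology continuous_map_product_projection)
  from openin_continuous_map_preimage[OF this, of "{0<..}"] show ?thesis by simp
qed

text \<open>By \<open>moment_far\<close> only finitely many strict inequalities between continuous functions of \<open>t\<close> are involved.\<close>
lemma openin_min_at:
  assumes a: "\<And>i. i \<le> n \<Longrightarrow> a i \<in> carrier F"
  shows "openin (subtopology (powertop_real UNIV) (standard_simplex n))
    {t \<in> standard_simplex n. min_at e (moment n t a) v}" (is "openin ?T _")
proof (cases "v \<in> carrier F")
  case v: True
  obtain R where R: "\<And>i. i \<le> n \<Longrightarrow> length (a i) \<le> R" using bounded_vertices[of n a] by blast
  define K where "K = {u \<in> carrier F. length u \<le> Suc (length v) + 2 * R}"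
  have K: "finite K" unfolding K_def by (rule finite_bounded_words)
  have far: "moment n t a p < moment n t a u"
    if "t \<in> standard_simplex n" "p \<in> carrier F" "length p \<le> Suc (length v)" "u \<in> carrier F" "u \<notin> K" for t p u
    using that a R by (intro moment_far[of t n a R]) (auto simp: K_def)
  have Inter: "openin ?T {t \<in> standard_simplex n. \<forall>u\<in>A. Q u t}"
    if "finite A" "\<And>u. u \<in> A \<Longrightarrow> openin ?T {t \<in> standard_simplex n. Q u t}" for A Q
  proof -
    have "{t \<in> standard_simplex n. \<forall>u\<in>A. Q u t}
        = standard_simplex n \<inter> (\<Inter>u\<in>A. {t \<in> standard_simplex n. Q u t})" by auto
    moreover have "openin ?T (topspace ?T \<inter> (\<Inter>u\<in>A. {t \<in> standard_simplex n. Q u t}))"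
    proof (cases "A = {}")
      case False
      have "openin ?T (\<Inter>u\<in>A. {t \<in> standard_simplex n. Q u t})"
        using that False by (intro openin_Inter) auto
      then show ?thesis by (rule openin_Int[OF openin_topspace])
    next
      case True
      then show ?thesis using openin_topspace[of ?T] by simp
    qed
    ultimately show ?thesis by simp
  qed
  show ?thesis
  proof (cases e)
    case False
    have "{t \<in> standard_simplex n. min_at e (moment n t a) v}
        = {t \<in> standard_simplex n. \<forall>u\<in>K - {v}. moment n t a v < moment n t a u}"
      using far[of _ v] v False by (auto simp: min_at_def K_def)
    moreover have "openin ?T {t \<in> standard_simplex n. \<forall>u\<in>K - {v}. moment n t a v < moment n t a u}"
      using v K by (intro Inter openin_moment_less) (auto simp: K_def)
    ultimately show ?thesis by simp
  next
    case True
    let ?w = "\<lambda>y. v \<otimes>\<^bsub>F\<^esub> [(y, True)]"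
    have w: "?w y \<in> carrier F" "length (?w y) \<le> Suc (length v)" if "y \<in> X" for y
      using v that length_mult[of v "[(y, True)]"] by simp_all
    have eq: "{t \<in> standard_simplex n. min_at e (moment n t a) v} = (\<Union>y\<in>X.
        {t \<in> standard_simplex n. \<forall>u\<in>K - {v, ?w y}. moment n t a v < moment n t a u \<and> moment n t a (?w y) < moment n t a u})"
      (is "_ = (\<Union>y\<in>X. ?Q y)")
    proof -
      have "(\<forall>u\<in>carrier F - {v, ?w y}. moment n t a v < moment n t a u \<and> moment n t a (?w y) < moment n t a u)
          \<longleftrightarrow> (\<forall>u\<in>K - {v, ?w y}. moment n t a v < moment n t a u \<and> moment n t a (?w y) < moment n t a u)"
        if "t \<in> standard_simplex n" "y \<in> X" for t y
        using far[OF that(1) v] far[OF that(1) w[OF that(2)]] by (auto simp: K_def)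
      then show ?thesis using True v by (auto simp: min_at_def)
    qed
    have "openin ?T (?Q y)" if "y \<in> X" for y
    proof (rule Inter)
      show "finite (K - {v, ?w y})" using K by simp
      fix u assume "u \<in> K - {v, ?w y}"
      then have u: "u \<in> carrier F" by (simp add: K_def)
      have "{t \<in> standard_simplex n. moment n t a v < moment n t a u \<and> moment n t a (?w y) < moment n t a u}
          = {t \<in> standard_simplex n. moment n t a v < moment n t a u} \<inter> {t \<in> standard_simplex n. moment n t a (?w y) < moment n t a u}"
        by auto
      then show "openin ?T {t \<in> standard_simplex n. moment n t a v < moment n t a u \<and> moment n t a (?w y) < moment n t a u}"
        using openin_moment_less[OF v u] openin_moment_less[OF w(1)[OF that] u] by (simp add: openin_Int)
    qed
    then show ?thesis unfolding eq by (intro openin_Union) auto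
  qed
qed (simp add: min_at_def)

lemma act_moment:
  assumes "u \<in> carrier F" "\<And>i. i \<le> n \<Longrightarrow> a i \<in> carrier F"
  shows "act u (moment n t a) = moment n t (\<lambda>i. u \<otimes>\<^bsub>F\<^esub> a i)"
  using assms by (auto simp: act_def moment_def fun_eq_iff inv_mult_group m_assoc intro!: sum.cong)

text \<open>The second moment of a finite cyclic subgroup, with equal weights, is invariant under that subgroup.
  Since translations act freely on the functions with a canonical minimum, the subgroup is trivial.\<close>
theorem torsion_free:
  assumes w: "w \<in> carrier F" and m: "w [^]\<^bsub>F\<^esub> (m::nat) = \<one>\<^bsub>F\<^esub>" "0 < m"
  shows "w = \<one>\<^bsub>F\<^esub>"
proof -
  define n where "n = m - 1"
  have n: "m = Suc n" using m(2) by (simp add: n_def)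
  define t :: "nat \<Rightarrow> real" where "t i = (if i \<le> n then 1 / m else 0)" for i
  have t: "t \<in> standard_simplex n" using n by (intro simplexI) (auto simp: t_def)
  define a where "a i = w [^]\<^bsub>F\<^esub> i" for i :: nat
  have a: "a i \<in> carrier F" for i using w by (simp add: a_def)
  have "(\<Sum>i\<le>n. \<phi> (w \<otimes>\<^bsub>F\<^esub> a i)) = (\<Sum>i\<le>n. \<phi> (a i))" for \<phi> :: "'a letter list \<Rightarrow> real"
  proof -
    have "(\<Sum>i\<le>n. \<phi> (w \<otimes>\<^bsub>F\<^esub> a i)) = (\<Sum>i\<le>n. \<phi> (a (Suc i)))"
      using nat_pow_Suc2[OF w] by (simp only: a_def)
    also have "\<dots> = (\<Sum>i<n. \<phi> (a (Suc i))) + \<phi> (a 0)"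
      using m n by (simp add: a_def del: nat_pow_Suc flip: lessThan_Suc_atMost)
    also have "\<dots> = (\<Sum>i\<le>n. \<phi> (a i))"
      by (subst lessThan_Suc_atMost[symmetric]) (simp only: sum.lessThan_Suc_shift add.commute)
    finally show ?thesis .
  qed
  from this[of "\<lambda>b. (1 / m) * (real (length (inv\<^bsub>F\<^esub> k \<otimes>\<^bsub>F\<^esub> b)))\<^sup>2" for k]
  have "moment n t (\<lambda>i. w \<otimes>\<^bsub>F\<^esub> a i) = moment n t a"
    by (auto simp: moment_def t_def fun_eq_iff)
  then have "act w (moment n t a) = moment n t a" using act_moment[OF w a] by simp
  moreover obtain e v where "min_at e (moment n t a) v"
    using moment_min_at[OF t, of a] a by blast
  ultimately show ?thesis using act_free w by simp
qed

end

section \<open>Sweeping out a path between two step functions\<close>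

abbreviation simplex_top :: "nat \<Rightarrow> (nat \<Rightarrow> real) topology" where
  "simplex_top n \<equiv> subtopology (powertop_real UNIV) (standard_simplex n)"

abbreviation bar_class :: "('g, 'm) monoid_scheme \<Rightarrow> 'g list \<Rightarrow> (nat \<Rightarrow> real) \<Rightarrow> 'g bar_point" where
  "bar_class G gs t \<equiv> bar_equiv G `` {(gs, t)}"

lemma bar_class_eq_iff: "bar_class G gs t = bar_class G gs' t' \<longleftrightarrow> ((gs, t), (gs', t')) \<in> bar_equiv G"
  using eq_equiv_class_iff[OF equiv_bar_equiv[of G], of "(gs, t)" "(gs', t')"] by simp

lemma continuous_map_bar_class:
  assumes gs: "gs \<in> lists (carrier G)"
  shows "continuous_map (simplex_top (length gs)) (classifying_space G) (bar_class G gs)"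
  unfolding continuous_map_def
proof (intro conjI allI impI)
  show "bar_class G gs \<in> topspace (simplex_top (length gs)) \<rightarrow> topspace (classifying_space G)"
    using bar_class_in[OF gs] by auto
  fix U assume "openin (classifying_space G) U"
  then show "openin (simplex_top (length gs)) {t \<in> topspace (simplex_top (length gs)). bar_class G gs t \<in> U}"
    using gs by (simp add: openin_classifying_space)
qed

lemma continuous_map_simplex_coordinate: "continuous_map (simplex_top n) euclideanreal (\<lambda>t. t i)"
  by (intro continuous_map_from_subtopology continuous_map_product_projection) simp

lemma continuous_map_into_simplex:
  assumes "\<And>i. continuous_map X euclideanreal (\<lambda>x. f x i)" "\<And>x. x \<in> topspace X \<Longrightarrow> f x \<in> standard_simplex n"
  shows "continuous_map X (simplex_top n) f"
  using assms by (auto simp: continuous_map_in_subtopology continuous_map_componentwise_UNIV)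

text \<open>Used for the compact-open topology: a condition that holds for all times in a compact set is open.\<close>
lemma openin_tube:
  assumes f: "continuous_map (prod_topology X Y) Z f" and Y: "compact_space Y" and V: "openin Z V"
  shows "openin X {x \<in> topspace X. \<forall>y\<in>topspace Y. f (x, y) \<in> V}"
proof -
  let ?C = "topspace (prod_topology X Y) - {p \<in> topspace (prod_topology X Y). f p \<in> V}"
  have "closedin (prod_topology X Y) ?C"
    by (rule closedin_diff[OF closedin_topspace openin_continuous_map_preimage[OF f V]])
  then have "closedin X (fst ` ?C)"
    using Abstract_Topological_Spaces.closed_map_fst[OF Y, of X] unfolding closed_map_def by blast
  then have "openin X (topspace X - fst ` ?C)" by (intro openin_diff) auto
  moreover have "topspace X - fst ` ?C = {x \<in> topspace X. \<forall>y\<in>topspace Y. f (x, y) \<in> V}"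
  proof (rule Set.set_eqI)
    fix x
    have "x \<in> fst ` ?C \<longleftrightarrow> (\<exists>y. (x, y) \<in> ?C)" by force
    then show "x \<in> topspace X - fst ` ?C \<longleftrightarrow> x \<in> {x \<in> topspace X. \<forall>y\<in>topspace Y. f (x, y) \<in> V}"
      by auto
  qed
  ultimately show ?thesis by simp
qed

text \<open>For two lists with \<open>n + 1\<close> vertices each, read one after the other, \<open>sweep n t \<tau>\<close> distributes the
  weights \<open>t\<close> so that the step function takes its values from the first list on \<open>[0, 1 - \<tau>)\<close> and
  from the second one on \<open>[1 - \<tau>, 1)\<close>, with the cuts of \<open>t\<close> in both parts. As \<open>\<tau>\<close> grows from 0 to 1, the values of
  the first function are replaced by those of the second, continuously and from the right.\<close>
definition kept :: "(nat \<Rightarrow> real) \<Rightarrow> real \<Rightarrow> nat \<Rightarrow> real" where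
  "kept t \<tau> j = min (t j) (max 0 (1 - \<tau> - cumulative t j))"

definition sweep :: "nat \<Rightarrow> (nat \<Rightarrow> real) \<Rightarrow> real \<Rightarrow> nat \<Rightarrow> real" where
  "sweep n t \<tau> j = (if j \<le> n then kept t \<tau> j
     else if j \<le> Suc (2 * n) then t (j - Suc n) - kept t \<tau> (j - Suc n) else 0)"

lemma cumulative_kept:
  assumes "t \<in> standard_simplex n" "0 \<le> \<tau>" "\<tau> \<le> 1"
  shows "cumulative (kept t \<tau>) j = min (cumulative t j) (1 - \<tau>)"
proof (induction j)
  case (Suc j)
  then show ?case using simplex_nonneg[OF assms(1), of j]
    by (auto simp: cumulative_Suc kept_def min_def max_def)
qed (use assms in simp)

lemma cumulative_sweep:
  assumes t: "t \<in> standard_simplex n" and \<tau>: "0 \<le> \<tau>" "\<tau> \<le> 1"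
  shows "j \<le> Suc n \<Longrightarrow> cumulative (sweep n t \<tau>) j = min (cumulative t j) (1 - \<tau>)"
    and "k \<le> Suc n \<Longrightarrow> cumulative (sweep n t \<tau>) (Suc n + k) = max (cumulative t k) (1 - \<tau>)"
proof -
  have 1: "cumulative (sweep n t \<tau>) j = min (cumulative t j) (1 - \<tau>)" if "j \<le> Suc n" for j
  proof -
    have "cumulative (sweep n t \<tau>) j = cumulative (kept t \<tau>) j"
      unfolding cumulative_def using that by (intro sum.cong) (auto simp: sweep_def)
    then show ?thesis by (simp add: cumulative_kept[OF assms])
  qed
  then show "j \<le> Suc n \<Longrightarrow> cumulative (sweep n t \<tau>) j = min (cumulative t j) (1 - \<tau>)" .
  show "cumulative (sweep n t \<tau>) (Suc n + k) = max (cumulative t k) (1 - \<tau>)" if "k \<le> Suc n"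
    using that
  proof (induction k)
    case 0
    then show ?case using 1[of "Suc n"] cumulative_last[OF t] \<tau> by simp
  next
    case (Suc k)
    then have "sweep n t \<tau> (Suc n + k) = t k - kept t \<tau> k" by (simp add: sweep_def)
    with Suc show ?case using simplex_nonneg[OF t, of k]
      by (auto simp: cumulative_Suc kept_def min_def max_def)
  qed
qed

lemma sweep_simplex:
  assumes t: "t \<in> standard_simplex n" and \<tau>: "0 \<le> \<tau>" "\<tau> \<le> 1"
  shows "sweep n t \<tau> \<in> standard_simplex (Suc (2 * n))"
proof (rule simplexI)
  have "0 \<le> kept t \<tau> j" "kept t \<tau> j \<le> t j" for j
    using simplex_nonneg[OF t, of j] by (auto simp: kept_def)
  then show "0 \<le> sweep n t \<tau> i" for i by (simp add: sweep_def)
  have "sum (sweep n t \<tau>) {..Suc (2 * n)} = cumulative (sweep n t \<tau>) (Suc n + Suc n)"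
    by (simp add: cumulative_def flip: lessThan_Suc_atMost mult_2)
  also have "\<dots> = 1" using cumulative_sweep(2)[OF assms, of "Suc n"] cumulative_last[OF t] \<tau> by simp
  finally show "sum (sweep n t \<tau>) {..Suc (2 * n)} = 1" .
qed (simp add: sweep_def)

lemma piece_sweep:
  assumes t: "t \<in> standard_simplex n" and \<tau>: "0 \<le> \<tau>" "\<tau> \<le> 1" and r: "0 \<le> r" "r < 1"
  shows "piece (sweep n t \<tau>) r = (if r < 1 - \<tau> then piece t r else Suc n + piece t r)"
proof -
  note b = piece_bounds[OF t r] piece_le[OF t r]
  note c = cumulative_sweep[OF t \<tau>]
  show ?thesis
  proof (cases "r < 1 - \<tau>")
    case True
    then have "piece (sweep n t \<tau>) r = piece t r"
      using b c(1)[of "piece t r"] c(1)[of "Suc (piece t r)"]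
      by (intro piece_eqI[OF sweep_simplex[OF t \<tau>] r]) auto
    with True show ?thesis by simp
  next
    case False
    then have "piece (sweep n t \<tau>) r = Suc n + piece t r"
      using b c(2)[of "piece t r"] c(2)[of "Suc (piece t r)"]
      by (intro piece_eqI[OF sweep_simplex[OF t \<tau>] r]) auto
    with False show ?thesis by simp
  qed
qed

lemma continuous_map_sweep:
  assumes C: "C \<subseteq> {0..1}"
  shows "continuous_map (prod_topology (simplex_top n) (top_of_set C)) (simplex_top (Suc (2 * n)))
    (\<lambda>p. sweep n (fst p) (snd p))"
proof (rule continuous_map_into_simplex)
  let ?X = "prod_topology (simplex_top n) (top_of_set C)"
  have t: "continuous_map ?X euclideanreal (\<lambda>p. fst p j)" for j
    using continuous_map_compose[OF continuous_map_fst continuous_map_simplex_coordinate, of n "top_of_set C" j]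
    by (simp add: comp_def)
  have \<tau>: "continuous_map ?X euclideanreal snd"
    using continuous_map_snd[of "simplex_top n" "top_of_set C"] by (simp add: continuous_map_in_subtopology)
  have kept: "continuous_map ?X euclideanreal (\<lambda>p. kept (fst p) (snd p) j)" for j
    unfolding kept_def cumulative_def
    by (intro continuous_map_real_min continuous_map_real_max continuous_map_diff
        continuous_map_sum t \<tau> continuous_map_const[THEN iffD2]) auto
  show "continuous_map ?X euclideanreal (\<lambda>p. sweep n (fst p) (snd p) i)" for i
  proof -
    consider "i \<le> n" | "n < i" "i \<le> Suc (2 * n)" | "Suc (2 * n) < i" by linarith
    then show ?thesis
      by cases (auto simp: sweep_def intro!: kept continuous_map_diff t)
  qed
  show "sweep n (fst p) (snd p) \<in> standard_simplex (Suc (2 * n))" if "p \<in> topspace ?X" for p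
    using that C by (intro sweep_simplex) (auto simp: subset_iff)
qed

lemma vertex_map:
  assumes "group G" "group H" "f \<in> hom G H" "set gs \<subseteq> carrier G"
  shows "vertex H (map f gs) i = f (vertex G gs i)"
proof -
  interpret group_hom G H f using assms by (auto simp: group_hom_def group_hom_axioms_def)
  have "foldr (\<otimes>\<^bsub>H\<^esub>) (map f xs) \<one>\<^bsub>H\<^esub> = f (foldr (\<otimes>\<^bsub>G\<^esub>) xs \<one>\<^bsub>G\<^esub>)" if "set xs \<subseteq> carrier G" for xs
    using that by (induction xs) (auto simp: G.foldr_mult_closed)
  moreover have "set (take i gs) \<subseteq> carrier G" using assms(4) by (auto dest: in_set_takeD)
  ultimately show ?thesis by (simp add: vertex_def take_map)
qed

lemma step_map:
  assumes "group G" "group H" "f \<in> hom G H" "set gs \<subseteq> carrier G"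
  shows "step H (map f gs) t r = f (step G gs t r)"
  by (simp add: step_def vertex_map[OF assms])

lemma group_Z: "group integer_group"
  by simp

context finite_rank_free_group
begin

abbreviation Pi :: "('a letter list \<times> int) monoid" where
  "Pi \<equiv> semidirect F integer_group (trivial_action F)"

lemma group_Pi: "group Pi"
  by (rule group_semidirect[OF is_group group_Z trivial_action_hom[OF is_group]])

sublocale Pi: group "semidirect (free_group X) integer_group (trivial_action (free_group X))"
  by (rule group_Pi)

lemma Pi_carrier: "x \<in> carrier Pi \<longleftrightarrow> fst x \<in> carrier F"
  by (cases x) (auto simp: semidirect_def)

lemma Pi_one: "\<one>\<^bsub>Pi\<^esub> = (\<one>\<^bsub>F\<^esub>, 0)"
  by (simp add: semidirect_def)

lemma Pi_mult: "fst y \<in> carrier F \<Longrightarrow> x \<otimes>\<^bsub>Pi\<^esub> y = (fst x \<otimes>\<^bsub>F\<^esub> fst y, snd x + snd y)"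
  by (cases x; cases y) (auto simp: semidirect_def trivial_action_def)

lemma snd_hom_Pi: "snd \<in> hom Pi integer_group"
  by (rule snd_hom)

definition first_vertex :: "('a letter list \<times> int) list \<Rightarrow> nat \<Rightarrow> 'a letter list" where
  "first_vertex gs i = fst (vertex Pi gs i)"

text \<open>The two coordinates of the map from the universal cover to the product of the tree and the line: the
  second moment in the free factor, whose minimum is taken later, and the mean in the integer factor.\<close>
definition spread :: "('a letter list \<times> int) list \<Rightarrow> (nat \<Rightarrow> real) \<Rightarrow> 'a letter list \<Rightarrow> real" where
  "spread gs t = moment (length gs) t (first_vertex gs)"

definition height :: "('a letter list \<times> int) list \<Rightarrow> (nat \<Rightarrow> real) \<Rightarrow> real" where
  "height gs t = (\<Sum>i\<le>length gs. t i * real_of_int (snd (vertex Pi gs i)))"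

lemma first_vertex_closed: "set gs \<subseteq> carrier Pi \<Longrightarrow> first_vertex gs i \<in> carrier F"
  using Pi.vertex_closed[of gs i] by (simp add: first_vertex_def Pi_carrier)

text \<open>The ambiguity in representing a point of the bar construction by a cell: a translation \<open>(u, m)\<close>, together
  with its effect on the two coordinates.\<close>
definition translated :: "'a letter list \<Rightarrow> int \<Rightarrow> ('a letter list \<times> int) list \<Rightarrow> (nat \<Rightarrow> real) \<Rightarrow>
    ('a letter list \<times> int) list \<Rightarrow> (nat \<Rightarrow> real) \<Rightarrow> bool" where
  "translated u m gs t gs' t' \<longleftrightarrow> u \<in> carrier F \<and>
     (gs, t) \<in> bar_cells Pi \<and> (gs', t') \<in> bar_cells Pi \<and>
     (\<forall>r. 0 \<le> r \<and> r < 1 \<longrightarrow> step Pi gs' t' r = (u, m) \<otimes>\<^bsub>Pi\<^esub> step Pi gs t r) \<and>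
     spread gs' t' = act u (spread gs t) \<and> height gs' t' = height gs t + m"

lemma bar_class_translated:
  assumes c: "(gs, t) \<in> bar_cells Pi" and eq: "bar_class Pi gs t = bar_class Pi gs' t'"
  obtains u m where "translated u m gs t gs' t'"
proof -
  have "((gs, t), (gs', t')) \<in> Pi.translate_rel"
    using eq by (intro Pi.bar_equiv_translate[OF c]) (simp add: bar_class_eq_iff)
  then obtain \<gamma> where c': "(gs', t') \<in> bar_cells Pi" and \<gamma>: "\<gamma> \<in> carrier Pi"
    and s: "\<And>r. 0 \<le> r \<Longrightarrow> r < 1 \<Longrightarrow> step Pi gs' t' r = \<gamma> \<otimes>\<^bsub>Pi\<^esub> step Pi gs t r"
    and p: "\<And>\<phi> :: 'a letter list \<times> int \<Rightarrow> real. (\<Sum>i\<le>length gs'. t' i * \<phi> (vertex Pi gs' i)) =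
            (\<Sum>i\<le>length gs. t i * \<phi> (\<gamma> \<otimes>\<^bsub>Pi\<^esub> vertex Pi gs i))"
    by (auto simp: Pi.translate_rel_def)
  obtain u m where um: "\<gamma> = (u, m)" by (cases \<gamma>)
  have u: "u \<in> carrier F" using \<gamma> um by (simp add: Pi_carrier)
  have gs: "set gs \<subseteq> carrier Pi" "set gs' \<subseteq> carrier Pi" and t: "t \<in> standard_simplex (length gs)"
    using c c' by (auto simp: Pi.bar_cells_iff)
  have cl: "fst (vertex Pi gs i) \<in> carrier F" for i using first_vertex_closed[OF gs(1)] by (simp add: first_vertex_def)
  have "spread gs' t' = act u (spread gs t)"
    unfolding spread_def act_moment[OF u first_vertex_closed[OF gs(1)]]
    using p[of "\<lambda>v. (real (length (inv\<^bsub>F\<^esub> k \<otimes>\<^bsub>F\<^esub> fst v)))\<^sup>2" for k]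
    by (simp add: moment_def first_vertex_def um Pi_mult cl fun_eq_iff)
  moreover have "height gs' t' = height gs t + m"
  proof -
    have "height gs' t' = (\<Sum>i\<le>length gs. t i * (m + real_of_int (snd (vertex Pi gs i))))"
      using p[of "\<lambda>v. real_of_int (snd v)"] by (simp add: height_def um Pi_mult cl)
    also have "\<dots> = m + height gs t"
      using simplex_sum[OF t]
      by (simp add: height_def distrib_left sum.distrib flip: sum_distrib_right)
    finally show ?thesis by simp
  qed
  ultimately show thesis using that[of u m] u c c' s um by (auto simp: translated_def)
qed

lemma spread_min_at: "(gs, t) \<in> bar_cells Pi \<Longrightarrow> \<exists>e v. min_at e (spread gs t) v"
  unfolding spread_def by (intro moment_min_at) (auto simp: Pi.bar_cells_iff first_vertex_closed)

lemma openin_spread_min_at: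
  "set gs \<subseteq> carrier Pi \<Longrightarrow> openin (simplex_top (length gs)) {t \<in> standard_simplex (length gs). min_at e (spread gs t) v}"
  unfolding spread_def by (intro openin_min_at first_vertex_closed)

lemma spread_extensional: "spread gs t \<in> extensional (carrier F)"
  by (simp add: spread_def moment_def)

end

context finite_rank_free_group
begin

lemma lists_iff: "gs \<in> lists A \<longleftrightarrow> set gs \<subseteq> A"
  by auto

abbreviation E where "E \<equiv> classifying_space Pi"

lemma in_E_iff: "x \<in> topspace E \<longleftrightarrow> (\<exists>gs t. (gs, t) \<in> bar_cells Pi \<and> x = bar_class Pi gs t)"
  by (auto simp: quotient_def)

context
  fixes w :: "'a letter list"
  assumes w: "w \<in> carrier F"
begin

abbreviation lift_w :: "int \<Rightarrow> 'a letter list \<times> int" where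
  "lift_w \<equiv> splitting (power_derivation F w)"

abbreviation proj :: "('a letter list \<times> int) bar_point \<Rightarrow> int bar_point" where
  "proj \<equiv> classifying_map integer_group snd"

abbreviation sect :: "int bar_point \<Rightarrow> ('a letter list \<times> int) bar_point" where
  "sect \<equiv> classifying_map Pi lift_w"

lemma lift_w_eq: "lift_w m = (w [^]\<^bsub>F\<^esub> m, m)"
  by (simp add: splitting_def power_derivation_def)

lemma lift_w_hom: "lift_w \<in> hom integer_group Pi"
proof (rule splitting_hom)
  show "derivation integer_group F (trivial_action F) (power_derivation F w)"
    using derivation_integers_iff[OF is_group w] by blast
qed

lemma lift_w_closed: "lift_w m \<in> carrier Pi"
  using w by (simp add: lift_w_eq Pi_carrier)

lemma proj_class: "proj (bar_class Pi gs t) = bar_class integer_group (map snd gs) t"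
  by (rule classifying_map_class[OF group_Pi group_Z snd_hom_Pi])

lemma sect_class: "sect (bar_class integer_group hs t) = bar_class Pi (map lift_w hs) t"
  by (rule classifying_map_class[OF group_Z group_Pi lift_w_hom])

lemma step_lift_w:
  "set gs \<subseteq> carrier Pi \<Longrightarrow> step Pi (map lift_w (map snd gs)) t r = lift_w (snd (step Pi gs t r))"
  by (subst step_map[OF group_Z group_Pi lift_w_hom], simp)
     (subst step_map[OF group_Pi group_Z snd_hom_Pi], auto)

text \<open>The first half of this word runs through the vertices \<open>(w\<^sup>b, b)\<close> below the vertices \<open>(a, b)\<close> of \<open>gs\<close>, and
  the second half is \<open>gs\<close> itself. The letter in the middle is the one for which, after translation by
  \<open>(c, 0)\<close>, the second half has the vertices of \<open>gs\<close> and the first half the vertices \<open>(c w\<^sup>b, b)\<close>.\<close>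
definition sweep_word :: "('a letter list \<times> int) list \<Rightarrow> 'a letter list \<Rightarrow> ('a letter list \<times> int) list" where
  "sweep_word gs c = map lift_w (map snd gs) @
     [inv\<^bsub>Pi\<^esub> ((c, 0) \<otimes>\<^bsub>Pi\<^esub> lift_w (snd (vertex Pi gs (length gs))))] @ gs"

text \<open>A path in the fibre from the chosen section to the point \<open>(gs, t)\<close>. At each place of \<open>[0, 1)\<close> the value
  changes from \<open>(c w\<^sup>b, b)\<close> to \<open>(a, b)\<close>, and the integer coordinate stays the same, which is why the path
  does not leave its fibre.\<close>
definition sweep_path :: "('a letter list \<times> int) list \<Rightarrow> (nat \<Rightarrow> real) \<Rightarrow> 'a letter list \<Rightarrow> real \<Rightarrow> ('a letter list \<times> int) bar_point" where
  "sweep_path gs t c \<tau> = bar_class Pi (sweep_word gs c) (sweep (length gs) t \<tau>)"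

lemma length_sweep_word [simp]: "length (sweep_word gs c) = Suc (2 * length gs)"
  by (simp add: sweep_word_def)

lemma c0_closed: "c \<in> carrier F \<Longrightarrow> (c, 0) \<in> carrier Pi"
  by (simp add: Pi_carrier)

lemma sweep_word_closed:
  assumes "set gs \<subseteq> carrier Pi" "c \<in> carrier F"
  shows "set (sweep_word gs c) \<subseteq> carrier Pi"
  using assms lift_w_closed c0_closed by (auto simp: sweep_word_def)

lemma vertex_sweep_word:
  assumes gs: "set gs \<subseteq> carrier Pi" and c: "c \<in> carrier F"
  shows "i \<le> length gs \<Longrightarrow> vertex Pi (sweep_word gs c) i = lift_w (snd (vertex Pi gs i))"
    and "vertex Pi (sweep_word gs c) (Suc (length gs + i)) = inv\<^bsub>Pi\<^esub> (c, 0) \<otimes>\<^bsub>Pi\<^esub> vertex Pi gs i"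
proof -
  let ?A = "map lift_w (map snd gs)"
  let ?y = "inv\<^bsub>Pi\<^esub> ((c, 0) \<otimes>\<^bsub>Pi\<^esub> lift_w (snd (vertex Pi gs (length gs))))"
  have A: "set ?A \<subseteq> carrier Pi" using lift_w_closed by auto
  have vA: "vertex Pi ?A i = lift_w (snd (vertex Pi gs i))" for i
    by (subst vertex_map[OF group_Z group_Pi lift_w_hom], simp)
       (subst vertex_map[OF group_Pi group_Z snd_hom_Pi gs], simp)
  have y: "?y \<in> carrier Pi" using c0_closed[OF c] lift_w_closed by simp
  then have B: "set ([?y] @ gs) \<subseteq> carrier Pi" using gs by simp
  have vB: "vertex Pi ([?y] @ gs) (Suc i) = ?y \<otimes>\<^bsub>Pi\<^esub> vertex Pi gs i" for i
    by (simp add: vertex_def)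
  show "i \<le> length gs \<Longrightarrow> vertex Pi (sweep_word gs c) i = lift_w (snd (vertex Pi gs i))"
    unfolding sweep_word_def Pi.vertex_append[OF A B] by (simp add: vA del: map_map)
  have "vertex Pi (sweep_word gs c) (Suc (length gs + i))
      = lift_w (snd (vertex Pi gs (length gs))) \<otimes>\<^bsub>Pi\<^esub> (?y \<otimes>\<^bsub>Pi\<^esub> vertex Pi gs i)"
    unfolding sweep_word_def Pi.vertex_append[OF A B] using vB[of i] by (simp add: vA del: map_map)
  also have "\<dots> = inv\<^bsub>Pi\<^esub> (c, 0) \<otimes>\<^bsub>Pi\<^esub> vertex Pi gs i"
    using c0_closed[OF c] lift_w_closed Pi.vertex_closed[OF gs]
    by (simp add: Pi.inv_mult_group Pi.m_assoc[symmetric])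
  finally show "vertex Pi (sweep_word gs c) (Suc (length gs + i)) = inv\<^bsub>Pi\<^esub> (c, 0) \<otimes>\<^bsub>Pi\<^esub> vertex Pi gs i" .
qed

lemma sweep_cell:
  assumes "(gs, t) \<in> bar_cells Pi" "c \<in> carrier F" "0 \<le> \<tau>" "\<tau> \<le> 1"
  shows "(sweep_word gs c, sweep (length gs) t \<tau>) \<in> bar_cells Pi"
  using assms sweep_word_closed[of gs c] sweep_simplex[of t "length gs" \<tau>]
  by (simp add: Pi.bar_cells_iff)

lemma step_sweep:
  assumes gt: "(gs, t) \<in> bar_cells Pi" and c: "c \<in> carrier F" and \<tau>: "0 \<le> \<tau>" "\<tau> \<le> 1"
    and r: "0 \<le> r" "r < 1"
  shows "step Pi (sweep_word gs c) (sweep (length gs) t \<tau>) r =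
    (if r < 1 - \<tau> then lift_w (snd (step Pi gs t r)) else inv\<^bsub>Pi\<^esub> (c, 0) \<otimes>\<^bsub>Pi\<^esub> step Pi gs t r)"
proof -
  have gs: "set gs \<subseteq> carrier Pi" and t: "t \<in> standard_simplex (length gs)"
    using gt by (auto simp: Pi.bar_cells_iff)
  show ?thesis
    using piece_le[OF t r] vertex_sweep_word[OF gs c]
    by (simp add: step_def piece_sweep[OF t \<tau> r])
qed

lemma sweep_path_0:
  assumes gt: "(gs, t) \<in> bar_cells Pi" and c: "c \<in> carrier F"
  shows "sweep_path gs t c 0 = sect (proj (bar_class Pi gs t))"
proof -
  have gs: "set gs \<subseteq> carrier Pi" using gt by (simp add: Pi.bar_cells_iff)
  have cell: "(map lift_w (map snd gs), t) \<in> bar_cells Pi"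
    using gt lift_w_closed by (auto simp: Pi.bar_cells_iff)
  have "((map lift_w (map snd gs), t), (sweep_word gs c, sweep (length gs) t 0)) \<in> bar_equiv Pi"
    using step_sweep[OF gt c, of 0] step_lift_w[OF gs] lift_w_closed
    by (intro Pi.bar_equiv_step[OF cell sweep_cell[OF gt c] Pi.one_closed]) simp_all
  then have "bar_class Pi (map lift_w (map snd gs)) t = bar_class Pi (sweep_word gs c) (sweep (length gs) t 0)"
    by (simp only: bar_class_eq_iff)
  then show ?thesis by (simp add: sweep_path_def proj_class sect_class)
qed

lemma sweep_path_1:
  assumes gt: "(gs, t) \<in> bar_cells Pi" and c: "c \<in> carrier F"
  shows "sweep_path gs t c 1 = bar_class Pi gs t"
proof -
  have "((gs, t), (sweep_word gs c, sweep (length gs) t 1)) \<in> bar_equiv Pi"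
    using step_sweep[OF gt c, of 1] c0_closed[OF c]
    by (intro Pi.bar_equiv_step[OF gt sweep_cell[OF gt c], of _ "inv\<^bsub>Pi\<^esub> (c, 0)"]) simp_all
  then show ?thesis unfolding sweep_path_def bar_class_eq_iff[symmetric] by simp
qed

lemma proj_sweep_path:
  assumes gt: "(gs, t) \<in> bar_cells Pi" and c: "c \<in> carrier F" and \<tau>: "0 \<le> \<tau>" "\<tau> \<le> 1"
  shows "proj (sweep_path gs t c \<tau>) = proj (bar_class Pi gs t)"
proof -
  have gs: "set gs \<subseteq> carrier Pi" and t: "t \<in> standard_simplex (length gs)"
    using gt by (auto simp: Pi.bar_cells_iff)
  have cells: "(map snd gs, t) \<in> bar_cells integer_group"
    "(map snd (sweep_word gs c), sweep (length gs) t \<tau>) \<in> bar_cells integer_group"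
    using t sweep_simplex[OF t \<tau>] by (auto simp: bar_cells_def)
  have cl: "fst (step Pi gs t r) \<in> carrier F" for r
    using Pi.step_closed[OF gs] by (simp add: Pi_carrier)
  have inv0: "inv\<^bsub>Pi\<^esub> (c, 0) = (inv\<^bsub>F\<^esub> c, 0)"
    using c by (intro Pi.inv_equality) (simp_all add: Pi_mult Pi_carrier Pi_one)
  have "((map snd gs, t), (map snd (sweep_word gs c), sweep (length gs) t \<tau>)) \<in> bar_equiv integer_group"
  proof (rule group.bar_equiv_step[OF group_Z cells])
    fix r :: real assume r: "0 \<le> r" "r < 1"
    show "step integer_group (map snd (sweep_word gs c)) (sweep (length gs) t \<tau>) r =
        0 \<otimes>\<^bsub>integer_group\<^esub> step integer_group (map snd gs) t r"
      using step_sweep[OF gt c \<tau> r] cl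
      by (simp add: step_map[OF group_Pi group_Z snd_hom_Pi] gs sweep_word_closed c
          lift_w_eq inv0 Pi_mult)
  qed simp
  then show ?thesis unfolding sweep_path_def proj_class bar_class_eq_iff
    by (meson equivE equiv_bar_equiv symD)
qed

text \<open>If the representing cell is translated by \<open>(u, m)\<close>, then \<open>(c w\<^sup>b, b)\<close> becomes \<open>(u c w\<^sup>b, b + m)\<close>. This is
  again of the form \<open>(c' w\<^sup>b\<^sup>', b')\<close>, for \<open>c' = u c w\<^sup>-\<^sup>m\<close> and \<open>b' = b + m\<close>.\<close>
lemma sweep_path_translated:
  assumes tr: "translated u m gs t gs' t'" and c: "c \<in> carrier F" and \<tau>: "0 \<le> \<tau>" "\<tau> \<le> 1"
  shows "sweep_path gs' t' (u \<otimes>\<^bsub>F\<^esub> c \<otimes>\<^bsub>F\<^esub> w [^]\<^bsub>F\<^esub> (- m)) \<tau> = sweep_path gs t c \<tau>"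
proof -
  let ?c = "u \<otimes>\<^bsub>F\<^esub> c \<otimes>\<^bsub>F\<^esub> w [^]\<^bsub>F\<^esub> (- m)"
  have u: "u \<in> carrier F" and gt: "(gs, t) \<in> bar_cells Pi" and gt': "(gs', t') \<in> bar_cells Pi"
    and s: "\<And>r. 0 \<le> r \<Longrightarrow> r < 1 \<Longrightarrow> step Pi gs' t' r = (u, m) \<otimes>\<^bsub>Pi\<^esub> step Pi gs t r"
    using tr by (auto simp: translated_def)
  have gs: "set gs \<subseteq> carrier Pi" using gt by (simp add: Pi.bar_cells_iff)
  have c': "?c \<in> carrier F" using u c w by simp
  have inv0: "inv\<^bsub>Pi\<^esub> (a, 0) = (inv\<^bsub>F\<^esub> a, 0)" if "a \<in> carrier F" for a
    using that by (intro Pi.inv_equality) (simp_all add: Pi_mult Pi_carrier Pi_one)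
  define \<gamma> where "\<gamma> = (inv\<^bsub>F\<^esub> ?c \<otimes>\<^bsub>F\<^esub> u \<otimes>\<^bsub>F\<^esub> c, m)"
  have \<gamma>: "\<gamma> \<in> carrier Pi" using u c c' by (simp add: \<gamma>_def Pi_carrier)
  have wm: "\<gamma> = (w [^]\<^bsub>F\<^esub> m, m)"
    using u c w by (simp add: \<gamma>_def inv_mult_group m_assoc int_pow_neg)
  define c' where "c' = ?c"
  note c' = c'[folded c'_def] and \<gamma>_def = \<gamma>_def[folded c'_def]
  have "((sweep_word gs c, sweep (length gs) t \<tau>), (sweep_word gs' c', sweep (length gs') t' \<tau>)) \<in> bar_equiv Pi"
  proof (rule Pi.bar_equiv_step[OF sweep_cell[OF gt c \<tau>] sweep_cell[OF gt' c' \<tau>] \<gamma>])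
    fix r :: real assume r: "0 \<le> r" "r < 1"
    have cl: "fst (step Pi gs t r) \<in> carrier F"
      using Pi.step_closed[OF gs] by (simp add: Pi_carrier)
    show "step Pi (sweep_word gs' c') (sweep (length gs') t' \<tau>) r =
        \<gamma> \<otimes>\<^bsub>Pi\<^esub> step Pi (sweep_word gs c) (sweep (length gs) t \<tau>) r"
    proof (cases "r < 1 - \<tau>")
      case True
      then show ?thesis
        using s[OF r] cl w u
        by (simp add: step_sweep[OF gt c \<tau> r] step_sweep[OF gt' c' \<tau> r] lift_w_eq wm Pi_mult int_pow_mult)
    next
      case False
      have "c \<otimes>\<^bsub>F\<^esub> (inv\<^bsub>F\<^esub> c \<otimes>\<^bsub>F\<^esub> x) = x" if "x \<in> carrier F" for x
        using c that by (simp add: m_assoc[symmetric])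
      with False show ?thesis
        using s[OF r] cl w u c c'
        by (simp add: step_sweep[OF gt c \<tau> r] step_sweep[OF gt' c' \<tau> r] \<gamma>_def Pi_mult inv0 m_assoc)
    qed
  qed
  then show ?thesis unfolding sweep_path_def bar_class_eq_iff c'_def by (meson equivE equiv_bar_equiv symD)
qed

lemma sweep_path_in_paths:
  assumes gt: "(gs, t) \<in> bar_cells Pi" and c: "c \<in> carrier F"
  shows "restrict (sweep_path gs t c) {0..1} \<in> paths E"
proof -
  have gs: "sweep_word gs c \<in> lists (carrier Pi)" and t: "t \<in> standard_simplex (length gs)"
    using gt sweep_word_closed[OF _ c] by (auto simp: Pi.bar_cells_iff lists_iff)
  have "continuous_map (top_of_set {0..1::real}) (prod_topology (simplex_top (length gs)) (top_of_set {0..1})) (\<lambda>\<tau>. (t, \<tau>))"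
    using t by (intro continuous_map_pairedI) auto
  from continuous_map_compose[OF this continuous_map_sweep]
  have "continuous_map (top_of_set {0..1}) (simplex_top (Suc (2 * length gs))) (\<lambda>\<tau>. sweep (length gs) t \<tau>)"
    by (simp add: comp_def)
  from continuous_map_compose[OF this] continuous_map_bar_class[OF gs]
  have "continuous_map (top_of_set {0..1}) E (sweep_path gs t c)"
    by (simp add: comp_def sweep_path_def[abs_def])
  then show ?thesis
    by (auto simp: paths_def pathin_def intro: continuous_map_eq)
qed

text \<open>A locally constant label \<open>c\<close> with the right behaviour under translation yields a section over the set on
  which it is defined: use the sweep with parameter \<open>c\<close>. Local constancy is the openness hypothesis for
  each single value of \<open>c\<close>.\<close>
lemma section_of_label:
  fixes C :: "('a letter list \<times> int) list \<Rightarrow> (nat \<Rightarrow> real) \<Rightarrow> 'a letter list \<Rightarrow> bool"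
  assumes closed: "\<And>gs t c. C gs t c \<Longrightarrow> c \<in> carrier F"
    and unique: "\<And>gs t c c'. C gs t c \<Longrightarrow> C gs t c' \<Longrightarrow> c = c'"
    and op: "\<And>gs c. set gs \<subseteq> carrier Pi \<Longrightarrow>
      openin (simplex_top (length gs)) {t \<in> standard_simplex (length gs). C gs t c}"
    and equivariant: "\<And>u m gs t gs' t' c. translated u m gs t gs' t' \<Longrightarrow> C gs t c \<Longrightarrow>
      C gs' t' (u \<otimes>\<^bsub>F\<^esub> c \<otimes>\<^bsub>F\<^esub> w [^]\<^bsub>F\<^esub> (- m))"
  defines "U \<equiv> {x. \<exists>gs t c. (gs, t) \<in> bar_cells Pi \<and> x = bar_class Pi gs t \<and> C gs t c}"
  shows "openin E U"
    and "\<exists>\<sigma>. continuous_map (subtopology E U) (fibrewise_path_space E proj sect) \<sigma> \<and> (\<forall>x\<in>U. \<sigma> x 1 = x)"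
proof -
  define rep where "rep x = (SOME (gs, t, c). (gs, t) \<in> bar_cells Pi \<and> x = bar_class Pi gs t \<and> C gs t c)" for x
  define \<sigma> where "\<sigma> x = (case rep x of (gs, t, c) \<Rightarrow> restrict (sweep_path gs t c) {0..1})" for x
  have rep: "\<exists>gs t c. rep x = (gs, t, c) \<and> (gs, t) \<in> bar_cells Pi \<and> x = bar_class Pi gs t \<and> C gs t c"
    if "x \<in> U" for x
  proof -
    have "\<exists>y. case y of (gs, t, c) \<Rightarrow> (gs, t) \<in> bar_cells Pi \<and> x = bar_class Pi gs t \<and> C gs t c"
      using that by (auto simp: U_def)
    from someI_ex[OF this] show ?thesis unfolding rep_def[symmetric] by (auto split: prod.splits)
  qed
  have label: "\<exists>c'. C gs' t' c'" if "bar_class Pi gs t = bar_class Pi gs' t'" "(gs, t) \<in> bar_cells Pi" "C gs t c"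
    for gs t gs' t' c
    using bar_class_translated[OF that(2,1)] equivariant[OF _ that(3)] by metis
  have \<sigma>: "\<sigma> (bar_class Pi gs t) = restrict (sweep_path gs t c) {0..1}"
    if gt: "(gs, t) \<in> bar_cells Pi" and C: "C gs t c" for gs t c
  proof -
    have "bar_class Pi gs t \<in> U" using gt C by (auto simp: U_def)
    from rep[OF this] obtain gs' t' c' where r: "rep (bar_class Pi gs t) = (gs', t', c')"
      "(gs', t') \<in> bar_cells Pi" "bar_class Pi gs t = bar_class Pi gs' t'" "C gs' t' c'" by blast
    obtain u m where tr: "translated u m gs t gs' t'" using bar_class_translated[OF gt r(3)] .
    have "c' = u \<otimes>\<^bsub>F\<^esub> c \<otimes>\<^bsub>F\<^esub> w [^]\<^bsub>F\<^esub> (- m)"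
      by (rule unique[OF r(4) equivariant[OF tr C]])
    then show ?thesis
      using sweep_path_translated[OF tr closed[OF C]] by (auto simp: \<sigma>_def r(1) restrict_def fun_eq_iff)
  qed
  have U_iff: "bar_class Pi gs t \<in> U \<longleftrightarrow> (\<exists>c. C gs t c)" if "(gs, t) \<in> bar_cells Pi" for gs t
    using that label by (auto simp: U_def)
  have cell: "(gs, t) \<in> bar_cells Pi" if "gs \<in> lists (carrier Pi)" "t \<in> standard_simplex (length gs)" for gs t
    using that by (auto simp: Pi.bar_cells_iff)
  have UE: "U \<subseteq> bar_cells Pi // bar_equiv Pi"
    by (auto simp: U_def quotient_def)
  show openU: "openin E U"
    unfolding openin_classifying_space
  proof (intro conjI ballI UE)
    fix gs assume gs: "gs \<in> lists (carrier Pi)"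
    have "{t \<in> standard_simplex (length gs). bar_class Pi gs t \<in> U}
        = (\<Union>c. {t \<in> standard_simplex (length gs). C gs t c})"
      using U_iff[OF cell[OF gs]] by auto
    then show "openin (simplex_top (length gs)) {t \<in> standard_simplex (length gs). bar_class Pi gs t \<in> U}"
      using op gs by (auto simp: lists_iff)
  qed
  have pre: "openin E {x \<in> U. \<sigma> x ` K \<subseteq> V}" if K: "compact K" "K \<subseteq> {0..1}" and V: "openin E V" for K V
    unfolding openin_classifying_space
  proof (intro conjI ballI)
    show "{x \<in> U. \<sigma> x ` K \<subseteq> V} \<subseteq> bar_cells Pi // bar_equiv Pi" using UE by auto
    fix gs assume gs: "gs \<in> lists (carrier Pi)"
    let ?n = "length gs"
    let ?S = "\<lambda>c. {t \<in> standard_simplex ?n. C gs t c} \<inter>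
        {t \<in> topspace (simplex_top ?n). \<forall>\<tau>\<in>topspace (top_of_set K). sweep_path gs t c \<tau> \<in> V}"
    have "{t \<in> standard_simplex ?n. bar_class Pi gs t \<in> {x \<in> U. \<sigma> x ` K \<subseteq> V}} = (\<Union>c. ?S c)"
      (is "?L = _")
    proof (intro equalityI subsetI)
      fix t assume "t \<in> ?L"
      then have t: "t \<in> standard_simplex ?n" "bar_class Pi gs t \<in> U" "\<sigma> (bar_class Pi gs t) ` K \<subseteq> V" by auto
      then obtain c where c: "C gs t c" using U_iff[OF cell[OF gs]] by blast
      have "t \<in> ?S c"
        using t c \<sigma>[OF cell[OF gs t(1)] c] K(2) by (auto simp: image_subset_iff subset_iff)
      then show "t \<in> (\<Union>c. ?S c)" by blast
    next
      fix t assume "t \<in> (\<Union>c. ?S c)"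
      then obtain c where t: "t \<in> standard_simplex ?n" "C gs t c" "\<forall>\<tau>\<in>K. sweep_path gs t c \<tau> \<in> V" by auto
      then show "t \<in> ?L"
        using \<sigma>[OF cell[OF gs t(1)] t(2)] K(2) U_iff[OF cell[OF gs t(1)]] by auto
    qed
    moreover have "openin (simplex_top ?n) (?S c)" for c
    proof (cases "c \<in> carrier F")
      case True
      have sw: "sweep_word gs c \<in> lists (carrier Pi)"
        using sweep_word_closed[OF _ True] gs by (auto simp: lists_iff)
      have "continuous_map (prod_topology (simplex_top ?n) (top_of_set K)) E
          (bar_class Pi (sweep_word gs c) \<circ> (\<lambda>p. sweep ?n (fst p) (snd p)))"
        using continuous_map_compose[OF continuous_map_sweep[OF K(2), of ?n]] continuous_map_bar_class[OF sw]
        by simp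
      from openin_tube[OF this _ V] have "openin (simplex_top ?n)
          {t \<in> topspace (simplex_top ?n). \<forall>\<tau>\<in>topspace (top_of_set K). sweep_path gs t c \<tau> \<in> V}"
        using K(1) by (simp add: sweep_path_def compact_space_subtopology)
      then show ?thesis using op[of gs c] gs by (intro openin_Int) (auto simp: lists_iff)
    next
      case False
      then have "?S c = {}" using closed by auto
      then show ?thesis by (simp only: openin_empty)
    qed
    ultimately show "openin (simplex_top ?n)
        {t \<in> standard_simplex ?n. bar_class Pi gs t \<in> {x \<in> U. \<sigma> x ` K \<subseteq> V}}"
      by (metis (no_types, lifting) openin_Union imageE)
  qed
  have \<sigma>_path: "\<sigma> x \<in> paths E \<and> \<sigma> x 1 = x \<and> \<sigma> x 0 = sect (proj x) \<and> (\<forall>\<tau>\<in>{0..1}. proj (\<sigma> x \<tau>) = proj x)"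
    if "x \<in> U" for x
  proof -
    obtain gs t c where x: "(gs, t) \<in> bar_cells Pi" "x = bar_class Pi gs t" "C gs t c"
      using \<open>x \<in> U\<close> by (auto simp: U_def)
    show ?thesis
      using sweep_path_in_paths[OF x(1) closed[OF x(3)]] sweep_path_0[OF x(1) closed[OF x(3)]]
        sweep_path_1[OF x(1) closed[OF x(3)]] proj_sweep_path[OF x(1) closed[OF x(3)]]
      by (simp add: \<sigma>[OF x(1,3), folded x(2)] flip: x(2))
  qed
  have top: "topspace (subtopology E U) = U" using openU openin_subset by force
  have "continuous_map (subtopology E U) (path_space E) \<sigma>"
    unfolding path_space_def
  proof (rule continuous_on_generated_topo)
    fix N assume "N \<in> {{\<alpha> \<in> paths E. \<alpha> ` K \<subseteq> V} | K V. compact K \<and> K \<subseteq> {0..1} \<and> openin E V}"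
    then obtain K V where N: "N = {\<alpha> \<in> paths E. \<alpha> ` K \<subseteq> V}" "compact K" "K \<subseteq> {0..1}" "openin E V" by blast
    have "\<sigma> -` N \<inter> U = {x \<in> U. \<sigma> x ` K \<subseteq> V}" using \<sigma>_path by (auto simp: N)
    then show "openin (subtopology E U) (\<sigma> -` N \<inter> topspace (subtopology E U))"
      using pre[OF N(2-4)] openU unfolding top by (simp add: openin_open_subtopology)
  next
    have "\<sigma> ` U \<subseteq> topspace (path_space E)" using \<sigma>_path by (auto simp: topspace_path_space)
    then show "\<sigma> ` topspace (subtopology E U) \<subseteq>
        \<Union> {{\<alpha> \<in> paths E. \<alpha> ` K \<subseteq> V} | K V. compact K \<and> K \<subseteq> {0..1} \<and> openin E V}"
      unfolding top by (simp add: path_space_def topology_generated_by_topspace)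
  qed
  moreover have "proj (sect (proj x)) = proj x" if "x \<in> U" for x
    using \<sigma>_path[OF that] by (metis atLeastAtMost_iff order_refl zero_le_one)
  ultimately have "continuous_map (subtopology E U) (fibrewise_path_space E proj sect) \<sigma>"
    using \<sigma>_path unfolding fibrewise_path_space_def continuous_map_in_subtopology top by auto
  then show "\<exists>\<sigma>. continuous_map (subtopology E U) (fibrewise_path_space E proj sect) \<sigma> \<and> (\<forall>x\<in>U. \<sigma> x 1 = x)"
    using \<sigma>_path by blast
qed

end

end

section \<open>Three open sets suffice\<close>

context finite_rank_free_group
begin

text \<open>The pairs (vertex or edge in the tree, position of the mean relative to \<open>m\<close>) that are assigned to the
  \<open>j\<close>-th open set. They are neighbourhoods of the cells of dimension \<open>j\<close> in the product of the tree and the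
  line: a vertex and a mean that rounds to \<open>m\<close>; an edge and a mean near \<open>m\<close>, or a vertex and a mean near
  \<open>m + 1/2\<close>; an edge and a mean strictly between \<open>m\<close> and \<open>m + 1\<close>. In the middle case the two kinds of
  interval are disjoint modulo 1, and all intervals have length at most 1; both are needed for uniqueness.\<close>
definition window :: "nat \<Rightarrow> bool \<Rightarrow> real \<Rightarrow> bool" where
  "window j e x \<longleftrightarrow> (if j = 0 then \<not> e \<and> - 1 / 2 < x \<and> x < 1 / 2
     else if j = 1 then (if e then - 1 / 4 < x \<and> x < 1 / 4 else 1 / 4 < x \<and> x < 3 / 4)
     else e \<and> 0 < x \<and> x < 1)"

definition label :: "'a letter list \<Rightarrow> nat \<Rightarrow> ('a letter list \<times> int) list \<Rightarrow> (nat \<Rightarrow> real) \<Rightarrow> 'a letter list \<Rightarrow> bool" where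
  "label w j gs t c \<longleftrightarrow> (\<exists>e v m. min_at e (spread gs t) v \<and> window j e (height gs t - of_int m) \<and>
     c = v \<otimes>\<^bsub>F\<^esub> w [^]\<^bsub>F\<^esub> (- m))"

lemma window_unique:
  assumes "window j e (h - of_int m)" "window j e' (h - of_int m')"
  shows "e = e' \<and> m = m'"
proof -
  have no_int: False if "0 < real_of_int i - real_of_int i'" "real_of_int i - real_of_int i' < 1" for i i'
  proof -
    have "real_of_int 0 < real_of_int (i - i')" "real_of_int (i - i') < real_of_int 1" using that by simp_all
    then show False unfolding of_int_less_iff by simp
  qed
  have e: "e = e'"
  proof (rule ccontr)
    assume "e \<noteq> e'"
    then have "(0 < real_of_int m - real_of_int m' \<and> real_of_int m - real_of_int m' < 1) \<or>
        (0 < real_of_int m' - real_of_int m \<and> real_of_int m' - real_of_int m < 1)"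
      using assms by (auto simp: window_def split: if_splits)
    then show False using no_int by blast
  qed
  have "\<bar>real_of_int m - real_of_int m'\<bar> < 1"
    using assms unfolding e by (auto simp: window_def split: if_splits)
  then have "m = m'" using no_int[of m m'] no_int[of m' m] by (cases m m' rule: linorder_cases) auto
  then show ?thesis using e by simp
qed

lemma ex_window: "\<exists>j\<le>2. \<exists>m :: int. window j e (h - of_int m)"
proof -
  define x where "x = h - of_int \<lfloor>h\<rfloor>"
  have x: "0 \<le> x" "x < 1" unfolding x_def by linarith+
  have up: "h - of_int (\<lfloor>h\<rfloor> + 1) = x - 1" by (simp add: x_def)
  show ?thesis
  proof (cases e)
    case True
    then have "window (if x = 0 then 1 else 2) e (h - of_int \<lfloor>h\<rfloor>)"
      using x by (simp add: window_def flip: x_def)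
    then show ?thesis by (intro exI[of _ "if x = 0 then 1 else 2"]) auto
  next
    case False
    consider "x < 1 / 2" | "x = 1 / 2" | "1 / 2 < x" by linarith
    then show ?thesis
    proof cases
      case 1
      then have "window 0 e (h - of_int \<lfloor>h\<rfloor>)" using x False by (simp add: window_def flip: x_def)
      then show ?thesis by blast
    next
      case 2
      then have "window 1 e (h - of_int \<lfloor>h\<rfloor>)" using False by (simp add: window_def flip: x_def)
      then show ?thesis by (intro exI[of _ 1]) auto
    next
      case 3
      then have "window 0 e (h - of_int (\<lfloor>h\<rfloor> + 1))" unfolding up using x False by (simp add: window_def)
      then show ?thesis by blast
    qed
  qed
qed

lemma openin_window:
  "openin (simplex_top (length gs)) {t \<in> standard_simplex (length gs). window j e (height gs t - of_int m)}"
proof -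
  have cont: "continuous_map (simplex_top (length gs)) euclideanreal (\<lambda>t. height gs t - of_int m)"
    unfolding height_def
    by (intro continuous_map_diff continuous_map_sum continuous_map_real_mult
        continuous_map_simplex_coordinate continuous_map_const[THEN iffD2]) auto
  have "{x. window j e x} = (if j = 0 then if e then {} else {- 1 / 2<..<1 / 2}
      else if j = 1 then if e then {- 1 / 4<..<1 / 4} else {1 / 4<..<3 / 4}
      else if e then {0<..<1} else {})"
    by (auto simp: window_def)
  then have "open {x. window j e x}" by auto
  from openin_continuous_map_preimage[OF cont, of "{x. window j e x}"] this show ?thesis by simp
qed

text \<open>The product of the tree and the line has dimension two, whence three sets. If \<open>v\<close> is the canonical minimum
  in the tree and \<open>m\<close> the integer attached to the mean, then \<open>v w\<^sup>-\<^sup>m\<close> is the required label.\<close>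
theorem three_set_cover:
  assumes w: "w \<in> carrier F"
  shows "\<exists>U :: nat \<Rightarrow> ('a letter list \<times> int) bar_point set.
    (\<forall>i\<le>2. openin E (U i)) \<and> (\<Union>i\<le>2. U i) = topspace E \<and>
    (\<forall>i\<le>2. \<exists>\<sigma>. continuous_map (subtopology E (U i)) (fibrewise_path_space E proj (sect w)) \<sigma> \<and>
       (\<forall>x\<in>U i. \<sigma> x 1 = x))"
proof -
  define U where "U j = {x. \<exists>gs t c. (gs, t) \<in> bar_cells Pi \<and> x = bar_class Pi gs t \<and> label w j gs t c}" for j
  have 1: "label w j gs t c \<Longrightarrow> c \<in> carrier F" for j gs t c
    using w by (auto simp: label_def min_at_closed)
  have 2: "c = c'" if "label w j gs t c" "label w j gs t c'" for j gs t c c'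
  proof -
    obtain e v m e' v' m' where *: "min_at e (spread gs t) v" "window j e (height gs t - of_int m)"
      "c = v \<otimes>\<^bsub>F\<^esub> w [^]\<^bsub>F\<^esub> (- m)" "min_at e' (spread gs t) v'" "window j e' (height gs t - of_int m')"
      "c' = v' \<otimes>\<^bsub>F\<^esub> w [^]\<^bsub>F\<^esub> (- m')" using \<open>label w j gs t c\<close> \<open>label w j gs t c'\<close> by (auto simp: label_def)
    have em: "e = e' \<and> m = m'" by (rule window_unique[OF *(2,5)])
    then have "v = v'" using min_at_unique *(1,4) by blast
    then show ?thesis using em *(3,6) by simp
  qed
  have 3: "openin (simplex_top (length gs)) {t \<in> standard_simplex (length gs). label w j gs t c}"
    if "set gs \<subseteq> carrier Pi" for gs j c
  proof -
    have "{t \<in> standard_simplex (length gs). label w j gs t c} =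
      (\<Union>(e, v, m) \<in> {(e, v, m). c = v \<otimes>\<^bsub>F\<^esub> w [^]\<^bsub>F\<^esub> (- m)}.
         {t \<in> standard_simplex (length gs). min_at e (spread gs t) v} \<inter>
         {t \<in> standard_simplex (length gs). window j e (height gs t - of_int m)})"
      by (auto simp: label_def)
    then show ?thesis
      using openin_spread_min_at[OF that] openin_window by (auto intro!: openin_Union openin_Int)
  qed
  have 4: "label w j gs' t' (u \<otimes>\<^bsub>F\<^esub> c \<otimes>\<^bsub>F\<^esub> w [^]\<^bsub>F\<^esub> (- m))"
    if tr: "translated u m gs t gs' t'" and l: "label w j gs t c" for u m gs t gs' t' j c
  proof -
    obtain e v k where *: "min_at e (spread gs t) v" "window j e (height gs t - of_int k)"
      "c = v \<otimes>\<^bsub>F\<^esub> w [^]\<^bsub>F\<^esub> (- k)" using l by (auto simp: label_def)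
    have u: "u \<in> carrier F" and sp: "spread gs' t' = act u (spread gs t)" "height gs' t' = height gs t + m"
      using tr by (auto simp: translated_def)
    have "u \<otimes>\<^bsub>F\<^esub> c \<otimes>\<^bsub>F\<^esub> w [^]\<^bsub>F\<^esub> (- m) = (u \<otimes>\<^bsub>F\<^esub> v) \<otimes>\<^bsub>F\<^esub> w [^]\<^bsub>F\<^esub> (- (k + m))"
      using u w min_at_closed[OF *(1)] by (simp add: *(3) m_assoc int_pow_mult[symmetric])
    moreover have "min_at e (spread gs' t') (u \<otimes>\<^bsub>F\<^esub> v)"
      unfolding sp by (rule min_at_act1[OF u *(1)])
    moreover have "window j e (height gs' t' - of_int (k + m))"
      using *(2) by (simp add: sp)
    ultimately show ?thesis unfolding label_def by blast
  qed
  note sec = section_of_label[OF w, of "label w j" for j, OF 1 2 3 4, folded U_def]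
  have "x \<in> (\<Union>i\<le>2. U i)" if x: "x \<in> topspace E" for x
  proof -
    obtain gs t where gt: "(gs, t) \<in> bar_cells Pi" "x = bar_class Pi gs t"
      using x unfolding in_E_iff by blast
    obtain e v where "min_at e (spread gs t) v" using spread_min_at[OF gt(1)] by blast
    moreover obtain j m where "j \<le> 2" "window j e (height gs t - of_int m)" using ex_window by blast
    ultimately have "label w j gs t (v \<otimes>\<^bsub>F\<^esub> w [^]\<^bsub>F\<^esub> (- m))" "j \<le> 2" by (auto simp: label_def)
    then have "x \<in> U j" "j \<le> 2" using gt unfolding U_def by blast+
    then show ?thesis by blast
  qed
  moreover have "U i \<subseteq> topspace E" for i by (rule openin_subset[OF sec(1)])
  ultimately have "(\<Union>i\<le>2. U i) = topspace E" by blast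
  then show ?thesis using sec by (intro exI[of _ U] conjI allI impI) (simp_all only:)
qed

section \<open>The bundle of second moments\<close>
text \<open>The translates of the second moment of a point form a principal homogeneous set for the free group. They
  model the fibre of the covering of the classifying space that belongs to the integer factor, so that paths can be
  lifted without putting a topology on the covering.\<close>
definition fibre :: "('a letter list \<times> int) bar_point \<Rightarrow> ('a letter list \<Rightarrow> real) set" where
  "fibre x = {act u (spread gs t) | u gs t. u \<in> carrier F \<and> (gs, t) \<in> bar_cells Pi \<and> x = bar_class Pi gs t}"

lemma act_one_spread: "act \<one>\<^bsub>F\<^esub> (spread gs t) = spread gs t"
  by (rule act_one[OF spread_extensional])

lemma fibreI: "u \<in> carrier F \<Longrightarrow> (gs, t) \<in> bar_cells Pi \<Longrightarrow> act u (spread gs t) \<in> fibre (bar_class Pi gs t)"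
  unfolding fibre_def mem_Collect_eq by (intro exI conjI) (rule refl | assumption)+

lemma spread_in_fibre: "(gs, t) \<in> bar_cells Pi \<Longrightarrow> spread gs t \<in> fibre (bar_class Pi gs t)"
  using fibreI[OF one_closed, of gs t] by (simp only: act_one_spread)

lemma fibre_act:
  assumes "f \<in> fibre x" "u \<in> carrier F"
  shows "act u f \<in> fibre x"
proof -
  obtain u' gs t where f: "f = act u' (spread gs t)" "u' \<in> carrier F" "(gs, t) \<in> bar_cells Pi" "x = bar_class Pi gs t"
    using assms(1) unfolding fibre_def by blast
  then show ?thesis
    using fibreI[of "u \<otimes>\<^bsub>F\<^esub> u'" gs t] assms(2) by (simp add: act_mult)
qed

lemma fibre_class:
  assumes "(gs, t) \<in> bar_cells Pi"
  shows "fibre (bar_class Pi gs t) = {act u (spread gs t) | u. u \<in> carrier F}"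
proof (intro equalityI subsetI)
  fix f assume "f \<in> fibre (bar_class Pi gs t)"
  then obtain u gs' t' where f: "f = act u (spread gs' t')" "u \<in> carrier F"
    "bar_class Pi gs t = bar_class Pi gs' t'" unfolding fibre_def by blast
  obtain u' m where "translated u' m gs t gs' t'" using bar_class_translated[OF assms f(3)] .
  then have u': "u' \<in> carrier F" "spread gs' t' = act u' (spread gs t)" by (auto simp: translated_def)
  then have "f = act (u \<otimes>\<^bsub>F\<^esub> u') (spread gs t)" using f(1,2) by (simp add: act_mult)
  moreover have "u \<otimes>\<^bsub>F\<^esub> u' \<in> carrier F" using u' f(2) by simp
  ultimately show "f \<in> {act u (spread gs t) | u. u \<in> carrier F}" by blast
next
  fix f assume "f \<in> {act u (spread gs t) | u. u \<in> carrier F}"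
  then show "f \<in> fibre (bar_class Pi gs t)" unfolding fibre_def using assms by blast
qed

lemma fibre_transitive:
  assumes "f \<in> fibre x" "f' \<in> fibre x"
  obtains u where "u \<in> carrier F" "f' = act u f"
proof -
  obtain gs t where x: "(gs, t) \<in> bar_cells Pi" "x = bar_class Pi gs t"
    using assms(1) unfolding fibre_def by blast
  obtain u u' where u: "u \<in> carrier F" "u' \<in> carrier F" "f = act u (spread gs t)" "f' = act u' (spread gs t)"
    using assms unfolding x(2) fibre_class[OF x(1)] by blast
  have "act (u' \<otimes>\<^bsub>F\<^esub> inv\<^bsub>F\<^esub> u) f = f'"
    using u by (simp add: act_mult m_assoc)
  then show thesis using that[of "u' \<otimes>\<^bsub>F\<^esub> inv\<^bsub>F\<^esub> u"] u by simp
qed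

lemma fibre_min_at:
  assumes "f \<in> fibre x" shows "\<exists>e v. min_at e f v"
proof -
  obtain u gs t where "f = act u (spread gs t)" "u \<in> carrier F" "(gs, t) \<in> bar_cells Pi"
    using assms unfolding fibre_def by blast
  moreover obtain e v where "min_at e (spread gs t) v" using spread_min_at[OF \<open>(gs, t) \<in> bar_cells Pi\<close>] by blast
  ultimately show ?thesis using min_at_act1 by blast
qed

lemma fibre_free:
  assumes f: "f \<in> fibre x" and u: "u \<in> carrier F" "u' \<in> carrier F" and eq: "act u f = act u' f"
  shows "u = u'"
proof -
  obtain e v where m: "min_at e f v" using fibre_min_at[OF f] by blast
  have "u \<otimes>\<^bsub>F\<^esub> v = u' \<otimes>\<^bsub>F\<^esub> v"
    using min_at_act1[OF u(1) m] min_at_act1[OF u(2) m] eq min_at_unique by metis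
  then show ?thesis using u min_at_closed[OF m] by simp
qed

text \<open>The minima are coordinates on a fibre: two elements with minima of the same kind differ by the
  translation that carries one minimum to the other.\<close>
lemma fibre_eq:
  assumes f: "f \<in> fibre x" "f' \<in> fibre x" and m: "min_at e f v" "min_at e f' (u \<otimes>\<^bsub>F\<^esub> v)" and u: "u \<in> carrier F"
  shows "f' = act u f"
proof -
  obtain u' where u': "u' \<in> carrier F" "f' = act u' f" using fibre_transitive[OF f] .
  have "u' \<otimes>\<^bsub>F\<^esub> v = u \<otimes>\<^bsub>F\<^esub> v"
    using min_at_act1[OF u'(1) m(1)] m(2) u'(2) min_at_unique by metis
  then have "u' = u" using u u' min_at_closed[OF m(1)] by simp
  with u' show ?thesis by simp
qed

lemma act_extensional: "act u f \<in> extensional (carrier F)"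
  unfolding act_def by (rule restrict_extensional)

lemma fibre_extensional: "f \<in> fibre x \<Longrightarrow> f \<in> extensional (carrier F)"
  unfolding fibre_def mem_Collect_eq by (elim exE conjE) (simp only: act_extensional)

lemma fibre_eq_same:
  assumes "f \<in> fibre x" "f' \<in> fibre x" "min_at e f v" "min_at e f' v"
  shows "f' = f"
proof -
  have "\<one>\<^bsub>F\<^esub> \<otimes>\<^bsub>F\<^esub> v = v" using min_at_closed[OF assms(3)] by simp
  then have "f' = act \<one>\<^bsub>F\<^esub> f" using fibre_eq[OF assms(1-3), of "\<one>\<^bsub>F\<^esub>"] assms(4) by simp
  then show ?thesis unfolding act_one[OF fibre_extensional[OF assms(1)]] .
qed

text \<open>This is both the openness of the charts, for \<open>e' = e\<close> and \<open>v' = v\<close>, and the local constancy of the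
  transition functions between them.\<close>
lemma openin_fibre_min_at:
  "openin E {x \<in> topspace E. \<exists>f\<in>fibre x. min_at e f v \<and> min_at e' f v'}" (is "openin E ?U")
proof (cases "v \<in> carrier F \<and> v' \<in> carrier F")
  case True
  show ?thesis
    unfolding openin_classifying_space
  proof (intro conjI ballI)
    fix gs assume gs: "gs \<in> lists (carrier Pi)"
    have "{t \<in> standard_simplex (length gs). bar_class Pi gs t \<in> ?U} = (\<Union>u\<in>carrier F.
        {t \<in> standard_simplex (length gs). min_at e (spread gs t) (inv\<^bsub>F\<^esub> u \<otimes>\<^bsub>F\<^esub> v)} \<inter>
        {t \<in> standard_simplex (length gs). min_at e' (spread gs t) (inv\<^bsub>F\<^esub> u \<otimes>\<^bsub>F\<^esub> v')})"
      (is "?A = ?B")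
    proof (rule Set.set_eqI)
      fix t
      show "t \<in> ?A \<longleftrightarrow> t \<in> ?B"
      proof (cases "t \<in> standard_simplex (length gs)")
        case t: True
        have c: "(gs, t) \<in> bar_cells Pi" using gs t by (auto simp: Pi.bar_cells_iff)
        then have "bar_class Pi gs t \<in> topspace E" unfolding in_E_iff by blast
        then have "t \<in> ?A \<longleftrightarrow> (\<exists>f\<in>fibre (bar_class Pi gs t). min_at e f v \<and> min_at e' f v')"
          unfolding mem_Collect_eq using t by blast
        also have "\<dots> \<longleftrightarrow> (\<exists>u\<in>carrier F. min_at e (act u (spread gs t)) v \<and> min_at e' (act u (spread gs t)) v')"
          unfolding fibre_class[OF c] by blast
        also have "\<dots> \<longleftrightarrow> t \<in> ?B"
          unfolding UN_iff Int_iff mem_Collect_eq using t True min_at_act by blast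
        finally show ?thesis .
      qed simp
    qed
    then show "openin (simplex_top (length gs)) {t \<in> standard_simplex (length gs). bar_class Pi gs t \<in> ?U}"
      using gs openin_spread_min_at[of gs] by (auto simp: lists_iff intro!: openin_Union openin_Int)
  next
    show "?U \<subseteq> bar_cells Pi // bar_equiv Pi" unfolding topspace_classifying_space by blast
  qed
next
  case False
  then have "?U = {}" using min_at_closed by blast
  then show ?thesis by (simp only: openin_empty)
qed

text \<open>A lift of \<open>H\<close> to the covering. Its continuity is expressed by local constancy of the minima.\<close>
definition covering_lift :: "'b::topological_space set \<Rightarrow> ('b \<Rightarrow> ('a letter list \<times> int) bar_point) \<Rightarrow>
    ('b \<Rightarrow> 'a letter list \<Rightarrow> real) \<Rightarrow> bool" where
  "covering_lift S H L \<longleftrightarrow> (\<forall>z\<in>S. L z \<in> fibre (H z)) \<and>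
     (\<forall>e v. openin (top_of_set S) {z \<in> S. min_at e (L z) v})"

lemma covering_lift_cell:
  assumes gs: "set gs \<subseteq> carrier Pi" and W: "continuous_map (top_of_set S) (simplex_top (length gs)) W"
  shows "covering_lift S (\<lambda>z. bar_class Pi gs (W z)) (\<lambda>z. spread gs (W z))"
proof -
  have t: "W z \<in> standard_simplex (length gs)" if "z \<in> S" for z
    using W that by (auto simp: continuous_map_def)
  have "openin (top_of_set S) {z \<in> S. min_at e (spread gs (W z)) v}" for e v
  proof -
    have "{z \<in> S. min_at e (spread gs (W z)) v} = {z \<in> topspace (top_of_set S).
        W z \<in> {t \<in> standard_simplex (length gs). min_at e (spread gs t) v}}"
      using t by auto
    then show ?thesis
      using openin_continuous_map_preimage[OF W openin_spread_min_at[OF gs]] by simp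
  qed
  then show ?thesis
    using t gs by (auto simp: covering_lift_def Pi.bar_cells_iff intro!: spread_in_fibre)
qed

lemma covering_lift_act:
  assumes L: "covering_lift S H L" and u: "u \<in> carrier F"
  shows "covering_lift S H (\<lambda>z. act u (L z))"
proof -
  have "openin (top_of_set S) {z \<in> S. min_at e (act u (L z)) v}" for e v
  proof (cases "v \<in> carrier F")
    case True
    then show ?thesis using L by (simp add: min_at_act[OF u True] covering_lift_def)
  next
    case False
    then have "{z \<in> S. min_at e (act u (L z)) v} = {}" using min_at_closed by blast
    then show ?thesis by (simp only: openin_empty)
  qed
  then show ?thesis using L u by (simp add: covering_lift_def fibre_act)
qed

lemma covering_lift_compose:
  assumes L: "covering_lift S H L" and f: "continuous_on S' f" "f ` S' \<subseteq> S"
  shows "covering_lift S' (\<lambda>z. H (f z)) (\<lambda>z. L (f z))"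
proof -
  have "openin (top_of_set S') {z \<in> S'. min_at e (L (f z)) v}" for e v
  proof -
    have "continuous_map (top_of_set S') (top_of_set S) f"
      using f by (simp add: continuous_map_in_subtopology image_subset_iff_funcset)
    from openin_continuous_map_preimage[OF this, of "{z \<in> S. min_at e (L z) v}"]
    have "openin (top_of_set S') {z \<in> S'. f z \<in> S \<and> min_at e (L (f z)) v}"
      using L by (simp add: covering_lift_def)
    moreover have "{z \<in> S'. f z \<in> S \<and> min_at e (L (f z)) v} = {z \<in> S'. min_at e (L (f z)) v}"
      using f(2) by auto
    ultimately show ?thesis by simp
  qed
  then show ?thesis using L f(2) by (auto simp: covering_lift_def)
qed

lemma covering_lift_subset: "covering_lift S H L \<Longrightarrow> S' \<subseteq> S \<Longrightarrow> covering_lift S' H L"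
  by (rule covering_lift_compose[where f = "\<lambda>z. z"]) auto

lemma covering_lift_cong:
  assumes "covering_lift S H L" "\<And>z. z \<in> S \<Longrightarrow> H z = H' z" "\<And>z. z \<in> S \<Longrightarrow> L z = L' z"
  shows "covering_lift S H' L'"
proof -
  have "{z \<in> S. min_at e (L' z) v} = {z \<in> S. min_at e (L z) v}" for e v using assms(3) by auto
  then show ?thesis using assms by (auto simp: covering_lift_def)
qed

text \<open>The sets on which \<open>L'\<close> is the translate of \<open>L\<close> by a given element are open and partition \<open>S\<close>.\<close>
lemma covering_lift_unique:
  assumes L: "covering_lift S H L" "covering_lift S H L'" and S: "connected S"
  obtains u where "u \<in> carrier F" "\<And>z. z \<in> S \<Longrightarrow> L' z = act u (L z)"
proof (cases "S = {}")
  case True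
  then show thesis using that[OF one_closed] by simp
next
  case False
  then obtain z0 where z0: "z0 \<in> S" by blast
  have fib: "L z \<in> fibre (H z)" "L' z \<in> fibre (H z)" if "z \<in> S" for z
    using L that by (auto simp: covering_lift_def)
  define A where "A u = {z \<in> S. L' z = act u (L z)}" for u
  have A: "openin (top_of_set S) (A u)" if u: "u \<in> carrier F" for u
  proof -
    have "A u = (\<Union>(e, v)\<in>UNIV. {z \<in> S. min_at e (L z) v} \<inter> {z \<in> S. min_at e (L' z) (u \<otimes>\<^bsub>F\<^esub> v)})" (is "_ = ?B")
    proof (intro equalityI subsetI)
      fix z assume "z \<in> A u"
      then have z: "z \<in> S" "L' z = act u (L z)" by (auto simp: A_def)
      obtain e v where "min_at e (L z) v" using fibre_min_at fib(1)[OF z(1)] by blast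
      then show "z \<in> ?B" using z min_at_act1[OF u, of e "L z" v] by auto
    next
      fix z assume "z \<in> ?B"
      then show "z \<in> A u" using fibre_eq[OF fib(1) fib(2) _ _ u] by (auto simp: A_def)
    qed
    moreover have "openin (top_of_set S) ({z \<in> S. min_at e (L z) v} \<inter> {z \<in> S. min_at e (L' z) (u \<otimes>\<^bsub>F\<^esub> v)})" for e v
      using L by (intro openin_Int) (simp_all add: covering_lift_def)
    ultimately show ?thesis by (auto intro!: openin_Union)
  qed
  obtain u where u: "u \<in> carrier F" "z0 \<in> A u"
    using fibre_transitive[OF fib(1)[OF z0] fib(2)[OF z0]] z0 by (auto simp: A_def)
  have "S - A u = (\<Union>u'\<in>carrier F - {u}. A u')"
  proof (intro equalityI subsetI)
    fix z assume z: "z \<in> S - A u"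
    then obtain u' where "u' \<in> carrier F" "L' z = act u' (L z)"
      using fibre_transitive[OF fib(1) fib(2), of z] by auto
    then show "z \<in> (\<Union>u'\<in>carrier F - {u}. A u')" using z by (auto simp: A_def)
  next
    fix z assume "z \<in> (\<Union>u'\<in>carrier F - {u}. A u')"
    then obtain u' where u': "u' \<in> carrier F" "u' \<noteq> u" "z \<in> S" "L' z = act u' (L z)" by (auto simp: A_def)
    then have "L' z \<noteq> act u (L z)" using fibre_free[OF fib(1) u'(1) u(1), of z] by auto
    then show "z \<in> S - A u" using u' by (simp add: A_def)
  qed
  then have "openin (top_of_set S) (S - A u)" using A by (auto intro!: openin_Union)
  then have "closedin (top_of_set S) (A u)"
    by (simp add: closedin_def A_def)
  then have "A u = S" using S A[OF u(1)] u(2) unfolding connected_clopen by blast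
  then show thesis using that[OF u(1)] by (auto simp: A_def)
qed

text \<open>Near \<open>z0\<close> the lift is the element of the fibre whose minimum, of the kind found at \<open>z0\<close>, stays where it
  is.\<close>
lemma covering_lift_local:
  assumes H: "continuous_map (top_of_set S) E H" and z0: "z0 \<in> S"
  obtains N L where "openin (top_of_set S) N" "z0 \<in> N" "covering_lift N H L"
proof -
  have E: "H z \<in> topspace E" if "z \<in> S" for z using H that unfolding continuous_map_def by auto
  obtain gs t where gt: "(gs, t) \<in> bar_cells Pi" "H z0 = bar_class Pi gs t"
    using E[OF z0] unfolding in_E_iff by blast
  obtain e v where m0: "min_at e (spread gs t) v" using spread_min_at[OF gt(1)] by blast
  define N where "N = {z \<in> S. \<exists>f\<in>fibre (H z). min_at e f v}"
  define L where "L z = (SOME f. f \<in> fibre (H z) \<and> min_at e f v)" for z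
  have pre: "openin (top_of_set S) {z \<in> S. \<exists>f\<in>fibre (H z). min_at e f v \<and> min_at e' f v'}" for e' v'
  proof -
    have "{z \<in> S. \<exists>f\<in>fibre (H z). min_at e f v \<and> min_at e' f v'} =
        {z \<in> topspace (top_of_set S). H z \<in> {x \<in> topspace E. \<exists>f\<in>fibre x. min_at e f v \<and> min_at e' f v'}}"
      using E by auto
    then show ?thesis using openin_continuous_map_preimage[OF H openin_fibre_min_at] by simp
  qed
  have N: "openin (top_of_set S) N" using pre[of e v] by (simp add: N_def)
  have L: "L z \<in> fibre (H z) \<and> min_at e (L z) v" if "z \<in> N" for z
  proof -
    have "\<exists>f. f \<in> fibre (H z) \<and> min_at e f v" using that unfolding N_def by blast
    from someI_ex[OF this] show ?thesis by (simp only: L_def)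
  qed
  have "openin (top_of_set N) {z \<in> N. min_at e' (L z) v'}" for e' v'
  proof -
    have "{z \<in> N. min_at e' (L z) v'} = {z \<in> S. \<exists>f\<in>fibre (H z). min_at e f v \<and> min_at e' f v'}" (is "?A = ?B")
    proof (intro equalityI subsetI)
      fix z assume "z \<in> ?A"
      then show "z \<in> ?B" using L by (auto simp: N_def)
    next
      fix z assume "z \<in> ?B"
      then obtain f where f: "z \<in> S" "f \<in> fibre (H z)" "min_at e f v" "min_at e' f v'" by blast
      then have zN: "z \<in> N" by (auto simp: N_def)
      have "f = L z" using fibre_eq_same L[OF zN] f(2,3) by blast
      then show "z \<in> ?A" using f zN by simp
    qed
    then have "openin (top_of_set S) {z \<in> N. min_at e' (L z) v'}" using pre by simp
    moreover have "N \<subseteq> S" by (auto simp: N_def)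
    ultimately show ?thesis by (auto intro: openin_subset_trans)
  qed
  then have "covering_lift N H L" using L by (simp add: covering_lift_def)
  moreover have "z0 \<in> N" using z0 m0 spread_in_fibre[OF gt(1)] by (auto simp: N_def gt(2))
  ultimately show thesis using that[OF N] by blast
qed

text \<open>On the connected overlap the two lifts differ by one translation, which is used to correct the second.\<close>
lemma covering_lift_glue:
  assumes A: "closed A" "covering_lift A H L" and B: "closed B" "covering_lift B H L'"
    and AB: "connected (A \<inter> B)"
  obtains M where "covering_lift (A \<union> B) H M"
proof -
  obtain u where u: "u \<in> carrier F" "\<And>z. z \<in> A \<inter> B \<Longrightarrow> L z = act u (L' z)"
    using covering_lift_unique[OF covering_lift_subset[OF B(2)] covering_lift_subset[OF A(2)] AB] by auto
  define M where "M z = (if z \<in> A then L z else act u (L' z))" for z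
  have MA: "covering_lift A H M"
    by (rule covering_lift_cong[OF A(2)]) (simp_all add: M_def)
  have MB: "covering_lift B H M"
    by (rule covering_lift_cong[OF covering_lift_act[OF B(2) u(1)]]) (use u(2) in \<open>auto simp: M_def\<close>)
  have "openin (top_of_set (A \<union> B)) {z \<in> A \<union> B. min_at e (M z) v}" for e v
  proof -
    have closed: "closed {z \<in> C. \<not> min_at e (M z) v}" if "closed C" "covering_lift C H M" for C
    proof -
      have "closedin (top_of_set C) (C - {z \<in> C. min_at e (M z) v})"
        using that(2) by (intro closedin_diff) (simp_all add: covering_lift_def)
      moreover have "C - {z \<in> C. min_at e (M z) v} = {z \<in> C. \<not> min_at e (M z) v}" by auto
      ultimately show ?thesis using that(1) closedin_closed_trans by metis
    qed
    have "closed ({z \<in> A. \<not> min_at e (M z) v} \<union> {z \<in> B. \<not> min_at e (M z) v})"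
      using closed[OF A(1) MA] closed[OF B(1) MB] by (rule closed_Un)
    from open_Compl[OF this] have "openin (top_of_set (A \<union> B))
        ((A \<union> B) \<inter> - ({z \<in> A. \<not> min_at e (M z) v} \<union> {z \<in> B. \<not> min_at e (M z) v}))"
      by (rule openin_open_Int)
    moreover have "(A \<union> B) \<inter> - ({z \<in> A. \<not> min_at e (M z) v} \<union> {z \<in> B. \<not> min_at e (M z) v}) = {z \<in> A \<union> B. min_at e (M z) v}"
      by auto
    ultimately show ?thesis by simp
  qed
  then have "covering_lift (A \<union> B) H M" using MA MB by (auto simp: covering_lift_def)
  then show thesis using that by blast
qed

end

section \<open>Lifting over the unit square\<close>

definition grid_cell :: "nat \<Rightarrow> nat \<Rightarrow> nat \<Rightarrow> (real \<times> real) set" where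
  "grid_cell n i j = {real i / n..real (Suc i) / n} \<times> {real j / n..real (Suc j) / n}"

abbreviation unit_square :: "(real \<times> real) set" where
  "unit_square \<equiv> {0..1} \<times> {0..1}"

lemma grid_cell_subset:
  assumes "i < n" "j < n" shows "grid_cell n i j \<subseteq> unit_square"
proof -
  have "{real i / n..real (Suc i) / n} \<subseteq> {0..1}" if "i < n" for i
    using that by (intro atLeastatMost_subset_iff[THEN iffD2]) simp
  with assms show ?thesis unfolding grid_cell_def by (intro Sigma_mono) simp_all
qed

text \<open>A Lebesgue number argument.\<close>
lemma unit_square_grid:
  assumes "\<And>z. z \<in> unit_square \<Longrightarrow> \<exists>N\<in>\<N>. openin (top_of_set unit_square) N \<and> z \<in> N"
  obtains n where "0 < n" "\<And>i j. i < n \<Longrightarrow> j < n \<Longrightarrow> \<exists>N\<in>\<N>. grid_cell n i j \<subseteq> N"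
proof -
  have comp: "compact unit_square" by (intro compact_Times compact_Icc)
  define \<G> where "\<G> = {G. open G \<and> unit_square \<inter> G \<in> \<N>}"
  have cov: "unit_square \<subseteq> \<Union>\<G>"
  proof
    fix z assume "z \<in> unit_square"
    then obtain N where N: "N \<in> \<N>" "openin (top_of_set unit_square) N" "z \<in> N" using assms by blast
    then obtain G where "open G" "N = unit_square \<inter> G" by (auto simp: openin_open)
    then show "z \<in> \<Union>\<G>" using N by (auto simp: \<G>_def)
  qed
  obtain e where e: "0 < e" "\<And>z. z \<in> unit_square \<Longrightarrow> \<exists>G\<in>\<G>. ball z e \<subseteq> G"
    using Heine_Borel_lemma[OF comp cov] by (auto simp: \<G>_def)
  obtain n where n: "n > 0" "inverse (real n) < e / 2"
    using reals_Archimedean[of "e / 2"] e(1) by (metis half_gt_zero inverse_Suc zero_less_Suc)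
  show thesis
  proof (rule that[OF n(1)])
    fix i j assume ij: "i < n" "j < n"
    let ?z = "(real i / n, real j / n)"
    have "?z \<in> grid_cell n i j" by (simp add: grid_cell_def divide_right_mono)
    then have "?z \<in> unit_square" using grid_cell_subset[OF ij] by blast
    then obtain G where G: "G \<in> \<G>" "ball ?z e \<subseteq> G" using e(2) by blast
    have "grid_cell n i j \<subseteq> ball ?z e"
    proof
      fix p assume p: "p \<in> grid_cell n i j"
      obtain x y where xy: "p = (x, y)" by (cases p)
      have "\<bar>real i / n - x\<bar> \<le> 1 / n" "\<bar>real j / n - y\<bar> \<le> 1 / n"
        using p xy by (auto simp: grid_cell_def add_divide_distrib abs_le_iff)
      then have "dist ?z p \<le> 1 / n + 1 / n"
        unfolding xy dist_Pair_Pair dist_real_def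
        using sqrt_sum_squares_le_sum_abs[of "real i / n - x" "real j / n - y"] by simp
      also have "\<dots> < e" using n(2) by (simp add: inverse_eq_divide)
      finally show "p \<in> ball ?z e" by simp
    qed
    then have "grid_cell n i j \<subseteq> unit_square \<inter> G" using G grid_cell_subset[OF ij] by blast
    moreover have "unit_square \<inter> G \<in> \<N>" using G(1) by (simp add: \<G>_def)
    ultimately show "\<exists>N\<in>\<N>. grid_cell n i j \<subseteq> N" by blast
  qed
qed

context finite_rank_free_group
begin

text \<open>Local lifts over the cells of a fine grid are glued to strips, and the strips are glued to the square; every
  overlap is a segment.\<close>
lemma covering_lift_square:
  assumes H: "continuous_map (top_of_set unit_square) E H"
  obtains L where "covering_lift unit_square H L"
proof -
  have local: "\<exists>N\<in>{N. \<exists>L. covering_lift N H L}. openin (top_of_set unit_square) N \<and> z \<in> N"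
    if "z \<in> unit_square" for z
  proof -
    from that obtain N L where "openin (top_of_set unit_square) N" "z \<in> N" "covering_lift N H L"
      by (rule covering_lift_local[OF H])
    then show ?thesis by blast
  qed
  obtain n where n: "0 < n" "\<And>i j. i < n \<Longrightarrow> j < n \<Longrightarrow>
      \<exists>N\<in>{N. \<exists>L. covering_lift N H L}. grid_cell n i j \<subseteq> N"
    using unit_square_grid[OF local] by blast
  have cell: "\<exists>L. covering_lift (grid_cell n i j) H L" if ij: "i < n" "j < n" for i j
  proof -
    obtain N L where "covering_lift N H L" "grid_cell n i j \<subseteq> N" using n(2)[OF ij] by blast
    then have "covering_lift (grid_cell n i j) H L" by (rule covering_lift_subset)
    then show ?thesis by blast
  qed
  have strip: "\<exists>L. covering_lift ({0..real (Suc k) / n} \<times> {real j / n..real (Suc j) / n}) H L" if "k < n" "j < n" for j k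
    using that
  proof (induction k)
    case 0
    then show ?case using cell[of 0 j] by (simp add: grid_cell_def)
  next
    case (Suc k)
    let ?A = "{0..real (Suc k) / n} \<times> {real j / n..real (Suc j) / n}" and ?B = "grid_cell n (Suc k) j"
    obtain L where L: "covering_lift ?A H L" using Suc by auto
    obtain L' where L': "covering_lift ?B H L'" using cell Suc.prems by blast
    have AB: "?A \<inter> ?B = {real (Suc k) / n} \<times> {real j / n..real (Suc j) / n}"
      by (auto simp: grid_cell_def divide_right_mono)
    have con: "connected (?A \<inter> ?B)"
      unfolding AB by (intro connected_Times connected_Icc connected_sing)
    have "?A \<union> ?B = {0..real (Suc (Suc k)) / n} \<times> {real j / n..real (Suc j) / n}"
      using ivl_disj_un_two_touch(4)[of 0 "real (Suc k) / n" "real (Suc (Suc k)) / n"]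
      by (simp add: grid_cell_def divide_right_mono flip: Sigma_Un_distrib1)
    moreover have "closed ?A" "closed ?B"
      by (auto simp: grid_cell_def intro!: closed_Times)
    moreover obtain M where "covering_lift (?A \<union> ?B) H M"
      by (rule covering_lift_glue[OF \<open>closed ?A\<close> L \<open>closed ?B\<close> L' con])
    ultimately show ?case by auto
  qed
  have stack: "\<exists>L. covering_lift ({0..1} \<times> {0..real (Suc k) / n}) H L" if "k < n" for k
    using that
  proof (induction k)
    case 0
    then show ?case using strip[of "n - 1" 0] n(1) by simp
  next
    case (Suc k)
    let ?A = "{0..1::real} \<times> {0..real (Suc k) / n}" and ?B = "{0..1::real} \<times> {real (Suc k) / n..real (Suc (Suc k)) / n}"
    obtain L where L: "covering_lift ?A H L" using Suc by auto
    obtain L' where L': "covering_lift ?B H L'" using strip[of "n - 1" "Suc k"] Suc.prems by auto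
    have AB: "?A \<inter> ?B = {0..1::real} \<times> {real (Suc k) / n}" by (auto simp: divide_right_mono)
    have con: "connected (?A \<inter> ?B)"
      unfolding AB by (intro connected_Times connected_Icc connected_sing)
    have "?A \<union> ?B = {0..1} \<times> {0..real (Suc (Suc k)) / n}"
      using ivl_disj_un_two_touch(4)[of 0 "real (Suc k) / n" "real (Suc (Suc k)) / n"]
      by (simp add: divide_right_mono flip: Sigma_Un_distrib2)
    moreover have "closed ?A" "closed ?B" by (auto intro!: closed_Times)
    moreover obtain M where "covering_lift (?A \<union> ?B) H M"
      by (rule covering_lift_glue[OF \<open>closed ?A\<close> L \<open>closed ?B\<close> L' con])
    ultimately show ?case by auto
  qed
  obtain L where "covering_lift unit_square H L" using stack[of "n - 1"] n(1) by auto
  then show thesis by (rule that)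
qed

text \<open>Evaluation is continuous for the compact-open topology because the unit interval is locally compact.\<close>
lemma continuous_section_evaluation:
  assumes \<sigma>: "continuous_map (subtopology E U) (fibrewise_path_space E q s) \<sigma>"
    and g: "continuous_map (top_of_set {0..1::real}) E g" "g ` {0..1} \<subseteq> U"
  shows "continuous_map (top_of_set unit_square) E (\<lambda>z. \<sigma> (g (fst z)) (snd z))"
proof -
  have \<sigma>g: "continuous_map (top_of_set {0..1}) (path_space E) (\<lambda>x. \<sigma> (g x))"
    using continuous_map_compose[of "top_of_set {0..1}" "subtopology E U" g "path_space E" \<sigma>] g \<sigma>
    by (auto simp: comp_def continuous_map_in_subtopology fibrewise_path_space_def)
  have path: "\<sigma> (g x) \<in> paths E" if "x \<in> {0..1}" for x
    using \<sigma>g that by (auto simp: continuous_map_def topspace_path_space)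
  show ?thesis
    unfolding continuous_map_def
  proof (intro conjI allI impI)
    show "(\<lambda>z. \<sigma> (g (fst z)) (snd z)) \<in> topspace (top_of_set unit_square) \<rightarrow> topspace E"
    proof
      fix z assume "z \<in> topspace (top_of_set unit_square)"
      then have "pathin E (\<sigma> (g (fst z)))" "snd z \<in> {0..1}" using path[of "fst z"] by (auto simp: paths_def)
      then show "\<sigma> (g (fst z)) (snd z) \<in> topspace E" unfolding pathin_def continuous_map_def by auto
    qed
    fix V assume V: "openin E V"
    let ?P = "{z \<in> topspace (top_of_set unit_square). \<sigma> (g (fst z)) (snd z) \<in> V}"
    show "openin (top_of_set unit_square) ?P"
    proof (subst openin_subopen, intro ballI)
      fix z assume z: "z \<in> ?P"
      obtain x0 t0 where xt: "z = (x0, t0)" by (cases z)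
      have x0: "x0 \<in> {0..1}" and t0: "t0 \<in> {0..1}" "\<sigma> (g x0) t0 \<in> V" using z xt by auto
      have "continuous_map (top_of_set {0..1}) E (\<sigma> (g x0))"
        using path[OF x0] by (simp add: paths_def pathin_def)
      from openin_continuous_map_preimage[OF this V]
      obtain G where G: "open G" "{t \<in> {0..1}. \<sigma> (g x0) t \<in> V} = {0..1} \<inter> G"
        by (auto simp: openin_open)
      then have "t0 \<in> G" using t0 by auto
      then obtain e where e: "0 < e" "cball t0 e \<subseteq> G" using G(1) open_contains_cball by blast
      define K where "K = {0..1} \<inter> cball t0 e"
      have K: "compact K" "K \<subseteq> {0..1}" by (auto simp: K_def compact_Int)
      define A where "A = {x \<in> topspace (top_of_set {0..1}). \<sigma> (g x) \<in> {\<alpha> \<in> paths E. \<alpha> ` K \<subseteq> V}}"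
      have "openin (path_space E) {\<alpha> \<in> paths E. \<alpha> ` K \<subseteq> V}"
        unfolding path_space_def by (rule topology_generated_by_Basis) (use K V in blast)
      then have A: "openin (top_of_set {0..1}) A"
        unfolding A_def by (rule openin_continuous_map_preimage[OF \<sigma>g])
      have B: "openin (top_of_set {0..1}) ({0..1} \<inter> ball t0 e)" by (intro openin_open_Int) simp
      have "openin (top_of_set unit_square) (A \<times> ({0..1} \<inter> ball t0 e))" by (rule openin_Times[OF A B])
      moreover have "z \<in> A \<times> ({0..1} \<inter> ball t0 e)"
        using x0 t0 e(1) path[OF x0] G(2) e(2) by (auto simp: xt A_def K_def)
      moreover have "A \<times> ({0..1} \<inter> ball t0 e) \<subseteq> ?P"
        by (auto simp: A_def K_def image_subset_iff)
      ultimately show "\<exists>T. openin (top_of_set unit_square) T \<and> z \<in> T \<and> T \<subseteq> ?P" by blast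
    qed
  qed
qed

end

section \<open>The holonomy of a section\<close>

context finite_rank_free_group
begin

text \<open>The translation is determined by the step functions alone, so the equations for \<open>spread\<close> and \<open>height\<close> hold
  for the given \<open>(u, m)\<close>.\<close>
lemma translatedI:
  assumes c: "(gs, t) \<in> bar_cells Pi" "(gs', t') \<in> bar_cells Pi" and u: "u \<in> carrier F"
    and s: "\<And>r. 0 \<le> r \<Longrightarrow> r < 1 \<Longrightarrow> step Pi gs' t' r = (u, m) \<otimes>\<^bsub>Pi\<^esub> step Pi gs t r"
  shows "translated u m gs t gs' t'"
proof -
  have um: "(u, m) \<in> carrier Pi" using u by (simp add: Pi_carrier)
  have "bar_class Pi gs t = bar_class Pi gs' t'"
    unfolding bar_class_eq_iff by (rule Pi.bar_equiv_step[OF c um s])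
  then obtain u' m' where tr: "translated u' m' gs t gs' t'" using bar_class_translated[OF c(1)] by blast
  have st: "step Pi gs t 0 \<in> carrier Pi" using c(1) by (simp add: Pi.bar_cells_iff Pi.step_closed)
  have um': "(u', m') \<in> carrier Pi" using tr by (simp add: Pi_carrier translated_def)
  have "step Pi gs' t' 0 = (u', m') \<otimes>\<^bsub>Pi\<^esub> step Pi gs t 0" using tr by (simp add: translated_def)
  then have "(u', m') \<otimes>\<^bsub>Pi\<^esub> step Pi gs t 0 = (u, m) \<otimes>\<^bsub>Pi\<^esub> step Pi gs t 0" using s[of 0] by simp
  then have "(u', m') = (u, m)" using um um' st by (simp only: Pi.right_cancel)
  then show ?thesis using tr by simp
qed

lemma translated_class: "translated u m gs t gs' t' \<Longrightarrow> bar_class Pi gs t = bar_class Pi gs' t'"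
proof -
  assume tr: "translated u m gs t gs' t'"
  then have c: "(gs, t) \<in> bar_cells Pi" "(gs', t') \<in> bar_cells Pi" and u: "(u, m) \<in> carrier Pi"
    and s: "\<And>r. 0 \<le> r \<Longrightarrow> r < 1 \<Longrightarrow> step Pi gs' t' r = (u, m) \<otimes>\<^bsub>Pi\<^esub> step Pi gs t r"
    by (auto simp: translated_def Pi_carrier)
  show ?thesis unfolding bar_class_eq_iff by (rule Pi.bar_equiv_step[OF c u s])
qed

text \<open>The image of a cell under the projection followed by the chosen section.\<close>
definition base_word :: "'a letter list \<Rightarrow> ('a letter list \<times> int) list \<Rightarrow> ('a letter list \<times> int) list" where
  "base_word w gs = map (lift_w w) (map snd gs)"

lemma base_word_closed: "w \<in> carrier F \<Longrightarrow> set (base_word w gs) \<subseteq> carrier Pi"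
  using lift_w_closed by (auto simp: base_word_def)

lemma length_base_word [simp]: "length (base_word w gs) = length gs"
  by (simp add: base_word_def)

lemma base_cell: "w \<in> carrier F \<Longrightarrow> (gs, t) \<in> bar_cells Pi \<Longrightarrow> (base_word w gs, t) \<in> bar_cells Pi"
  using base_word_closed[of w gs] by (simp add: Pi.bar_cells_iff)

lemma sect_proj_class: "w \<in> carrier F \<Longrightarrow> sect w (proj (bar_class Pi gs t)) = bar_class Pi (base_word w gs) t"
  by (simp only: proj_class sect_class base_word_def)

lemma translated_base:
  assumes w: "w \<in> carrier F" and tr: "translated u m gs t gs' t'"
  shows "translated (w [^]\<^bsub>F\<^esub> m) m (base_word w gs) t (base_word w gs') t'"
proof -
  have c: "(gs, t) \<in> bar_cells Pi" "(gs', t') \<in> bar_cells Pi"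
    and s: "\<And>r. 0 \<le> r \<Longrightarrow> r < 1 \<Longrightarrow> step Pi gs' t' r = (u, m) \<otimes>\<^bsub>Pi\<^esub> step Pi gs t r"
    using tr by (auto simp: translated_def)
  have gs: "set gs \<subseteq> carrier Pi" "set gs' \<subseteq> carrier Pi" using c by (auto simp: Pi.bar_cells_iff)
  have cl: "fst (step Pi gs t r) \<in> carrier F" for r
    using Pi.step_closed[OF gs(1)] by (simp add: Pi_carrier)
  show ?thesis
  proof (rule translatedI[OF base_cell[OF w c(1)] base_cell[OF w c(2)]])
    fix r :: real assume r: "0 \<le> r" "r < 1"
    show "step Pi (base_word w gs') t' r = (w [^]\<^bsub>F\<^esub> m, m) \<otimes>\<^bsub>Pi\<^esub> step Pi (base_word w gs) t r"
      using s[OF r] cl w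
      by (simp only: base_word_def step_lift_w[OF w gs(1)] step_lift_w[OF w gs(2)])
        (simp add: lift_w_eq Pi_mult int_pow_mult)
  qed (use w in simp)
qed

text \<open>Lift the path that \<open>\<sigma>\<close> chooses for the point \<open>(gs, t)\<close> so that it ends at the second moment of \<open>gs\<close>. It
  starts at a translate of the second moment of the vertices \<open>(w\<^sup>b, b)\<close>; the translation is the holonomy.
  This recovers the parameter \<open>c\<close> of the sweep.\<close>
definition holonomy :: "'a letter list \<Rightarrow> (('a letter list \<times> int) bar_point \<Rightarrow> real \<Rightarrow> ('a letter list \<times> int) bar_point) \<Rightarrow>
    ('a letter list \<times> int) list \<Rightarrow> (nat \<Rightarrow> real) \<Rightarrow> 'a letter list \<Rightarrow> bool" where
  "holonomy w \<sigma> gs t c \<longleftrightarrow> c \<in> carrier F \<and> (\<exists>L. covering_lift {0..1} (\<sigma> (bar_class Pi gs t)) L \<and>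
     L 1 = spread gs t \<and> L 0 = act c (spread (base_word w gs) t))"

lemma covering_lift_fibre: "covering_lift S H L \<Longrightarrow> z \<in> S \<Longrightarrow> L z \<in> fibre (H z)"
  by (simp add: covering_lift_def)

lemma holonomy_unique:
  assumes w: "w \<in> carrier F" and c: "(gs, t) \<in> bar_cells Pi"
    and h: "holonomy w \<sigma> gs t c" "holonomy w \<sigma> gs t c'"
  shows "c = c'"
proof -
  obtain L L' where L: "covering_lift {0..1::real} (\<sigma> (bar_class Pi gs t)) L"
      "L 1 = spread gs t" "L 0 = act c (spread (base_word w gs) t)"
    and L': "covering_lift {0..1::real} (\<sigma> (bar_class Pi gs t)) L'"
      "L' 1 = spread gs t" "L' 0 = act c' (spread (base_word w gs) t)"
    using h unfolding holonomy_def by blast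
  have cc: "c \<in> carrier F" "c' \<in> carrier F" using h by (auto simp: holonomy_def)
  obtain u where u: "u \<in> carrier F" "\<And>z. z \<in> {0..1} \<Longrightarrow> L' z = act u (L z)"
    using covering_lift_unique[OF L(1) L'(1) connected_Icc] by blast
  have "act u (L 1) = act \<one>\<^bsub>F\<^esub> (L 1)" using u(2)[of 1] L(2) L'(2) by (simp add: act_one_spread)
  then have "u = \<one>\<^bsub>F\<^esub>"
    using fibre_free[OF covering_lift_fibre[OF L(1), of 1] u(1) one_closed] by simp
  then have "act c' (spread (base_word w gs) t) = act c (spread (base_word w gs) t)"
    using u(2)[of 0] L(3) L'(3) cc by (simp add: act_mult)
  then show ?thesis
    using fibre_free[OF spread_in_fibre[OF base_cell[OF w c]] cc(2,1)] by simp
qed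

text \<open>The same transformation rule as for the labels in \<open>section_of_label\<close>.\<close>
lemma holonomy_translated:
  assumes w: "w \<in> carrier F" and tr: "translated u m gs t gs' t'" and h: "holonomy w \<sigma> gs t c"
  shows "holonomy w \<sigma> gs' t' (u \<otimes>\<^bsub>F\<^esub> c \<otimes>\<^bsub>F\<^esub> w [^]\<^bsub>F\<^esub> (- m))"
proof -
  obtain L where L: "covering_lift {0..1::real} (\<sigma> (bar_class Pi gs t)) L"
      "L 1 = spread gs t" "L 0 = act c (spread (base_word w gs) t)"
    using h unfolding holonomy_def by blast
  have c: "c \<in> carrier F" using h by (simp add: holonomy_def)
  have u: "u \<in> carrier F" and sp: "spread gs' t' = act u (spread gs t)"
    using tr by (auto simp: translated_def)
  have sp': "spread (base_word w gs') t' = act (w [^]\<^bsub>F\<^esub> m) (spread (base_word w gs) t)"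
    using translated_base[OF w tr] by (simp add: translated_def)
  have "covering_lift {0..1} (\<sigma> (bar_class Pi gs' t')) (\<lambda>z. act u (L z))"
    using covering_lift_act[OF L(1) u] by (simp only: translated_class[OF tr])
  moreover have "act u (L 1) = spread gs' t'" by (simp only: L(2) sp)
  moreover have "act u (L 0) = act (u \<otimes>\<^bsub>F\<^esub> c \<otimes>\<^bsub>F\<^esub> w [^]\<^bsub>F\<^esub> (- m)) (spread (base_word w gs') t')"
  proof -
    have "u \<otimes>\<^bsub>F\<^esub> c \<otimes>\<^bsub>F\<^esub> w [^]\<^bsub>F\<^esub> (- m) \<otimes>\<^bsub>F\<^esub> w [^]\<^bsub>F\<^esub> m = u \<otimes>\<^bsub>F\<^esub> c"
      using u c w by (simp add: m_assoc int_pow_mult[symmetric])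
    then show ?thesis using u c w by (simp add: L(3) sp' act_mult)
  qed
  ultimately show ?thesis using u c w unfolding holonomy_def by auto
qed

text \<open>Over a path of points, the chosen paths form a homotopy on the unit square. A lift of it compares the
  second moments along the top edge and along the bottom edge, each by a single translation.\<close>
lemma holonomy_constant:
  assumes w: "w \<in> carrier F"
    and \<sigma>: "continuous_map (subtopology E U) (fibrewise_path_space E proj (sect w)) \<sigma>" "\<And>x. x \<in> U \<Longrightarrow> \<sigma> x 1 = x"
    and gs: "set gs \<subseteq> carrier Pi" and W: "continuous_map (top_of_set {0..1::real}) (simplex_top (length gs)) W"
    and U: "\<And>s. s \<in> {0..1} \<Longrightarrow> bar_class Pi gs (W s) \<in> U"
  obtains c where "\<And>s. s \<in> {0..1} \<Longrightarrow> holonomy w \<sigma> gs (W s) c"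
proof -
  let ?g = "\<lambda>s. bar_class Pi gs (W s)"
  have gl: "gs \<in> lists (carrier Pi)" using gs by (simp add: lists_iff)
  have cell: "(gs, W s) \<in> bar_cells Pi" if "s \<in> {0..1}" for s
    using W gs that by (auto simp: Pi.bar_cells_iff continuous_map_def)
  have g: "continuous_map (top_of_set {0..1}) E ?g" "?g ` {0..1} \<subseteq> U"
    using continuous_map_compose[OF W continuous_map_bar_class[OF gl]] U by (auto simp: comp_def)
  define H where "H z = \<sigma> (?g (fst z)) (snd z)" for z
  have "continuous_map (top_of_set unit_square) E H"
    unfolding H_def by (rule continuous_section_evaluation[OF \<sigma>(1) g])
  then obtain L where L: "covering_lift unit_square H L" by (rule covering_lift_square)
  have start: "\<sigma> (?g s) 0 = bar_class Pi (base_word w gs) (W s)" if s: "s \<in> {0..1}" for s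
  proof -
    have "?g s \<in> topspace (subtopology E U)" using cell[OF s] U[OF s] in_E_iff by auto
    then have "\<sigma> (?g s) \<in> topspace (fibrewise_path_space E proj (sect w))"
      using \<sigma>(1) by (auto simp: continuous_map_def)
    then have *: "\<forall>t\<in>{0..1}. proj (\<sigma> (?g s) t) = proj (\<sigma> (?g s) 0)" "\<sigma> (?g s) 0 = sect w (proj (\<sigma> (?g s) 0))"
      unfolding fibrewise_path_space_def topspace_subtopology Int_iff mem_Collect_eq by blast+
    have "proj (\<sigma> (?g s) 0) = proj (?g s)" using *(1) \<sigma>(2)[OF U[OF s]] by (metis atLeastAtMost_iff order_refl zero_le_one)
    then show ?thesis using *(2) sect_proj_class[OF w] by simp
  qed
  have pair: "continuous_on {0..1} (\<lambda>s. (s, \<tau>))" "(\<lambda>s. (s, \<tau>)) ` {0..1} \<subseteq> unit_square" if "\<tau> \<in> {0..1}" for \<tau> :: real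
    using that by (auto intro!: continuous_intros)
  have "covering_lift {0..1} (\<lambda>s. H (s, 1)) (\<lambda>s. L (s, 1))"
    by (rule covering_lift_compose[OF L pair]) simp_all
  then have top: "covering_lift {0..1} ?g (\<lambda>s. L (s, 1))"
    by (rule covering_lift_cong) (simp_all add: H_def \<sigma>(2) U)
  obtain u where u: "u \<in> carrier F" "\<And>s. s \<in> {0..1} \<Longrightarrow> spread gs (W s) = act u (L (s, 1))"
    using covering_lift_unique[OF top covering_lift_cell[OF gs W] connected_Icc] by blast
  define M where "M z = act u (L z)" for z
  have M: "covering_lift unit_square H M"
    unfolding M_def by (rule covering_lift_act[OF L u(1)])
  have "covering_lift {0..1} (\<lambda>s. H (s, 0)) (\<lambda>s. M (s, 0))"
    by (rule covering_lift_compose[OF M pair]) simp_all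
  then have bottom: "covering_lift {0..1} (\<lambda>s. bar_class Pi (base_word w gs) (W s)) (\<lambda>s. M (s, 0))"
    by (rule covering_lift_cong) (simp_all add: H_def start)
  have base: "covering_lift {0..1} (\<lambda>s. bar_class Pi (base_word w gs) (W s)) (\<lambda>s. spread (base_word w gs) (W s))"
    using W by (intro covering_lift_cell base_word_closed w) simp
  obtain c where c: "c \<in> carrier F" "\<And>s. s \<in> {0..1} \<Longrightarrow> M (s, 0) = act c (spread (base_word w gs) (W s))"
    using covering_lift_unique[OF base bottom connected_Icc] by blast
  show thesis
  proof (rule that[of c])
    fix s :: real assume s: "s \<in> {0..1}"
    have "continuous_on {0..1} (Pair s)" "Pair s ` {0..1} \<subseteq> unit_square"
      using s by (auto intro!: continuous_intros)
    then have "covering_lift {0..1} (\<lambda>\<tau>. H (s, \<tau>)) (\<lambda>\<tau>. M (s, \<tau>))"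
      by (rule covering_lift_compose[OF M])
    then have "covering_lift {0..1} (\<sigma> (?g s)) (\<lambda>\<tau>. M (s, \<tau>))"
      by (rule covering_lift_cong) (simp_all add: H_def)
    then show "holonomy w \<sigma> gs (W s) c"
      unfolding holonomy_def using c s u(2)[OF s] by (auto simp: M_def[of "(s, 1)"])
  qed
qed

end

section \<open>Two open sets do not suffice\<close>

text \<open>The integer points \<open>(P i j, Q i j)\<close> define a map of a triangulated torus to the standard torus that has
  degree one: by the boundary conditions the signed areas of the image triangles add up to 1. If every
  triangle has two vertices with the same image, all these areas vanish. Here \<open>h\<close> and \<open>v\<close> are twice
  the areas swept by the horizontal and vertical edges.\<close>
lemma no_degenerate_grid:
  fixes P Q :: "nat \<Rightarrow> nat \<Rightarrow> int"
  assumes x: "\<And>j. j \<le> N \<Longrightarrow> P N j = P 0 j + 1" "\<And>j. j \<le> N \<Longrightarrow> Q N j = Q 0 j"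
    and y: "\<And>i. i \<le> N \<Longrightarrow> P i N = P i 0" "\<And>i. i \<le> N \<Longrightarrow> Q i N = Q i 0 + 1"
    and lower: "\<And>i j. i < N \<Longrightarrow> j < N \<Longrightarrow>
      card {(P i j, Q i j), (P (Suc i) j, Q (Suc i) j), (P (Suc i) (Suc j), Q (Suc i) (Suc j))} \<le> 2"
    and upper: "\<And>i j. i < N \<Longrightarrow> j < N \<Longrightarrow>
      card {(P i j, Q i j), (P i (Suc j), Q i (Suc j)), (P (Suc i) (Suc j), Q (Suc i) (Suc j))} \<le> 2"
  shows False
proof -
  define h where "h i j = P i j * Q (Suc i) j - Q i j * P (Suc i) j" for i j
  define v where "v i j = P i j * Q i (Suc j) - Q i j * P i (Suc j)" for i j
  have degenerate: "a * d - b * c + (c * f - d * e) + (e * b - f * a) = 0"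
    if "card {(a, b), (c, d), (e, f)} \<le> 2" for a b c d e f :: int
  proof -
    have "(a, b) = (c, d) \<or> (c, d) = (e, f) \<or> (a, b) = (e, f)"
      using that by (auto simp: card_insert_if split: if_splits)
    then show ?thesis by (auto simp: algebra_simps)
  qed
  have square: "h i j - h i (Suc j) + (v (Suc i) j - v i j) = 0" if "i < N" "j < N" for i j
    using degenerate[OF lower[OF that]] degenerate[OF upper[OF that]]
    by (simp add: h_def v_def algebra_simps)
  have "0 = (\<Sum>i<N. \<Sum>j<N. h i j - h i (Suc j) + (v (Suc i) j - v i j))"
    using square by simp
  also have "\<dots> = (\<Sum>i<N. \<Sum>j<N. h i j - h i (Suc j)) + (\<Sum>i<N. \<Sum>j<N. v (Suc i) j - v i j)"
    by (simp add: sum.distrib)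
  also have "(\<Sum>i<N. \<Sum>j<N. h i j - h i (Suc j)) = (\<Sum>i<N. P (Suc i) 0 - P i 0)"
  proof (intro sum.cong refl)
    fix i assume "i \<in> {..<N}"
    then have "h i 0 - h i N = P (Suc i) 0 - P i 0"
      using y[of i] y[of "Suc i"] by (simp add: h_def algebra_simps)
    then show "(\<Sum>j<N. h i j - h i (Suc j)) = P (Suc i) 0 - P i 0"
      by (simp only: sum_lessThan_telescope')
  qed
  also have "\<dots> = 1" using x(1)[of 0] sum_lessThan_telescope[of "\<lambda>i. P i 0" N] by simp
  also have "(\<Sum>i<N. \<Sum>j<N. v (Suc i) j - v i j) = (\<Sum>j<N. \<Sum>i<N. v (Suc i) j - v i j)"
    by (rule sum.swap)
  also have "\<dots> = (\<Sum>j<N. Q 0 (Suc j) - Q 0 j)"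
  proof (intro sum.cong refl)
    fix j assume "j \<in> {..<N}"
    then have "v N j - v 0 j = Q 0 (Suc j) - Q 0 j"
      using x[of j] x[of "Suc j"] by (simp add: v_def algebra_simps)
    then show "(\<Sum>i<N. v (Suc i) j - v i j) = Q 0 (Suc j) - Q 0 j"
      using sum_lessThan_telescope[of "\<lambda>i. v i j" N] by simp
  qed
  also have "\<dots> = 1" using y(2)[of 0] sum_lessThan_telescope[of "\<lambda>j. Q 0 j" N] by simp
  finally show False by simp
qed

context finite_rank_free_group
begin

text \<open>The action \<open>c \<mapsto> v\<^sup>n c w\<^sup>-\<^sup>m\<close> of pairs of integers is free, so its orbits are copies of the lattice of such
  pairs. The origin of each copy is chosen arbitrarily.\<close>
lemma equivariant_coordinates:
  assumes v: "v \<in> carrier F" and w: "w \<in> carrier F"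
    and free: "\<forall>c\<in>carrier F. \<forall>(n :: int) m :: int. v [^]\<^bsub>F\<^esub> n \<otimes>\<^bsub>F\<^esub> c = c \<otimes>\<^bsub>F\<^esub> w [^]\<^bsub>F\<^esub> m \<longrightarrow> n = 0 \<and> m = 0"
  obtains \<kappa> \<mu> :: "'a letter list \<Rightarrow> int"
  where "\<And>c. c \<in> carrier F \<Longrightarrow> \<kappa> (v \<otimes>\<^bsub>F\<^esub> c) = \<kappa> c + 1 \<and> \<mu> (v \<otimes>\<^bsub>F\<^esub> c) = \<mu> c"
    and "\<And>c. c \<in> carrier F \<Longrightarrow> \<kappa> (c \<otimes>\<^bsub>F\<^esub> inv\<^bsub>F\<^esub> w) = \<kappa> c \<and> \<mu> (c \<otimes>\<^bsub>F\<^esub> inv\<^bsub>F\<^esub> w) = \<mu> c + 1"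
proof -
  define T where "T n m c = v [^]\<^bsub>F\<^esub> n \<otimes>\<^bsub>F\<^esub> c \<otimes>\<^bsub>F\<^esub> w [^]\<^bsub>F\<^esub> (- m)" for n m :: int and c
  have T_closed: "T n m c \<in> carrier F" if "c \<in> carrier F" for n m c using that v w by (simp add: T_def)
  have T_add: "T n m (T n' m' c) = T (n + n') (m + m') c" if "c \<in> carrier F" for n m n' m' c
  proof -
    have "w [^]\<^bsub>F\<^esub> (- m') \<otimes>\<^bsub>F\<^esub> w [^]\<^bsub>F\<^esub> (- m) = w [^]\<^bsub>F\<^esub> (- (m + m'))"
      using w by (simp add: int_pow_mult[symmetric] algebra_simps)
    then show ?thesis using that v w by (simp add: T_def m_assoc int_pow_mult)
  qed
  have T_free: "n = n' \<and> m = m'" if c: "c \<in> carrier F" and eq: "T n m c = T n' m' c" for n m n' m' c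
  proof -
    have "T (- n' + n) (- m' + m) c = c"
      using T_add[OF c, of "- n'" "- m'" n m] T_add[OF c, of "- n'" "- m'" n' m'] eq c by (simp add: T_def)
    then have "v [^]\<^bsub>F\<^esub> (n - n') \<otimes>\<^bsub>F\<^esub> c \<otimes>\<^bsub>F\<^esub> w [^]\<^bsub>F\<^esub> (m' - m) \<otimes>\<^bsub>F\<^esub> w [^]\<^bsub>F\<^esub> (m - m') = c \<otimes>\<^bsub>F\<^esub> w [^]\<^bsub>F\<^esub> (m - m')"
      by (simp add: T_def add.commute)
    then have "v [^]\<^bsub>F\<^esub> (n - n') \<otimes>\<^bsub>F\<^esub> c = c \<otimes>\<^bsub>F\<^esub> w [^]\<^bsub>F\<^esub> (m - m')"
      using c v w by (simp add: m_assoc int_pow_mult[symmetric])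
    from free[rule_format, OF c this] show ?thesis by simp
  qed
  define orbit where "orbit c = {T n m c | n m. True}" for c
  define rep where "rep c = (SOME c0. c0 \<in> orbit c)" for c
  have orbit_T: "orbit (T n m c) = orbit c" if "c \<in> carrier F" for n m c
  proof (intro equalityI subsetI)
    fix d assume "d \<in> orbit (T n m c)"
    then show "d \<in> orbit c" using T_add[OF that] by (auto simp: orbit_def)
  next
    fix d assume "d \<in> orbit c"
    then obtain n' m' where "d = T n' m' c" by (auto simp: orbit_def)
    then have "d = T (n' - n) (m' - m) (T n m c)" using T_add[OF that] by simp
    then show "d \<in> orbit (T n m c)" by (auto simp: orbit_def)
  qed
  have rep: "rep c \<in> carrier F \<and> (\<exists>n m. c = T n m (rep c))" if c: "c \<in> carrier F" for c
  proof -
    have "c = T 0 0 c" using c by (simp add: T_def)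
    then have "\<exists>c0. c0 \<in> orbit c" by (auto simp: orbit_def)
    then have "rep c \<in> orbit c" unfolding rep_def by (rule someI_ex)
    then obtain n m where "rep c = T n m c" by (auto simp: orbit_def)
    moreover have "T (- n) (- m) (T n m c) = c" using T_add[OF c, of "- n" "- m" n m] \<open>c = T 0 0 c\<close> by simp
    ultimately show ?thesis using T_closed[OF c] by metis
  qed
  define coord where "coord c = (SOME (n, m). c = T n m (rep c))" for c
  have coord: "coord c = (n, m)" if c: "c \<in> carrier F" and "c = T n m (rep c)" for c n m
  proof -
    have "\<exists>p. case p of (n, m) \<Rightarrow> c = T n m (rep c)" using that by auto
    from someI_ex[OF this] obtain n' m' where nm: "coord c = (n', m')" "c = T n' m' (rep c)"
      by (auto simp: coord_def)
    then show ?thesis using T_free[of "rep c" n m n' m'] rep[OF c] that(2) by simp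
  qed
  have shift: "coord (T n m c) = (fst (coord c) + n, snd (coord c) + m)" if c: "c \<in> carrier F" for n m c
  proof -
    obtain n' m' where nm: "c = T n' m' (rep c)" "rep c \<in> carrier F" using rep[OF c] by blast
    have "rep (T n m c) = rep c" by (simp add: rep_def orbit_T[OF c])
    then have "T n m c = T (n + n') (m + m') (rep (T n m c))" using T_add[OF nm(2), of n m n' m'] nm(1) by simp
    then have "coord (T n m c) = (n + n', m + m')" by (rule coord[OF T_closed[OF c]])
    moreover have "coord c = (n', m')" by (rule coord[OF c nm(1)])
    ultimately show ?thesis by simp
  qed
  have 1: "T 1 0 c = v \<otimes>\<^bsub>F\<^esub> c" "T 0 1 c = c \<otimes>\<^bsub>F\<^esub> inv\<^bsub>F\<^esub> w" if "c \<in> carrier F" for c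
    using that v w by (simp_all add: T_def int_pow_neg)
  show thesis
    by (rule that[of "\<lambda>c. fst (coord c)" "\<lambda>c. snd (coord c)"]) (simp_all add: shift flip: 1)
qed

lemma exponent_hom:
  obtains h where "h \<in> hom F integer_group" "\<And>x. x \<in> X \<Longrightarrow> h [(x, True)] = (if x = a then 1 else 0)"
  using free_group_universal(1)[OF group_Z, of "\<lambda>x. if x = a then 1 else 0" X] by auto

lemma int_pow_eq_one:
  assumes w: "w \<in> carrier F" "w \<noteq> \<one>\<^bsub>F\<^esub>" and eq: "w [^]\<^bsub>F\<^esub> (m :: int) = \<one>\<^bsub>F\<^esub>"
  shows "m = 0"
proof (rule ccontr)
  assume "m \<noteq> 0"
  have "w [^]\<^bsub>F\<^esub> (nat \<bar>m\<bar>) = \<one>\<^bsub>F\<^esub>"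
  proof (cases "0 \<le> m")
    case True
    then show ?thesis using eq w by (simp add: int_pow_int[symmetric] del: int_pow_int)
  next
    case False
    then have "w [^]\<^bsub>F\<^esub> (- m) = \<one>\<^bsub>F\<^esub>" using eq w by (simp add: int_pow_neg)
    then show ?thesis using False by (simp add: int_pow_int[symmetric] del: int_pow_int)
  qed
  then show False using torsion_free[OF w(1), of "nat \<bar>m\<bar>"] w(2) \<open>m \<noteq> 0\<close> by simp
qed

text \<open>The exponent sum of a second generator \<open>b\<close> decides. If it vanishes on \<open>w\<close>, then no nontrivial power of
  \<open>b\<close> is conjugate to a power of \<open>w\<close>; if it does not vanish on \<open>w\<close>, the same is true for \<open>a\<close>, on which it
  vanishes.\<close>
lemma independent_generator:
  assumes w: "w \<in> carrier F" "w \<noteq> \<one>\<^bsub>F\<^esub>" and ab: "a \<in> X" "b \<in> X" "a \<noteq> b"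
  obtains v where "v \<in> carrier F"
    "\<forall>c\<in>carrier F. \<forall>(n :: int) m :: int. v [^]\<^bsub>F\<^esub> n \<otimes>\<^bsub>F\<^esub> c = c \<otimes>\<^bsub>F\<^esub> w [^]\<^bsub>F\<^esub> m \<longrightarrow> n = 0 \<and> m = 0"
proof -
  obtain h where h: "h \<in> hom F integer_group" "\<And>x. x \<in> X \<Longrightarrow> h [(x, True)] = (if x = b then 1 else 0)"
    using exponent_hom[of b] by blast
  interpret h: group_hom F integer_group h
    using h(1) by (simp add: group_hom_def group_hom_axioms_def is_group)
  have gen: "[(x, True)] \<in> carrier F" "[(x, True)] \<noteq> \<one>\<^bsub>F\<^esub>" if "x \<in> X" for x
    using that by (auto simp: one_eq)
  have pow: "h (u [^]\<^bsub>F\<^esub> n) = n * h u" if "u \<in> carrier F" for u and n :: int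
    using h.hom_int_pow[OF that, of n] by simp
  have eq: "n * h v = m * h w"
    if "v \<in> carrier F" "c \<in> carrier F" "v [^]\<^bsub>F\<^esub> n \<otimes>\<^bsub>F\<^esub> c = c \<otimes>\<^bsub>F\<^esub> w [^]\<^bsub>F\<^esub> m" for v c and n m :: int
    using arg_cong[OF that(3), of h] that(1,2) w(1) by (simp add: pow)
  show thesis
  proof (cases "h w = 0")
    case True
    show thesis
    proof (rule that[of "[(b, True)]"])
      have "n = 0 \<and> m = 0" if c: "c \<in> carrier F" and *: "[(b, True)] [^]\<^bsub>F\<^esub> n \<otimes>\<^bsub>F\<^esub> c = c \<otimes>\<^bsub>F\<^esub> w [^]\<^bsub>F\<^esub> m" for n m :: int and c
      proof -
        have n: "n = 0" using eq[OF gen(1)[OF ab(2)] c *] True h(2)[OF ab(2)] by simp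
        then have "w [^]\<^bsub>F\<^esub> m = \<one>\<^bsub>F\<^esub>" using * c w by simp
        with n int_pow_eq_one[OF w] show ?thesis by simp
      qed
      then show "\<forall>c\<in>carrier F. \<forall>(n :: int) m :: int. [(b, True)] [^]\<^bsub>F\<^esub> n \<otimes>\<^bsub>F\<^esub> c = c \<otimes>\<^bsub>F\<^esub> w [^]\<^bsub>F\<^esub> m \<longrightarrow> n = 0 \<and> m = 0"
        by blast
    qed (rule gen(1)[OF ab(2)])
  next
    case False
    show thesis
    proof (rule that[of "[(a, True)]"])
      have "n = 0 \<and> m = 0" if c: "c \<in> carrier F" and *: "[(a, True)] [^]\<^bsub>F\<^esub> n \<otimes>\<^bsub>F\<^esub> c = c \<otimes>\<^bsub>F\<^esub> w [^]\<^bsub>F\<^esub> m" for n m :: int and c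
      proof -
        have m: "m = 0" using eq[OF gen(1)[OF ab(1)] c *] False h(2)[OF ab(1)] ab(3) by simp
        then have "[(a, True)] [^]\<^bsub>F\<^esub> n = \<one>\<^bsub>F\<^esub>" using * c gen(1)[OF ab(1)] by simp
        with m int_pow_eq_one[OF gen[OF ab(1)]] show ?thesis by simp
      qed
      then show "\<forall>c\<in>carrier F. \<forall>(n :: int) m :: int. [(a, True)] [^]\<^bsub>F\<^esub> n \<otimes>\<^bsub>F\<^esub> c = c \<otimes>\<^bsub>F\<^esub> w [^]\<^bsub>F\<^esub> m \<longrightarrow> n = 0 \<and> m = 0"
        by blast
    qed (rule gen(1)[OF ab(1)])
  qed
qed

text \<open>The commuting elements \<open>(v, 0)\<close> and \<open>(\<one>, 1)\<close> define a torus in the classifying space. At the point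
  \<open>(x, y)\<close> of the unit square its step function is \<open>r \<mapsto> (v\<^sup>i, j)\<close>, where \<open>i\<close> is 1 for \<open>r \<ge> 1 - x\<close> and 0
  otherwise, and \<open>j\<close> is 1 for \<open>r \<ge> 1 - y\<close> and 0 otherwise. The word passes through the vertices \<open>(\<one>, 0)\<close>,
  \<open>(v, 0)\<close>, \<open>(\<one>, 1)\<close>, \<open>(v, 1)\<close>; giving one of the two in the middle the weight zero serves both triangles
  of the square at once.\<close>
definition torus_word :: "'a letter list \<Rightarrow> ('a letter list \<times> int) list" where
  "torus_word v = [(v, 0), (inv\<^bsub>F\<^esub> v, 1), (v, 0)]"

definition torus_weights :: "real \<times> real \<Rightarrow> nat \<Rightarrow> real" where
  "torus_weights z k = (if k = 0 then 1 - max (fst z) (snd z) else if k = 1 then max (fst z - snd z) 0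
     else if k = 2 then max (snd z - fst z) 0 else if k = 3 then min (fst z) (snd z) else 0)"

lemma torus_word_closed: "v \<in> carrier F \<Longrightarrow> set (torus_word v) \<subseteq> carrier Pi"
  by (simp add: torus_word_def Pi_carrier)

lemma length_torus_word [simp]: "length (torus_word v) = 3"
  by (simp add: torus_word_def)

lemma torus_weights_simplex:
  assumes "z \<in> unit_square" shows "torus_weights z \<in> standard_simplex 3"
proof (rule simplexI)
  show "sum (torus_weights z) {..3} = 1"
    by (simp add: numeral_3_eq_3 torus_weights_def max_def min_def)
qed (use assms in \<open>auto simp: torus_weights_def\<close>)

lemma torus_cell: "v \<in> carrier F \<Longrightarrow> z \<in> unit_square \<Longrightarrow> (torus_word v, torus_weights z) \<in> bar_cells Pi"
  using torus_word_closed torus_weights_simplex by (simp add: Pi.bar_cells_iff)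

lemma torus_vertices:
  assumes v: "v \<in> carrier F"
  shows "vertex Pi (torus_word v) 0 = (\<one>\<^bsub>F\<^esub>, 0)" "vertex Pi (torus_word v) 1 = (v, 0)"
    "vertex Pi (torus_word v) 2 = (\<one>\<^bsub>F\<^esub>, 1)" "vertex Pi (torus_word v) 3 = (v, 1)"
  using v by (simp_all add: vertex_def torus_word_def Pi_mult Pi_one numeral_2_eq_2 numeral_3_eq_3)

lemma translated_torus_x:
  assumes v: "v \<in> carrier F" and y: "y \<in> {0..1}"
  shows "translated v 0 (torus_word v) (torus_weights (0, y)) (torus_word v) (torus_weights (1, y))"
proof (rule translatedI)
  fix r :: real assume r: "0 \<le> r" "r < 1"
  have 0: "piece (torus_weights (0, y)) r = (if r < 1 - y then 0 else 2)"
    using y r by (intro piece_eqI[OF torus_weights_simplex])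
      (auto simp: cumulative_Suc torus_weights_def numeral_2_eq_2)
  have 1: "piece (torus_weights (1, y)) r = (if r < 1 - y then 1 else 3)"
    using y r by (intro piece_eqI[OF torus_weights_simplex])
      (auto simp: cumulative_Suc torus_weights_def numeral_2_eq_2 numeral_3_eq_3)
  show "step Pi (torus_word v) (torus_weights (1, y)) r = (v, 0) \<otimes>\<^bsub>Pi\<^esub> step Pi (torus_word v) (torus_weights (0, y)) r"
    using v by (simp add: step_def 0 1 torus_vertices Pi_mult Pi_one del: One_nat_def)
qed (use v y in \<open>auto intro!: torus_cell\<close>)

lemma translated_torus_y:
  assumes v: "v \<in> carrier F" and x: "x \<in> {0..1}"
  shows "translated \<one>\<^bsub>F\<^esub> 1 (torus_word v) (torus_weights (x, 0)) (torus_word v) (torus_weights (x, 1))"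
proof (rule translatedI)
  fix r :: real assume r: "0 \<le> r" "r < 1"
  have 0: "piece (torus_weights (x, 0)) r = (if r < 1 - x then 0 else 1)"
    using x r by (intro piece_eqI[OF torus_weights_simplex])
      (auto simp: cumulative_Suc torus_weights_def)
  have 1: "piece (torus_weights (x, 1)) r = (if r < 1 - x then 2 else 3)"
    using x r by (intro piece_eqI[OF torus_weights_simplex])
      (auto simp: cumulative_Suc torus_weights_def numeral_2_eq_2 numeral_3_eq_3)
  show "step Pi (torus_word v) (torus_weights (x, 1)) r = (\<one>\<^bsub>F\<^esub>, 1) \<otimes>\<^bsub>Pi\<^esub> step Pi (torus_word v) (torus_weights (x, 0)) r"
    using v by (simp add: step_def 0 1 torus_vertices Pi_mult Pi_one del: One_nat_def)
qed (use v x in \<open>auto intro!: torus_cell\<close>)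

lemma continuous_torus_weights: "continuous_map (top_of_set unit_square) (simplex_top 3) torus_weights"
proof (rule continuous_map_into_simplex)
  fix k
  have "continuous_on unit_square (\<lambda>z. torus_weights z k)"
    unfolding torus_weights_def
    by (cases "k = 0"; cases "k = 1"; cases "k = 2"; cases "k = 3") (auto intro!: continuous_intros)
  then show "continuous_map (top_of_set unit_square) euclideanreal (\<lambda>z. torus_weights z k)" by simp
qed (simp add: torus_weights_simplex)

text \<open>Over the torus, the holonomies of the two sections have values in the group, on which pairs of integers
  act by \<open>c \<mapsto> v\<^sup>n c w\<^sup>-\<^sup>m\<close>. With a generator \<open>v\<close> independent of \<open>w\<close> this action is free, and its lattice
  coordinates turn the holonomies into points of the plane. On a fine grid each cell lies in one of the two
  sets and gets one point. In a triangle of three cells around a common corner, two cells belong to the same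
  set and thus have the same point. This is what \<open>no_degenerate_grid\<close> excludes.\<close>
theorem no_two_set_cover:
  fixes U :: "nat \<Rightarrow> ('a letter list \<times> int) bar_point set"
  assumes w: "w \<in> carrier F" "w \<noteq> \<one>\<^bsub>F\<^esub>" and ab: "a \<in> X" "b \<in> X" "a \<noteq> b"
    and U: "\<And>l. l \<le> 1 \<Longrightarrow> openin E (U l)" "(\<Union>l\<le>1. U l) = topspace E"
    and sec: "\<And>l. l \<le> 1 \<Longrightarrow> \<exists>\<sigma>. continuous_map (subtopology E (U l)) (fibrewise_path_space E proj (sect w)) \<sigma> \<and>
       (\<forall>x\<in>U l. \<sigma> x 1 = x)"
  shows False
proof -
  obtain v where v: "v \<in> carrier F" and free: "\<forall>c\<in>carrier F. \<forall>(n :: int) m :: int. v [^]\<^bsub>F\<^esub> n \<otimes>\<^bsub>F\<^esub> c = c \<otimes>\<^bsub>F\<^esub> w [^]\<^bsub>F\<^esub> m \<longrightarrow> n = 0 \<and> m = 0"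
    using independent_generator[OF w ab] by blast
  obtain \<kappa> \<mu> :: "'a letter list \<Rightarrow> int" where
    km_v: "\<And>c. c \<in> carrier F \<Longrightarrow> \<kappa> (v \<otimes>\<^bsub>F\<^esub> c) = \<kappa> c + 1 \<and> \<mu> (v \<otimes>\<^bsub>F\<^esub> c) = \<mu> c" and
    km_w: "\<And>c. c \<in> carrier F \<Longrightarrow> \<kappa> (c \<otimes>\<^bsub>F\<^esub> inv\<^bsub>F\<^esub> w) = \<kappa> c \<and> \<mu> (c \<otimes>\<^bsub>F\<^esub> inv\<^bsub>F\<^esub> w) = \<mu> c + 1"
    using equivariant_coordinates[OF v w(1) free] by blast
  obtain \<sigma> where \<sigma>: "\<And>l. l \<le> 1 \<Longrightarrow> continuous_map (subtopology E (U l)) (fibrewise_path_space E proj (sect w)) (\<sigma> l)"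
      "\<And>l x. l \<le> 1 \<Longrightarrow> x \<in> U l \<Longrightarrow> \<sigma> l x 1 = x"
    using sec by metis
  let ?g = "\<lambda>z. bar_class Pi (torus_word v) (torus_weights z)"
  have lists: "torus_word v \<in> lists (carrier Pi)" using torus_word_closed[OF v] by (simp only: lists_iff)
  have W: "continuous_map (top_of_set unit_square) (simplex_top (length (torus_word v))) torus_weights"
    using continuous_torus_weights by simp
  have g: "continuous_map (top_of_set unit_square) E ?g"
    using continuous_map_compose[OF W continuous_map_bar_class[OF lists]] by (simp add: comp_def)
  define hol where "hol l z c \<longleftrightarrow> holonomy w (\<sigma> l) (torus_word v) (torus_weights z) c" for l z c
  have convex: "\<exists>c. hol l z c \<and> hol l z' c"
    if l: "l \<le> 1" and S: "S \<subseteq> unit_square" "convex S" "?g ` S \<subseteq> U l" and z: "z \<in> S" "z' \<in> S" for l S z z'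
  proof -
    define p where "p s = (1 - s) *\<^sub>R z + s *\<^sub>R z'" for s :: real
    have p: "p s \<in> S" if "s \<in> {0..1}" for s
      using that z S(2) by (auto simp: p_def convex_alt)
    have "continuous_map (top_of_set {0..1}) (top_of_set unit_square) p"
      using p S(1) by (auto simp: continuous_map_in_subtopology p_def intro!: continuous_intros)
    from continuous_map_compose[OF this W]
    have Wp: "continuous_map (top_of_set {0..1}) (simplex_top (length (torus_word v))) (\<lambda>s. torus_weights (p s))"
      by (simp add: comp_def)
    obtain c where c: "\<And>s. s \<in> {0..1} \<Longrightarrow> holonomy w (\<sigma> l) (torus_word v) (torus_weights (p s)) c"
      by (rule holonomy_constant[OF w(1) \<sigma>(1)[OF l] \<sigma>(2)[OF l] torus_word_closed[OF v] Wp])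
        (use p S(3) in blast)+
    have "p 0 = z" "p 1 = z'" by (simp_all add: p_def)
    then show ?thesis using c[of 0] c[of 1] by (auto simp: hol_def)
  qed
  have unique: "c = c'" if "z \<in> unit_square" "hol l z c" "hol l z c'" for l z c c'
    using that unfolding hol_def by (intro holonomy_unique[OF w(1) torus_cell[OF v]])
  have closed: "c \<in> carrier F" if "hol l z c" for l z c using that by (simp add: hol_def holonomy_def)
  have hol_x: "hol l (1, y) (v \<otimes>\<^bsub>F\<^esub> c)" if "hol l (0, y) c" "y \<in> {0..1}" for l y c
    using holonomy_translated[OF w(1) translated_torus_x[OF v that(2)], of "\<sigma> l" c] that closed[OF that(1)] v
    by (simp add: hol_def)
  have hol_y: "hol l (x, 1) (c \<otimes>\<^bsub>F\<^esub> inv\<^bsub>F\<^esub> w)" if "hol l (x, 0) c" "x \<in> {0..1}" for l x c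
    using holonomy_translated[OF w(1) translated_torus_y[OF v that(2)], of "\<sigma> l" c] that closed[OF that(1)] w(1)
    by (simp add: hol_def int_pow_neg)
  define V where "V l = {z \<in> topspace (top_of_set unit_square). ?g z \<in> U l}" for l
  have V: "openin (top_of_set unit_square) (V l)" if "l \<le> 1" for l
    unfolding V_def by (rule openin_continuous_map_preimage[OF g U(1)[OF that]])
  have local: "\<exists>N\<in>V ` {..1}. openin (top_of_set unit_square) N \<and> z \<in> N" if z: "z \<in> unit_square" for z
  proof -
    have "?g z \<in> topspace E" using g z unfolding continuous_map_def by auto
    then obtain l where "l \<le> 1" "?g z \<in> U l" using U(2) by blast
    then show ?thesis using V z by (auto simp: V_def)
  qed
  obtain N where N: "0 < N" "\<And>i j. i < N \<Longrightarrow> j < N \<Longrightarrow> \<exists>M\<in>V ` {..1}. grid_cell N i j \<subseteq> M"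
    using unit_square_grid[OF local] by blast
  define ch where "ch i j = (SOME l :: nat. l \<le> 1 \<and> grid_cell N i j \<subseteq> V l)" for i j
  have ch: "ch i j \<le> 1 \<and> grid_cell N i j \<subseteq> V (ch i j)" if ij: "i < N" "j < N" for i j
  proof -
    obtain l where "l \<le> 1" "grid_cell N i j \<subseteq> V l" using N(2)[OF ij] by auto
    then have "\<exists>l :: nat. l \<le> 1 \<and> grid_cell N i j \<subseteq> V l" by blast
    from someI_ex[OF this] show ?thesis by (simp only: ch_def)
  qed
  \<comment> \<open>Indices are taken modulo the grid size, so that opposite sides of the square use the same
    section, although holonomies there are not equal but related by translation.\<close>
  define lab where "lab i j = ch (i mod N) (j mod N)" for i j
  define pt where "pt i j = (real i / N, real j / N)" for i j
  have pt: "pt i j \<in> unit_square" if "i \<le> N" "j \<le> N" for i j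
    using that N(1) by (auto simp: pt_def divide_le_eq_1)
  have lab: "lab i j \<le> 1" for i j using ch N(1) by (simp add: lab_def)
  have cell: "\<exists>c. hol (lab i j) (pt i j) c \<and> hol (lab i j) (pt (i + di) (j + dj)) c"
    if "i < N" "j < N" "di \<le> 1" "dj \<le> 1" for i j di dj
  proof (rule convex[OF lab])
    show "grid_cell N i j \<subseteq> unit_square" by (rule grid_cell_subset[OF that(1,2)])
    show "convex (grid_cell N i j)" unfolding grid_cell_def by (intro convex_Times convex_real_interval)
    show "?g ` grid_cell N i j \<subseteq> U (lab i j)" using ch[OF that(1,2)] that by (auto simp: lab_def V_def)
    show "pt i j \<in> grid_cell N i j" "pt (i + di) (j + dj) \<in> grid_cell N i j"
      using that by (auto simp: grid_cell_def pt_def divide_right_mono)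
  qed
  \<comment> \<open>The cell with lower left corner \<open>pt i j\<close> has the same holonomy at its four corners. For \<open>i = N\<close> or
    \<open>j = N\<close> the cell lies on the opposite side of the square and its values are carried over by
    \<open>hol_x\<close> and \<open>hol_y\<close>.\<close>
  have edge: "\<exists>c. hol (lab i j) (pt i j) c \<and> hol (lab i j) (pt (i + di) (j + dj)) c"
    if ij: "i \<le> N" "j \<le> N" "di \<le> 1" "dj \<le> 1" "i + di \<le> N" "j + dj \<le> N" for i j di dj
  proof -
    have y: "\<exists>c. hol (lab i j) (pt i j) c \<and> hol (lab i j) (pt (i + di) (j + dj)) c"
      if p: "i < N" "j \<le> N" "di \<le> 1" "dj \<le> 1" "i + di \<le> N" "j + dj \<le> N" for i j di dj
    proof (cases "j < N")
      case False
      then have j: "j = N" "dj = 0" using p by auto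
      obtain c where c: "hol (lab i 0) (pt i 0) c" "hol (lab i 0) (pt (i + di) 0) c"
        using cell[of i 0 di 0] p N(1) by auto
      have "hol (lab i j) (pt i j) (c \<otimes>\<^bsub>F\<^esub> inv\<^bsub>F\<^esub> w)" "hol (lab i j) (pt (i + di) (j + dj)) (c \<otimes>\<^bsub>F\<^esub> inv\<^bsub>F\<^esub> w)"
        using hol_y[of "lab i 0" "real i / N" c] hol_y[of "lab i 0" "real (i + di) / N" c] c p N(1)
        by (simp_all add: pt_def j lab_def del: of_nat_add)
      then show ?thesis by blast
    qed (use cell p in blast)
    show ?thesis
    proof (cases "i < N")
      case False
      then have i: "i = N" "di = 0" using ij by auto
      obtain c where c: "hol (lab 0 j) (pt 0 j) c" "hol (lab 0 j) (pt 0 (j + dj)) c"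
        using y[of 0 j 0 dj] ij N(1) by auto
      have "hol (lab i j) (pt i j) (v \<otimes>\<^bsub>F\<^esub> c)" "hol (lab i j) (pt (i + di) (j + dj)) (v \<otimes>\<^bsub>F\<^esub> c)"
        using hol_x[of "lab 0 j" "real j / N" c] hol_x[of "lab 0 j" "real (j + dj) / N" c] c ij N(1)
        by (simp_all add: pt_def i lab_def del: of_nat_add)
      then show ?thesis by blast
    qed (use y ij in blast)
  qed
  define C where "C i j = (SOME c. hol (lab i j) (pt i j) c)" for i j
  have C0: "hol (lab i j) (pt i j) (C i j)" if "i \<le> N" "j \<le> N" for i j
    unfolding C_def by (rule someI_ex) (use edge[of i j 0 0] that in auto)
  have C: "hol (lab i j) (pt (i + di) (j + dj)) (C i j)"
    if "i \<le> N" "j \<le> N" "di \<le> 1" "dj \<le> 1" "i + di \<le> N" "j + dj \<le> N" for i j di dj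
    using edge[OF that] unique[OF pt C0] that by blast
  \<comment> \<open>Two cells with the same section that share a corner, namely \<open>pt (i + di) (j + dj)\<close>.\<close>
  have C_eq: "C i j = C i' j'"
    if "lab i j = lab i' j'" "i \<le> N" "j \<le> N" "di \<le> 1" "dj \<le> 1" "i + di \<le> N" "j + dj \<le> N"
      "i' \<le> N" "j' \<le> N" "di' \<le> 1" "dj' \<le> 1" "i + di = i' + di'" "j + dj = j' + dj'" for i j i' j' di dj di' dj'
    using unique[OF pt C C[of i' j' di' dj', folded that(1), folded that(12,13)]] that by simp
  have C_x: "C N j = v \<otimes>\<^bsub>F\<^esub> C 0 j" if j: "j \<le> N" for j
  proof (rule unique)
    show "pt N j \<in> unit_square" using pt j by simp
    show "hol (lab N j) (pt N j) (C N j)" using C0 j by simp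
    show "hol (lab N j) (pt N j) (v \<otimes>\<^bsub>F\<^esub> C 0 j)"
      using hol_x[of "lab 0 j" "real j / N" "C 0 j"] C0[of 0 j] j N(1) by (simp add: pt_def lab_def)
  qed
  have C_y: "C i N = C i 0 \<otimes>\<^bsub>F\<^esub> inv\<^bsub>F\<^esub> w" if i: "i \<le> N" for i
  proof (rule unique)
    show "pt i N \<in> unit_square" using pt i by simp
    show "hol (lab i N) (pt i N) (C i N)" using C0 i by simp
    show "hol (lab i N) (pt i N) (C i 0 \<otimes>\<^bsub>F\<^esub> inv\<^bsub>F\<^esub> w)"
      using hol_y[of "lab i 0" "real i / N" "C i 0"] C0[of i 0] i N(1) by (simp add: pt_def lab_def)
  qed
  have C_closed: "C i j \<in> carrier F" if "i \<le> N" "j \<le> N" for i j using closed[OF C0[OF that]] .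
  have pigeon: "lab i j = lab i' j' \<or> lab i' j' = lab i'' j'' \<or> lab i j = lab i'' j''" for i j i' j' i'' j''
    using lab[of i j] lab[of i' j'] lab[of i'' j''] by linarith
  let ?\<Phi> = "\<lambda>c. (\<kappa> c, \<mu> c)"
  have card: "card {?\<Phi> c, ?\<Phi> c', ?\<Phi> c''} \<le> 2" if "c = c' \<or> c' = c'' \<or> c = c''" for c c' c''
    using that by (auto simp: card_insert_if)
  show False
  proof (rule no_degenerate_grid[of N "\<lambda>i j. \<kappa> (C i j)" "\<lambda>i j. \<mu> (C i j)"])
    fix i j assume ij: "i < N" "j < N"
    have 1: "lab i j = lab (Suc i) j \<Longrightarrow> C i j = C (Suc i) j"
      "lab (Suc i) j = lab (Suc i) (Suc j) \<Longrightarrow> C (Suc i) j = C (Suc i) (Suc j)"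
      "lab i j = lab (Suc i) (Suc j) \<Longrightarrow> C i j = C (Suc i) (Suc j)"
      "lab i j = lab i (Suc j) \<Longrightarrow> C i j = C i (Suc j)"
      "lab i (Suc j) = lab (Suc i) (Suc j) \<Longrightarrow> C i (Suc j) = C (Suc i) (Suc j)"
      using ij C_eq[of i j "Suc i" j 1 1 0 1] C_eq[of "Suc i" j "Suc i" "Suc j" 0 1 0 0]
        C_eq[of i j "Suc i" "Suc j" 1 1 0 0] C_eq[of i j i "Suc j" 1 1 1 0]
        C_eq[of i "Suc j" "Suc i" "Suc j" 1 0 0 0] by simp_all
    show "card {?\<Phi> (C i j), ?\<Phi> (C (Suc i) j), ?\<Phi> (C (Suc i) (Suc j))} \<le> 2"
      using 1 pigeon by (intro card) blast
    show "card {?\<Phi> (C i j), ?\<Phi> (C i (Suc j)), ?\<Phi> (C (Suc i) (Suc j))} \<le> 2"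
      using 1 pigeon by (intro card) blast
  qed (use C_x C_y km_v km_w C_closed in simp_all)
qed

end

section \<open>The complexity of a homomorphism from the integers\<close>

context finite_rank_free_group
begin

text \<open>Enlarging a family of at most two sets by repeating its last member allows one to treat covers by one and by two
  sets alike.\<close>
theorem tc_power_derivation:
  assumes w: "w \<in> carrier F" "w \<noteq> \<one>\<^bsub>F\<^esub>" and ab: "a \<in> X" "b \<in> X" "a \<noteq> b"
  shows "tc integer_group F (trivial_action F) (power_derivation F w) = 2"
proof -
  define covered where "covered n \<longleftrightarrow> (\<exists>U :: nat \<Rightarrow> ('a letter list \<times> int) bar_point set.
     (\<forall>i\<le>n. openin E (U i)) \<and> (\<Union>i\<le>n. U i) = topspace E \<and>
     (\<forall>i\<le>n. \<exists>\<sigma>. continuous_map (subtopology E (U i)) (fibrewise_path_space E proj (sect w)) \<sigma> \<and>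
        (\<forall>y\<in>U i. \<sigma> y 1 = y)))" for n :: nat
  have tc: "tc integer_group F (trivial_action F) (power_derivation F w) = Inf {enat n | n. covered n}"
    unfolding tc_def parametrized_cat_def secat_def covered_def ..
  have "covered 2" unfolding covered_def by (rule three_set_cover[OF w(1)])
  moreover have "2 \<le> n" if cv: "covered n" for n
  proof (rule ccontr)
    assume "\<not> 2 \<le> n"
    then have n: "n \<le> 1" by simp
    obtain U where U: "\<forall>i\<le>n. openin E (U i)" "(\<Union>i\<le>n. U i) = topspace E"
      and sec: "\<forall>i\<le>n. \<exists>\<sigma>. continuous_map (subtopology E (U i))
        (fibrewise_path_space E proj (sect w)) \<sigma> \<and> (\<forall>y\<in>U i. \<sigma> y 1 = y)"
      using cv unfolding covered_def by (elim exE conjE) (rule that)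
    have "n = 0 \<or> n = 1" using n by auto
    then have "(\<lambda>l. min l n) ` {..1} = {..n}" by (elim disjE) (auto simp: atMost_Suc)
    then have "(\<Union>l\<le>1. U (min l n)) = (\<Union>i\<le>n. U i)" by (metis image_image)
    then have cov: "(\<Union>l\<le>1. U (min l n)) = topspace E" by (simp only: U(2))
    show False
      by (rule no_two_set_cover[OF w ab _ cov]) (intro U(1)[rule_format] sec[rule_format]; simp)+
  qed
  ultimately have "Inf {enat n | n. covered n} = enat 2"
    by (intro antisym Inf_lower Inf_greatest) auto
  then show ?thesis by (simp add: tc numeral_eq_enat)
qed

end

theorem proposition4p4:
  fixes w :: "nat letter list"
  assumes "w \<in> carrier F2" and "w \<noteq> \<one>\<^bsub>F2\<^esub>"
  shows "tc integer_group F2 (trivial_action F2) (power_derivation F2 w) = 2"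
proof -
  interpret finite_rank_free_group "{..<2 :: nat}"
    by unfold_locales simp
  show ?thesis
    using tc_power_derivation[of w 0 1] assms by (simp add: F2_def)
qed

end
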